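(* Let $d\geq2$ and $p\in[q_d,p_d]$. There exists a constant $C>0$ depending only on $d$ and $p$ such that, for every $\lambda>0$, $$\lambda^{1/4}\|u\|_{B_*}+\lambda^{\frac d2(\frac1p-\frac1{p_d})}\|u\|_{L^p}\leq C\|u\|_{X_\lambda^*}$$ for every $u\in\mathcal{S}(\mathbb{R}^d)$.
   Context: $\widehat f(\xi) = (2\pi)^{-d/2}\int_{\mathbb{R}^d} e^{-ix\cdot\xi} f(x)\,\mathrm{d}x$. $\mathbb{N}_0=\{0,1,2,\dots\}$; $D_0 = \{|x|\leq 1\}$, $D_j = \{2^{j-1}<|x|\leq 2^j\}$ for $j\geq 1$; $\|f\|_{B} = \sum_{j\in\mathbb{N}_0} 2^{j/2}\|f\|_{L^2(D_j)}$ and $\|f\|_{B_*}=\sup_{j\in\mathbb{N}_0}2^{-j/2}\|f\|_{L^2(D_j)}$. Exponents: $2/q_d = (d-1)/(d+1)$ for $d\geq2$; $1/p_d = 1/2-1/d$ for $d\geq3$ and $p_2=\infty$; $q_d',p_d'$ are their dual exponents. Littlewood–Paley projectors: $\phi\in\mathcal{S}(\mathbb{R}^d)$ supported in $\{|\xi|\leq2\}$ with $\phi=1$ on $\{|\xi|\leq1\}$, $\psi(\xi)=\phi(\xi)-\phi(2\xi)$, $\widehat{P_kf}(\xi)=\psi(\xi/2^k)\widehat f(\xi)$, $\widehat{P_{\leq k}f}(\xi)=\phi(\xi/2^k)\widehat f(\xi)$. Given $\lambda>0$, $m_\lambda(\xi) = |\lambda - |\xi|^2|$, $k_\lambda\in\mathbb{Z}$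 satisfies $2^{k_\lambda-1}<\lambda^{1/2}\leq2^{k_\lambda}$, $I=\{k_\lambda-2,k_\lambda-1,k_\lambda,k_\lambda+1\}$, $P_{<I}=P_{\leq k_\lambda-3}$. $Y_\lambda$ and $Z_\lambda$ are the spaces of tempered distributions for which the following norms are finite: $$\|f\|_{Y_\lambda}^2 = \|m_\lambda^{-1/2}\widehat{P_{<I} f}\|_{L^2}^2 + \sum_{k\in I} \lambda^{-1/2}\|P_k f\|_{B}^2 +\sum_{k > k_\lambda + 1}\|m_\lambda^{-1/2}\widehat{P_k f}\|_{L^2}^2,$$ $$\|g\|_{Z_\lambda}^2 = \|m_\lambda^{-1/2}\widehat{P_{<I} g}\|_{L^2}^2 + \sum_{k\in I} \lambda^{d(\frac{1}{q_d'}-\frac{1}{p_d'})}\|P_k g\|_{L^{q_d'}}^2 +\sum_{k > k_\lambda + 1}\|m_\lambda^{-1/2}\widehat{P_k g}\|_{L^2}^2.$$ $X_\lambda = Y_\lambda+Z_\lambda$ with $\|h\|_{X_\lambda}=\inf\{\|f\|_{Y_\lambda}+\|g\|_{Z_\lambda}: h=f+g\}$, and $X_\lambda^*$ is the Banach dual of $X_\lambda$ with its dual norm; since $\mathcal{S}(\mathbb{R}^d)$ is dense in $X_\lambda$, elements of $X_\lambda^*$ are identified with tempered distributions.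
   Formalization: For d=2 the endpoint p=p_2=∞ is excluded (only 6≤p<∞ is covered), because there the inequality fails: at high frequencies the X_λ^* norm is bounded by the H^1 norm, which does not control the sup norm in two dimensions. *)

theory Defs
  imports "HOL-Analysis.Analysis"
begin

section \<open>Schwartz functions and tempered distributions\<close>

text \<open>Iterated partial derivatives: the list names the coordinate directions, the head being
  the direction differentiated last.\<close>

fun iter_partial :: "'a list \<Rightarrow> ('a::euclidean_space \<Rightarrow> complex) \<Rightarrow> 'a \<Rightarrow> complex" where
  "iter_partial [] f = f"
| "iter_partial (b # bs) f = (\<lambda>x. frechet_derivative (iter_partial bs f) (at x) b)"

definition schwartz :: "('a::euclidean_space \<Rightarrow> complex) set" where
  "schwartz = {f. \<forall>bs \<in> lists Basis.
      (\<forall>x. iter_partial bs f differentiable at x) \<and>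
      (\<forall>n::nat. bounded (range (\<lambda>x. of_real (norm x ^ n) * iter_partial bs f x)))}"

text \<open>The seminorms for increasing \<open>N\<close> generate the usual Frechet topology of the Schwartz space;
  the suprema are only meaningful for Schwartz functions.\<close>

definition schwartz_seminorm :: "nat \<Rightarrow> ('a::euclidean_space \<Rightarrow> complex) \<Rightarrow> real" where
  "schwartz_seminorm N f =
     (\<Sum>n\<le>N. \<Sum>bs \<in> {bs. set bs \<subseteq> Basis \<and> length bs \<le> N}.
        SUP x. norm x ^ n * cmod (iter_partial bs f x))"

type_synonym 'a distr = "('a \<Rightarrow> complex) \<Rightarrow> complex"

text \<open>A tempered distribution is a continuous complex-linear functional on the Schwartz space.
  Functionals are total in HOL; the value \<open>0\<close> outside the Schwartz space makes equality of
  distributions coincide with equality of the HOL functions.\<close>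

definition tempered :: "'a::euclidean_space distr set" where
  "tempered = {T.
     (\<forall>f\<in>schwartz. \<forall>g\<in>schwartz. T (\<lambda>x. f x + g x) = T f + T g) \<and>
     (\<forall>c. \<forall>f\<in>schwartz. T (\<lambda>x. c * f x) = c * T f) \<and>
     (\<exists>C N. \<forall>f\<in>schwartz. cmod (T f) \<le> C * schwartz_seminorm N f) \<and>
     (\<forall>f. f \<notin> schwartz \<longrightarrow> T f = 0)}"

definition distr_of :: "('a::euclidean_space \<Rightarrow> complex) \<Rightarrow> 'a distr" where
  "distr_of u = (\<lambda>f. if f \<in> schwartz then LINT x|lborel. u x * f x else 0)"

definition distr_add :: "'a distr \<Rightarrow> 'a distr \<Rightarrow> 'a distr" where
  "distr_add S T = (\<lambda>f. S f + T f)"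

definition distr_scale :: "complex \<Rightarrow> 'a distr \<Rightarrow> 'a distr" where
  "distr_scale c T = (\<lambda>f. c * T f)"


section \<open>Fourier transform and Fourier multipliers\<close>

definition fourier :: "('a::euclidean_space \<Rightarrow> complex) \<Rightarrow> 'a \<Rightarrow> complex" where
  "fourier f \<xi> = of_real ((2 * pi) powr (- real DIM('a) / 2)) *
     (LINT x|lborel. exp (- \<i> * of_real (x \<bullet> \<xi>)) * f x)"

definition inv_fourier :: "('a::euclidean_space \<Rightarrow> complex) \<Rightarrow> 'a \<Rightarrow> complex" where
  "inv_fourier f x = of_real ((2 * pi) powr (- real DIM('a) / 2)) *
     (LINT \<xi>|lborel. exp (\<i> * of_real (x \<bullet> \<xi>)) * f \<xi>)"

definition fourier_distr :: "'a::euclidean_space distr \<Rightarrow> 'a distr" where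
  "fourier_distr T = (\<lambda>f. if f \<in> schwartz then T (fourier f) else 0)"

definition inv_fourier_distr :: "'a::euclidean_space distr \<Rightarrow> 'a distr" where
  "inv_fourier_distr T = (\<lambda>f. if f \<in> schwartz then T (inv_fourier f) else 0)"

definition mult_distr :: "('a::euclidean_space \<Rightarrow> complex) \<Rightarrow> 'a distr \<Rightarrow> 'a distr" where
  "mult_distr a T = (\<lambda>f. if f \<in> schwartz then T (\<lambda>x. a x * f x) else 0)"

definition fourier_mult :: "('a::euclidean_space \<Rightarrow> complex) \<Rightarrow> 'a distr \<Rightarrow> 'a distr" where
  "fourier_mult a T = inv_fourier_distr (mult_distr a (fourier_distr T))"

definition LP_psi :: "('a::euclidean_space \<Rightarrow> complex) \<Rightarrow> 'a \<Rightarrow> complex" where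
  "LP_psi \<phi> \<xi> = \<phi> \<xi> - \<phi> (2 *\<^sub>R \<xi>)"

definition LP_proj :: "('a::euclidean_space \<Rightarrow> complex) \<Rightarrow> int \<Rightarrow> 'a distr \<Rightarrow> 'a distr" where
  "LP_proj \<phi> k = fourier_mult (\<lambda>\<xi>. LP_psi \<phi> (\<xi> /\<^sub>R (2 powi k)))"

definition LP_proj_le :: "('a::euclidean_space \<Rightarrow> complex) \<Rightarrow> int \<Rightarrow> 'a distr \<Rightarrow> 'a distr" where
  "LP_proj_le \<phi> k = fourier_mult (\<lambda>\<xi>. \<phi> (\<xi> /\<^sub>R (2 powi k)))"


section \<open>Norms of functions\<close>

text \<open>All norms take values in \<open>[0,\<infinity>]\<close>. The power below is used for positive exponents only.\<close>

definition enn_powr :: "ennreal \<Rightarrow> real \<Rightarrow> ennreal" where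
  "enn_powr x a = (if x = \<infinity> then \<infinity> else ennreal (enn2real x powr a))"

definition Lp_norm_on :: "real \<Rightarrow> 'a::euclidean_space set \<Rightarrow> ('a \<Rightarrow> complex) \<Rightarrow> ennreal" where
  "Lp_norm_on p S f =
     enn_powr (\<integral>\<^sup>+x. ennreal (cmod (f x) powr p) * indicator S x \<partial>lborel) (1 / p)"

abbreviation Lp_norm :: "real \<Rightarrow> ('a::euclidean_space \<Rightarrow> complex) \<Rightarrow> ennreal" where
  "Lp_norm p \<equiv> Lp_norm_on p UNIV"

definition dyadic_shell :: "nat \<Rightarrow> 'a::euclidean_space set" where
  "dyadic_shell j = (if j = 0 then {x. norm x \<le> 1} else {x. 2 ^ (j - 1) < norm x \<and> norm x \<le> 2 ^ j})"

definition B_norm :: "('a::euclidean_space \<Rightarrow> complex) \<Rightarrow> ennreal" where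
  "B_norm f = (\<Sum>j. ennreal (2 powr (real j / 2)) * Lp_norm_on 2 (dyadic_shell j) f)"

definition Bstar_norm :: "('a::euclidean_space \<Rightarrow> complex) \<Rightarrow> ennreal" where
  "Bstar_norm f = (SUP j. ennreal (2 powr (- real j / 2)) * Lp_norm_on 2 (dyadic_shell j) f)"

text \<open>A function norm applied to a tempered distribution: the norm of the (almost everywhere
  unique) function representing it, and \<open>\<infinity> = Inf {}\<close> if it is not given by a function.\<close>

definition represents :: "('a::euclidean_space \<Rightarrow> complex) \<Rightarrow> 'a distr \<Rightarrow> bool" where
  "represents g T \<longleftrightarrow> g \<in> borel_measurable lborel \<and>
     (\<forall>f\<in>schwartz. integrable lborel (\<lambda>x. g x * f x) \<and> T f = (LINT x|lborel. g x * f x))"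

definition distr_norm ::
    "(('a::euclidean_space \<Rightarrow> complex) \<Rightarrow> ennreal) \<Rightarrow> 'a distr \<Rightarrow> ennreal" where
  "distr_norm N T = (INF g \<in> {g. represents g T}. N g)"


section \<open>Exponents\<close>

definition q_exp :: "nat \<Rightarrow> real" where
  "q_exp d = 2 / ((real d - 1) / (real d + 1))"

definition p_exp :: "nat \<Rightarrow> ereal" where
  "p_exp d = (if d = 2 then \<infinity> else ereal (1 / (1 / 2 - 1 / real d)))"

text \<open>For \<open>d = 2\<close> the exponents between \<open>q_exp d\<close> and \<open>p_exp d\<close> considered are the real ones,
  \<open>6 \<le> p < \<infinity>\<close>. At \<open>p = \<infinity>\<close> the estimate would fail: for high frequencies the dual norm is
  bounded by the \<open>H^1\<close> norm, which does not control the supremum in two dimensions.\<close>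

text \<open>Reciprocal with \<open>1 / \<infinity> = 0\<close>, and the dual exponent \<open>1 / p' = 1 - 1 / p\<close>, which is
  finite for \<open>1 < p \<le> \<infinity>\<close>.\<close>

definition recip :: "ereal \<Rightarrow> real" where
  "recip p = real_of_ereal (1 / p)"

definition dual_exp :: "ereal \<Rightarrow> real" where
  "dual_exp p = 1 / (1 - recip p)"


section \<open>The spaces \<open>Y\<close>, \<open>Z\<close>, \<open>X\<close> and the dual of \<open>X\<close>\<close>

definition k_of :: "real \<Rightarrow> int" where
  "k_of l = (THE k. 2 powi (k - 1) < sqrt l \<and> sqrt l \<le> 2 powi k)"

lemma k_of_bounds:
  assumes "l > 0"
  shows "2 powi (k_of l - 1) < sqrt l" and "sqrt l \<le> 2 powi (k_of l)"
proof -
  have eq: "(2 powi (k - 1) < sqrt l \<and> sqrt l \<le> 2 powi k) \<longleftrightarrow> k = \<lceil>log 2 (sqrt l)\<rceil>" for k :: int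
  proof -
    have "(2::real) powi m = 2 powr real_of_int m" for m :: int
      by (simp add: powr_real_of_int')
    then have "(2 powi (k - 1) < sqrt l \<and> sqrt l \<le> 2 powi k) \<longleftrightarrow>
        real_of_int (k - 1) < log 2 (sqrt l) \<and> log 2 (sqrt l) \<le> real_of_int k"
      using assms by (simp add: less_log_iff log_le_iff)
    also have "\<dots> \<longleftrightarrow> k = \<lceil>log 2 (sqrt l)\<rceil>"
      by linarith
    finally show ?thesis .
  qed
  have "2 powi (k_of l - 1) < sqrt l \<and> sqrt l \<le> 2 powi (k_of l)"
    unfolding k_of_def by (rule theI') (auto simp: eq)
  then show "2 powi (k_of l - 1) < sqrt l" and "sqrt l \<le> 2 powi (k_of l)"
    by auto
qed

definition k_range :: "real \<Rightarrow> int set" where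
  "k_range l = {k_of l - 2, k_of l - 1, k_of l, k_of l + 1}"

definition LP_proj_below :: "('a::euclidean_space \<Rightarrow> complex) \<Rightarrow> real \<Rightarrow> 'a distr \<Rightarrow> 'a distr" where
  "LP_proj_below \<phi> l = LP_proj_le \<phi> (k_of l - 3)"

definition m_sym :: "real \<Rightarrow> 'a::euclidean_space \<Rightarrow> real" where
  "m_sym l \<xi> = \<bar>l - (norm \<xi>)\<^sup>2\<bar>"

text \<open>The function \<open>m_sym l powr (-1/2)\<close> takes the value \<open>0\<close> on the null set where
  \<open>m_sym l\<close> vanishes.\<close>

definition weighted_norm :: "real \<Rightarrow> 'a::euclidean_space distr \<Rightarrow> ennreal" where
  "weighted_norm l T =
     distr_norm (\<lambda>g. Lp_norm 2 (\<lambda>\<xi>. of_real (m_sym l \<xi> powr (- 1 / 2)) * g \<xi>)) (fourier_distr T)"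

definition Y_norm :: "('a::euclidean_space \<Rightarrow> complex) \<Rightarrow> real \<Rightarrow> 'a distr \<Rightarrow> ennreal" where
  "Y_norm \<phi> l f = enn_powr
     ((weighted_norm l (LP_proj_below \<phi> l f))\<^sup>2
      + (\<Sum>k\<in>k_range l. ennreal (l powr (- 1 / 2)) * (distr_norm B_norm (LP_proj \<phi> k f))\<^sup>2)
      + (\<Sum>\<^sub>\<infinity>k\<in>{k. k > k_of l + 1}. (weighted_norm l (LP_proj \<phi> k f))\<^sup>2)) (1 / 2)"

definition Z_norm :: "('a::euclidean_space \<Rightarrow> complex) \<Rightarrow> real \<Rightarrow> 'a distr \<Rightarrow> ennreal" where
  "Z_norm \<phi> l g = enn_powr
     ((weighted_norm l (LP_proj_below \<phi> l g))\<^sup>2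
      + (\<Sum>k\<in>k_range l.
           ennreal (l powr (real DIM('a) * (1 / dual_exp (q_exp DIM('a)) - 1 / dual_exp (p_exp DIM('a)))))
           * (distr_norm (Lp_norm (dual_exp (q_exp DIM('a)))) (LP_proj \<phi> k g))\<^sup>2)
      + (\<Sum>\<^sub>\<infinity>k\<in>{k. k > k_of l + 1}. (weighted_norm l (LP_proj \<phi> k g))\<^sup>2)) (1 / 2)"

definition Y_space :: "('a::euclidean_space \<Rightarrow> complex) \<Rightarrow> real \<Rightarrow> 'a distr set" where
  "Y_space \<phi> l = {f \<in> tempered. Y_norm \<phi> l f < \<infinity>}"

definition Z_space :: "('a::euclidean_space \<Rightarrow> complex) \<Rightarrow> real \<Rightarrow> 'a distr set" where
  "Z_space \<phi> l = {g \<in> tempered. Z_norm \<phi> l g < \<infinity>}"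

definition X_space :: "('a::euclidean_space \<Rightarrow> complex) \<Rightarrow> real \<Rightarrow> 'a distr set" where
  "X_space \<phi> l = {distr_add f g | f g. f \<in> Y_space \<phi> l \<and> g \<in> Z_space \<phi> l}"

definition X_norm :: "('a::euclidean_space \<Rightarrow> complex) \<Rightarrow> real \<Rightarrow> 'a distr \<Rightarrow> ennreal" where
  "X_norm \<phi> l h = (INF (f, g) \<in> {(f, g). f \<in> Y_space \<phi> l \<and> g \<in> Z_space \<phi> l \<and> h = distr_add f g}.
     Y_norm \<phi> l f + Z_norm \<phi> l g)"

text \<open>Values of functionals outside \<open>X_space\<close> are irrelevant below.\<close>

definition dual_norm ::
    "('a::euclidean_space \<Rightarrow> complex) \<Rightarrow> real \<Rightarrow> ('a distr \<Rightarrow> complex) \<Rightarrow> ennreal" where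
  "dual_norm \<phi> l L = (SUP h \<in> {h \<in> X_space \<phi> l. X_norm \<phi> l h \<le> 1}. ennreal (cmod (L h)))"

definition X_dual :: "('a::euclidean_space \<Rightarrow> complex) \<Rightarrow> real \<Rightarrow> ('a distr \<Rightarrow> complex) set" where
  "X_dual \<phi> l = {L.
     (\<forall>g\<in>X_space \<phi> l. \<forall>h\<in>X_space \<phi> l. L (distr_add g h) = L g + L h) \<and>
     (\<forall>c. \<forall>h\<in>X_space \<phi> l. L (distr_scale c h) = c * L h) \<and>
     dual_norm \<phi> l L < \<infinity>}"

text \<open>A functional \<open>L\<close> in the dual is identified with the tempered distribution
  \<open>f \<mapsto> L (distr_of f)\<close> on Schwartz functions. By density of these in \<open>X_space\<close>, at most one
  functional (up to its values outside \<open>X_space\<close>) corresponds to a given distribution, and the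
  infimum below is its dual norm; it is \<open>\<infinity>\<close> for distributions that are not in the dual.\<close>

definition Xstar_norm :: "('a::euclidean_space \<Rightarrow> complex) \<Rightarrow> real \<Rightarrow> 'a distr \<Rightarrow> ennreal" where
  "Xstar_norm \<phi> l T =
     (INF L \<in> {L \<in> X_dual \<phi> l. \<forall>f\<in>schwartz. L (distr_of f) = T f}. dual_norm \<phi> l L)"

end

theory Submission
  imports Defs "HOL-Probability.Sinc_Integral" "HOL-Probability.Characteristic_Functions"
begin

text \<open>Duality turns the estimate into bounds for the norm of \<open>X\<close> on test functions. If a functional
\<open>L\<close> on \<open>X\<close> is given by \<open>f \<mapsto> \<integral> u f\<close> on Schwartz functions, then \<open>\<bar>\<integral> u f\<bar> \<le> \<parallel>L\<parallel> \<parallel>f\<parallel>\<^sub>X\<close>; and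
\<open>\<parallel>f\<parallel>\<^sub>X\<close> is at most the norm of \<open>f\<close> in \<open>Y\<close> and at most its norm in \<open>Z\<close>, because \<open>f = f + 0 = 0 + f\<close>.
It remains to choose \<open>f\<close> and to estimate one of the two norms. The Littlewood--Paley pieces of a Schwartz
function \<open>f\<close> have explicit representing functions (\<open>represents_fmul\<close>), which give upper bounds for these norms.

For the \<open>B\<^sub>*\<close> norm on the shell \<open>\<bar>x\<bar> \<sim> 2\<^sup>j\<close> the test function is a cutoff to the ball of radius
\<open>R = 2\<^sup>j\<^sup>+\<^sup>1\<close> times \<open>cnj u\<close>, and the claim is \<open>\<parallel>f\<parallel>\<^sub>Y \<le> C \<lambda>\<^bsup>-1/4\<^esup> R\<^bsup>1/2\<^esup> \<parallel>f\<parallel>\<^sub>2\<close>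
(\<open>Y_norm_compact_support\<close>). Its source is the uncertainty principle \<open>local_energy\<close>: of a function supported
in a ball of radius \<open>R\<close>, at most a fraction \<open>min 1 (s R)\<close> of the energy, up to a constant, lies at frequencies of
size at most \<open>s\<close>. Away from the sphere \<open>\<bar>\<xi>\<bar> = \<lambda>\<^bsup>1/2\<^esup>\<close> the symbol \<open>m\<close> is comparable to \<open>\<lambda>\<close> for low and to
\<open>4\<^sup>k\<close> for high frequencies, so this settles the weighted terms. For the frequencies near the sphere the \<open>B\<close> norm
is interpolated between the \<open>L\<^sup>2\<close> norm and the first moment (\<open>B_norm_le\<close>).

For the \<open>L\<^sup>p\<close> norm the test function approximates \<open>\<bar>u\<bar>\<^bsup>p-2\<^esup> cnj u\<close>, and the claim is
\<open>\<parallel>f\<parallel>\<^sub>Z \<le> C \<lambda>\<^bsup>-e\<^esup> \<parallel>f\<parallel>\<^sub>t\<close> with \<open>t\<close> dual to \<open>p\<close> (\<open>Z_norm_Lp\<close>). Low and middle frequencies follow from Bernstein's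
inequality (\<open>bernstein\<close>). At high frequencies Bernstein's inequality gives a geometric series if \<open>p < p\<^sub>d\<close>. At
\<open>p = p\<^sub>d\<close> all dyadic pieces have bounds of the same size, and their sum is the dual form of the Sobolev inequality
(\<open>endpoint_sobolev\<close>): at frequency \<open>2\<^sup>k\<close> the values of \<open>\<bar>f\<bar>\<close> above and below the height \<open>2\<^bsup>(d+2)k/2\<^esup>\<close> are treated
differently, and the resulting sum over \<open>k\<close> converges pointwise to a multiple of \<open>\<bar>f\<bar>\<^sup>t\<close>.

The Fourier analysis behind this consists of the invariance of the Schwartz space, the inversion formula and
Plancherel's theorem; the last two follow from the multiplication formula \<open>\<integral> \<F> f g = \<integral> f \<F> g\<close>.\<close>

section \<open>The Schwartz space\<close>

abbreviation partial :: "'a \<Rightarrow> ('a::euclidean_space \<Rightarrow> complex) \<Rightarrow> 'a \<Rightarrow> complex" where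
  "partial b f \<equiv> (\<lambda>x. frechet_derivative f (at x) b)"

definition rapid :: "('a::euclidean_space \<Rightarrow> complex) \<Rightarrow> bool" where
  "rapid f \<longleftrightarrow> (\<forall>n::nat. \<exists>C. \<forall>x. norm x ^ n * cmod (f x) \<le> C)"

lemma pd_eq: "(f has_derivative f') (at x) \<Longrightarrow> partial b f x = f' b"
  using frechet_derivative_at by metis

lemma rapid_iff_bounded:
  "rapid f \<longleftrightarrow> (\<forall>n::nat. bounded (range (\<lambda>x. of_real (norm x ^ n) * f x)))"
  by (simp add: rapid_def bounded_iff norm_mult norm_power)

text \<open>The Schwartz space is the largest set of rapidly decreasing differentiable functions that is closed under
partial derivatives. A function therefore belongs to it as soon as it lies in some set of such functions with this
closure property; to prove closure properties of the space one exhibits such a set.\<close>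

lemma schwartz_coinduct:
  assumes f: "f \<in> S"
    and diff: "\<And>f x. f \<in> S \<Longrightarrow> f differentiable at x"
    and rapid: "\<And>f. f \<in> S \<Longrightarrow> rapid f"
    and partial: "\<And>f b. f \<in> S \<Longrightarrow> b \<in> Basis \<Longrightarrow> partial b f \<in> S"
  shows "f \<in> schwartz"
proof -
  have "iter_partial bs f \<in> S" if "bs \<in> lists Basis" for bs
    using that by (induction bs) (use f partial in auto)
  then show ?thesis
    using diff rapid unfolding schwartz_def rapid_iff_bounded by blast
qed

lemma iter_partial_snoc: "iter_partial (bs @ [b]) f = iter_partial bs (partial b f)"
  by (induction bs) auto

lemma schwartz_pd:
  assumes "f \<in> schwartz" "b \<in> Basis"
  shows "partial b f \<in> schwartz"
proof -
  have "(\<forall>x. iter_partial bs (partial b f) differentiable at x) \<and>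
      (\<forall>n::nat. bounded (range (\<lambda>x. of_real (norm x ^ n) * iter_partial bs (partial b f) x)))"
    if "bs \<in> lists Basis" for bs
  proof -
    have "bs @ [b] \<in> lists Basis" using that assms(2) by auto
    then show ?thesis
      using assms(1) unfolding schwartz_def mem_Collect_eq iter_partial_snoc[symmetric] by blast
  qed
  then show ?thesis unfolding schwartz_def by blast
qed

lemma schwartz_diff: "f \<in> schwartz \<Longrightarrow> f differentiable at x"
  unfolding schwartz_def by (auto dest!: bspec[where x="[]"])

lemma schwartz_rapid: "f \<in> schwartz \<Longrightarrow> rapid f"
  unfolding schwartz_def rapid_iff_bounded by (auto dest!: bspec[where x="[]"])

lemma schwartz_has_derivative:
  "f \<in> schwartz \<Longrightarrow> (f has_derivative frechet_derivative f (at x)) (at x)"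
  using frechet_derivative_works schwartz_diff by blast

lemma schwartz_continuous: "f \<in> schwartz \<Longrightarrow> continuous_on A f"
  using schwartz_diff by (meson differentiable_imp_continuous_within continuous_at_imp_continuous_on)

lemma schwartz_measurable: "f \<in> schwartz \<Longrightarrow> f \<in> borel_measurable borel"
  by (rule borel_measurable_continuous_onI[OF schwartz_continuous])

lemma rapidE:
  assumes "rapid f"
  obtains C where "\<And>x. norm x ^ n * cmod (f x) \<le> C" "C > 0"
proof -
  obtain C where "\<And>x. norm x ^ n * cmod (f x) \<le> C"
    using assms unfolding rapid_def by blast
  then have "\<And>x. norm x ^ n * cmod (f x) \<le> max C 1"
    by (meson max.coboundedI1)
  then show ?thesis
    using that[of "max C 1"] by auto
qed

lemma rapidI: "(\<And>n::nat. \<exists>C. \<forall>x. norm x ^ n * cmod (f x) \<le> C) \<Longrightarrow> rapid f"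
  by (auto simp: rapid_def)

lemma rapid_add: "rapid f \<Longrightarrow> rapid g \<Longrightarrow> rapid (\<lambda>x. f x + g x)"
proof (rule rapidI)
  fix n assume "rapid f" "rapid g"
  then obtain C D where C: "\<And>x. norm x ^ n * cmod (f x) \<le> C" and D: "\<And>x. norm x ^ n * cmod (g x) \<le> D"
    by (metis rapidE)
  have "norm x ^ n * cmod (f x + g x) \<le> C + D" for x
  proof -
    have "norm x ^ n * cmod (f x + g x) \<le> norm x ^ n * (cmod (f x) + cmod (g x))"
      by (intro mult_left_mono norm_triangle_ineq) auto
    also have "\<dots> \<le> C + D" using C[of x] D[of x] by (simp add: algebra_simps)
    finally show ?thesis .
  qed
  then show "\<exists>C. \<forall>x. norm x ^ n * cmod (f x + g x) \<le> C" by blast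
qed

lemma rapid_poly_mult:
  assumes f: "rapid f" and g: "\<And>x. cmod (g x) \<le> K * (1 + norm x)"
  shows "rapid (\<lambda>x. g x * f x)"
proof (rule rapidI)
  fix n
  obtain C where C: "\<And>x. norm x ^ n * cmod (f x) \<le> C" by (metis rapidE f)
  obtain D where D: "\<And>x. norm x ^ (Suc n) * cmod (f x) \<le> D" by (metis rapidE f)
  have K: "K \<ge> 0" using order_trans[OF norm_ge_zero g[of 0]] by simp
  have "norm x ^ n * cmod (g x * f x) \<le> K * (C + D)" for x
  proof -
    have "norm x ^ n * cmod (g x * f x) \<le> norm x ^ n * ((K * (1 + norm x)) * cmod (f x))"
      unfolding norm_mult by (intro mult_left_mono mult_right_mono g) auto
    also have "\<dots> = K * (norm x ^ n * cmod (f x) + norm x ^ (Suc n) * cmod (f x))"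
      by (simp add: algebra_simps)
    also have "\<dots> \<le> K * (C + D)" using C[of x] D[of x] K by (intro mult_left_mono add_mono) auto
    finally show ?thesis .
  qed
  then show "\<exists>C. \<forall>x. norm x ^ n * cmod (g x * f x) \<le> C" by blast
qed

lemma rapid_bdd_mult:
  assumes f: "rapid f" and g: "\<And>x. cmod (g x) \<le> K"
  shows "rapid (\<lambda>x. g x * f x)"
proof (rule rapid_poly_mult[OF f])
  have "K \<ge> 0" using order_trans[OF norm_ge_zero g] .
  then show "cmod (g x) \<le> K * (1 + norm x)" for x
    using order_trans[OF g[of x]] by (simp add: algebra_simps)
qed

lemma schwartz_bdd:
  assumes "f \<in> schwartz"
  obtains M where "\<And>x. cmod (f x) \<le> M" "M > 0"
  using rapidE[OF schwartz_rapid[OF assms], of 0] by auto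

text \<open>In applications a derivative is computed as a linear map depending on the point; its values at the basis
vectors are then the partial derivatives.\<close>

lemma schwartz_coinduct_derivative:
  fixes S :: "('a::euclidean_space \<Rightarrow> complex) set"
  assumes f: "f \<in> S"
    and rapid: "\<And>f. f \<in> S \<Longrightarrow> rapid f"
    and deriv: "\<And>f. f \<in> S \<Longrightarrow>
      \<exists>f'. (\<forall>x. (f has_derivative f' x) (at x)) \<and> (\<forall>b\<in>Basis. (\<lambda>x. f' x b) \<in> S)"
  shows "f \<in> schwartz"
proof (rule schwartz_coinduct[OF f _ rapid])
  fix f x assume "f \<in> S"
  then show "f differentiable at x" using deriv unfolding differentiable_def by blast
next
  fix f and b :: 'a assume "f \<in> S" and b: "b \<in> Basis"
  then obtain f' where f': "\<And>x. (f has_derivative f' x) (at x)" "(\<lambda>x. f' x b) \<in> S"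
    using deriv by blast
  have "partial b f = (\<lambda>x. f' x b)" using pd_eq[OF f'(1)] by (rule ext)
  then show "partial b f \<in> S" using f'(2) by simp
qed

lemma schwartz_add:
  assumes "f \<in> schwartz" "g \<in> schwartz"
  shows "(\<lambda>x. f x + g x) \<in> schwartz"
proof -
  define S :: "('a \<Rightarrow> complex) set" where "S = {(\<lambda>x. f x + g x) | f g. f \<in> schwartz \<and> g \<in> schwartz}"
  have SI: "(\<lambda>x. f x + g x) \<in> S" if "f \<in> schwartz" "g \<in> schwartz" for f g
    using that unfolding S_def by blast
  show ?thesis
  proof (rule schwartz_coinduct_derivative[OF SI[OF assms]])
    fix h assume "h \<in> S"
    then obtain f g where h: "h = (\<lambda>x. f x + g x)" and f: "f \<in> schwartz" and g: "g \<in> schwartz"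
      unfolding S_def by blast
    show "rapid h" unfolding h by (intro rapid_add schwartz_rapid f g)
    have "(h has_derivative (\<lambda>k. frechet_derivative f (at x) k + frechet_derivative g (at x) k)) (at x)" for x
      unfolding h by (intro derivative_intros schwartz_has_derivative f g)
    moreover have "(\<lambda>x. frechet_derivative f (at x) b + frechet_derivative g (at x) b) \<in> S"
      if "b \<in> Basis" for b
      by (intro SI schwartz_pd f g that)
    ultimately show "\<exists>h'. (\<forall>x. (h has_derivative h' x) (at x)) \<and> (\<forall>b\<in>Basis. (\<lambda>x. h' x b) \<in> S)"
      by (intro exI[of _ "\<lambda>x k. frechet_derivative f (at x) k + frechet_derivative g (at x) k"]) simp
  qed
qed

lemma schwartz_scale:
  assumes "f \<in> schwartz"
  shows "(\<lambda>x. c * f x) \<in> schwartz"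
proof -
  define S :: "('a \<Rightarrow> complex) set" where "S = {(\<lambda>x. c * f x) | f. f \<in> schwartz}"
  have SI: "(\<lambda>x. c * f x) \<in> S" if "f \<in> schwartz" for f
    using that unfolding S_def by blast
  show ?thesis
  proof (rule schwartz_coinduct_derivative[OF SI[OF assms]])
    fix h assume "h \<in> S"
    then obtain f where h: "h = (\<lambda>x. c * f x)" and f: "f \<in> schwartz"
      unfolding S_def by blast
    show "rapid h" unfolding h by (rule rapid_bdd_mult[OF schwartz_rapid[OF f] order_refl])
    have "(h has_derivative (\<lambda>k. c * frechet_derivative f (at x) k)) (at x)" for x
      unfolding h by (intro derivative_intros schwartz_has_derivative f)
    moreover have "(\<lambda>x. c * frechet_derivative f (at x) b) \<in> S" if "b \<in> Basis" for b
      by (intro SI schwartz_pd f that)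
    ultimately show "\<exists>h'. (\<forall>x. (h has_derivative h' x) (at x)) \<and> (\<forall>b\<in>Basis. (\<lambda>x. h' x b) \<in> S)"
      by (intro exI[of _ "\<lambda>x k. c * frechet_derivative f (at x) k"]) simp
  qed
qed

text \<open>Derivatives of a product are sums of products, so the coinduction is over all such sums.\<close>

inductive_set schwartz_prods :: "('a::euclidean_space \<Rightarrow> complex) set" where
  prod: "f \<in> schwartz \<Longrightarrow> g \<in> schwartz \<Longrightarrow> (\<lambda>x. f x * g x) \<in> schwartz_prods"
| add: "u \<in> schwartz_prods \<Longrightarrow> v \<in> schwartz_prods \<Longrightarrow> (\<lambda>x. u x + v x) \<in> schwartz_prods"

lemma schwartz_mult:
  assumes "f \<in> schwartz" "g \<in> schwartz"
  shows "(\<lambda>x. f x * g x) \<in> schwartz"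
proof (rule schwartz_coinduct[where S=schwartz_prods])
  show "(\<lambda>x. f x * g x) \<in> schwartz_prods" using assms by (rule schwartz_prods.prod)
next
  fix h :: "'a \<Rightarrow> complex" and x assume "h \<in> schwartz_prods"
  then show "h differentiable at x"
    by induction (auto intro: differentiable_add differentiable_mult schwartz_diff)
next
  fix h :: "'a \<Rightarrow> complex" assume "h \<in> schwartz_prods"
  then show "rapid h"
  proof induction
    case (prod f g)
    then show ?case by (metis rapid_bdd_mult schwartz_bdd schwartz_rapid)
  qed (rule rapid_add)
next
  fix h :: "'a \<Rightarrow> complex" and b :: 'a assume h: "h \<in> schwartz_prods" and b: "b \<in> Basis"
  have "(\<forall>x. h differentiable at x) \<and> partial b h \<in> schwartz_prods" using h
  proof induction
    case (prod f g)
    have "partial b (\<lambda>x. f x * g x) = (\<lambda>x. f x * partial b g x + partial b f x * g x)"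
      by (intro ext pd_eq derivative_intros schwartz_has_derivative prod)
    moreover have "(\<lambda>x. f x * partial b g x + partial b f x * g x) \<in> schwartz_prods"
      by (rule schwartz_prods.add[OF schwartz_prods.prod schwartz_prods.prod]) (intro schwartz_pd prod b)+
    ultimately show ?case
      using prod by (simp add: differentiable_mult schwartz_diff)
  next
    case (add u v)
    have "partial b (\<lambda>x. u x + v x) = (\<lambda>x. partial b u x + partial b v x)"
      using add by (intro ext pd_eq derivative_intros) (auto simp: frechet_derivative_works[symmetric])
    moreover have "(\<lambda>x. partial b u x + partial b v x) \<in> schwartz_prods"
      by (rule schwartz_prods.add) (use add in auto)
    ultimately show ?case
      using add by (simp add: differentiable_add)
  qed
  then show "partial b h \<in> schwartz_prods" by blast
qed

lemma schwartz_cnj: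
  assumes "f \<in> schwartz"
  shows "(\<lambda>x. cnj (f x)) \<in> schwartz"
proof -
  define S :: "('a \<Rightarrow> complex) set" where "S = {(\<lambda>x. cnj (f x)) | f. f \<in> schwartz}"
  have SI: "(\<lambda>x. cnj (f x)) \<in> S" if "f \<in> schwartz" for f
    using that unfolding S_def by blast
  show ?thesis
  proof (rule schwartz_coinduct_derivative[OF SI[OF assms]])
    fix h assume "h \<in> S"
    then obtain f where h: "h = (\<lambda>x. cnj (f x))" and f: "f \<in> schwartz"
      unfolding S_def by blast
    show "rapid h" unfolding h using schwartz_rapid[OF f] by (simp add: rapid_def)
    have "(h has_derivative (\<lambda>k. cnj (frechet_derivative f (at x) k))) (at x)" for x
      unfolding h by (intro has_derivative_cnj schwartz_has_derivative f)
    moreover have "(\<lambda>x. cnj (frechet_derivative f (at x) b)) \<in> S" if "b \<in> Basis" for b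
      by (intro SI schwartz_pd f that)
    ultimately show "\<exists>h'. (\<forall>x. (h has_derivative h' x) (at x)) \<and> (\<forall>b\<in>Basis. (\<lambda>x. h' x b) \<in> S)"
      by (intro exI[of _ "\<lambda>x k. cnj (frechet_derivative f (at x) k)"]) simp
  qed
qed

lemma schwartz_zero: "(\<lambda>x. 0) \<in> schwartz"
  by (rule schwartz_coinduct_derivative[where S="{\<lambda>x. 0}"])
     (auto simp: rapid_def intro!: exI[of _ "\<lambda>x k. 0"])

text \<open>A derivative of \<open>x\<^sub>b f\<close> is \<open>x\<^sub>b\<close> times a derivative of \<open>f\<close> plus a multiple of \<open>f\<close>; hence the set of all functions
\<open>x\<^sub>b f + g\<close>.\<close>

lemma schwartz_coord:
  assumes "f \<in> schwartz" "b \<in> Basis"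
  shows "(\<lambda>x. of_real (x \<bullet> b) * f x) \<in> schwartz"
proof -
  define S :: "('a \<Rightarrow> complex) set" where
    "S = {(\<lambda>x. of_real (x \<bullet> b) * f x + g x) | f g. f \<in> schwartz \<and> g \<in> schwartz}"
  have SI: "(\<lambda>x. of_real (x \<bullet> b) * f x + g x) \<in> S" if "f \<in> schwartz" "g \<in> schwartz" for f g
    using that unfolding S_def by blast
  have "(\<lambda>x. of_real (x \<bullet> b) * f x + 0) \<in> S" by (intro SI assms schwartz_zero)
  then have "(\<lambda>x. of_real (x \<bullet> b) * f x) \<in> S" by simp
  then show ?thesis
  proof (rule schwartz_coinduct_derivative)
    fix h assume "h \<in> S"
    then obtain f g where h: "h = (\<lambda>x. of_real (x \<bullet> b) * f x + g x)"
      and f: "f \<in> schwartz" and g: "g \<in> schwartz" unfolding S_def by blast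
    have "cmod (of_real (x \<bullet> b)) \<le> 1 * (1 + norm x)" for x
      using Basis_le_norm[OF assms(2), of x] by simp
    then show "rapid h" unfolding h
      by (intro rapid_add rapid_poly_mult schwartz_rapid f g)
    define h' where "h' = (\<lambda>x k. of_real (x \<bullet> b) * frechet_derivative f (at x) k
        + (of_real (k \<bullet> b) * f x + frechet_derivative g (at x) k))"
    have "(h has_derivative h' x) (at x)" for x
      unfolding h h'_def add.assoc[symmetric]
      by (intro derivative_intros schwartz_has_derivative f g)
    moreover have "(\<lambda>x. h' x c) \<in> S" if "c \<in> Basis" for c
      unfolding h'_def by (intro SI schwartz_add schwartz_scale schwartz_pd f g that)
    ultimately show "\<exists>h'. (\<forall>x. (h has_derivative h' x) (at x)) \<and> (\<forall>b\<in>Basis. (\<lambda>x. h' x b) \<in> S)"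
      by blast
  qed
qed

lemma schwartz_dilate:
  assumes "f \<in> schwartz" "c \<noteq> 0"
  shows "(\<lambda>x. f (c *\<^sub>R x)) \<in> schwartz"
proof -
  define S :: "('a \<Rightarrow> complex) set" where "S = {(\<lambda>x. f (c *\<^sub>R x)) | f. f \<in> schwartz}"
  have SI: "(\<lambda>x. f (c *\<^sub>R x)) \<in> S" if "f \<in> schwartz" for f
    using that unfolding S_def by blast
  show ?thesis
  proof (rule schwartz_coinduct_derivative[OF SI[OF assms(1)]])
    fix h assume "h \<in> S"
    then obtain f where h: "h = (\<lambda>x. f (c *\<^sub>R x))" and f: "f \<in> schwartz"
      unfolding S_def by blast
    show "rapid h"
    proof (rule rapidI)
      fix n
      obtain C where C: "\<And>x. norm x ^ n * cmod (f x) \<le> C" by (metis rapidE schwartz_rapid[OF f])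
      have "norm x ^ n * cmod (h x) \<le> C / \<bar>c\<bar> ^ n" for x
        using C[of "c *\<^sub>R x"] assms(2) by (simp add: h field_simps power_mult_distrib)
      then show "\<exists>C. \<forall>x. norm x ^ n * cmod (h x) \<le> C" by blast
    qed
    have "(h has_derivative (\<lambda>k. frechet_derivative f (at (c *\<^sub>R x)) (c *\<^sub>R k))) (at x)" for x
      unfolding h by (rule has_derivative_compose[OF _ schwartz_has_derivative[OF f]])
        (auto intro!: derivative_eq_intros)
    then have "(h has_derivative (\<lambda>k. of_real c * frechet_derivative f (at (c *\<^sub>R x)) k)) (at x)" for x
      using linear_cmul[OF has_derivative_linear[OF schwartz_has_derivative[OF f]]]
      by (simp add: scaleR_conv_of_real)
    moreover have "(\<lambda>x. of_real c * frechet_derivative f (at (c *\<^sub>R x)) b) \<in> S" if "b \<in> Basis" for b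
      by (rule SI[of "\<lambda>x. of_real c * frechet_derivative f (at x) b"]) (intro schwartz_scale schwartz_pd f that)
    ultimately show "\<exists>h'. (\<forall>x. (h has_derivative h' x) (at x)) \<and> (\<forall>b\<in>Basis. (\<lambda>x. h' x b) \<in> S)"
      by (intro exI[of _ "\<lambda>x k. of_real c * frechet_derivative f (at (c *\<^sub>R x)) k"]) simp
  qed
qed

lemma schwartz_modulate:
  assumes "f \<in> schwartz"
  shows "(\<lambda>x. exp (- \<i> * of_real (x \<bullet> \<xi>)) * f x) \<in> schwartz"
proof -
  define S :: "('a \<Rightarrow> complex) set" where
    "S = {(\<lambda>x. exp (- \<i> * of_real (x \<bullet> \<xi>)) * f x) | f. f \<in> schwartz}"
  have SI: "(\<lambda>x. exp (- \<i> * of_real (x \<bullet> \<xi>)) * f x) \<in> S" if "f \<in> schwartz" for f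
    using that unfolding S_def by blast
  show ?thesis
  proof (rule schwartz_coinduct_derivative[OF SI[OF assms]])
    fix h assume "h \<in> S"
    then obtain f where h: "h = (\<lambda>x. exp (- \<i> * of_real (x \<bullet> \<xi>)) * f x)" and f: "f \<in> schwartz"
      unfolding S_def by blast
    show "rapid h" unfolding h
      by (rule rapid_bdd_mult[where K=1, OF schwartz_rapid[OF f]]) (simp add: norm_exp_eq_Re)
    have e: "((\<lambda>x. exp (- \<i> * of_real (x \<bullet> \<xi>))) has_derivative
       (\<lambda>h. (- \<i> * of_real (h \<bullet> \<xi>)) * exp (- \<i> * of_real (x \<bullet> \<xi>)))) (at x)" for x
      by (rule has_derivative_compose[where g=exp and f="\<lambda>x. - \<i> * of_real (x \<bullet> \<xi>)",
          OF _ DERIV_exp[unfolded has_field_derivative_def], THEN has_derivative_eq_rhs])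
         (auto intro!: derivative_eq_intros simp: algebra_simps)
    have "(h has_derivative (\<lambda>k. exp (- \<i> * of_real (x \<bullet> \<xi>)) *
       (frechet_derivative f (at x) k + (- \<i> * of_real (k \<bullet> \<xi>)) * f x))) (at x)" for x
      unfolding h
      by (rule has_derivative_mult[OF e schwartz_has_derivative[OF f], THEN has_derivative_eq_rhs])
         (simp add: algebra_simps)
    moreover have "(\<lambda>x. exp (- \<i> * of_real (x \<bullet> \<xi>)) *
       (frechet_derivative f (at x) b + (- \<i> * of_real (b \<bullet> \<xi>)) * f x)) \<in> S" if "b \<in> Basis" for b
      by (intro SI schwartz_add schwartz_scale schwartz_pd f that)
    ultimately show "\<exists>h'. (\<forall>x. (h has_derivative h' x) (at x)) \<and> (\<forall>b\<in>Basis. (\<lambda>x. h' x b) \<in> S)"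
      by (intro exI[of _ "\<lambda>x k. exp (- \<i> * of_real (x \<bullet> \<xi>)) *
       (frechet_derivative f (at x) k + (- \<i> * of_real (k \<bullet> \<xi>)) * f x)"]) simp
  qed
qed

subsection \<open>Integrability\<close>

text \<open>Functions with separated variables provide both the majorant for the decay of Schwartz functions and the
Fourier transform of the Gaussian.\<close>

lemma prod_lborel_integrable:
  fixes g :: "'a::euclidean_space \<Rightarrow> real \<Rightarrow> 'c::{real_normed_field,banach,second_countable_topology}"
  assumes "\<And>b. b \<in> Basis \<Longrightarrow> integrable lborel (g b)"
  shows "integrable lborel (\<lambda>x::'a. \<Prod>b\<in>Basis. g b (x \<bullet> b))"
    and "(LINT x|lborel. (\<Prod>b\<in>Basis. g b (x \<bullet> b))) = (\<Prod>b\<in>Basis. LINT t|lborel. g b t)"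
proof -
  interpret product_sigma_finite "\<lambda>_::'a. lborel :: real measure" ..
  have [measurable]: "\<And>b. b \<in> Basis \<Longrightarrow> g b \<in> borel_measurable borel"
    using assms by (auto dest: borel_measurable_integrable)
  have m: "(\<lambda>x::'a. \<Prod>b\<in>Basis. g b (x \<bullet> b)) \<in> borel_measurable borel"
    by measurable
  have [simp]: "(\<Sum>c\<in>Basis. f c *\<^sub>R c) \<bullet> b = f b" if "b \<in> Basis" for b :: 'a and f
    using that by (simp add: inner_sum_left_Basis)
  show "integrable lborel (\<lambda>x::'a. \<Prod>b\<in>Basis. g b (x \<bullet> b))"
    unfolding lborel_eq[where 'a='a]
    using m product_integrable_prod[of Basis g] assms
    by (subst integrable_distr_eq) auto
  show "(LINT x|lborel. (\<Prod>b\<in>Basis. g b (x \<bullet> b))) = (\<Prod>b\<in>Basis. LINT t|lborel. g b t)"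
    unfolding lborel_eq[where 'a='a]
    using m product_integral_prod[of Basis g] assms
    by (subst integral_distr) (auto simp: lborel_eq[where 'a='a, symmetric])
qed

text \<open>Since \<open>\<bar>x\<^sub>b\<bar> \<le> \<bar>x\<bar>\<close> for every coordinate, the function is at most the product of the functions \<open>1 / (1 + x\<^sub>b\<^sup>2)\<close>.\<close>

lemma integrable_decay:
  "integrable lborel (\<lambda>x::'a::euclidean_space. 1 / (1 + norm x) ^ (2 * DIM('a)))"
proof (rule Bochner_Integration.integrable_bound)
  have "set_integrable lborel (einterval (-\<infinity>) \<infinity>) (\<lambda>x::real. inverse (1 + x^2))"
    by (rule Sinc_Integral.integrable_inverse_1_plus_square)
  then have "integrable lborel (\<lambda>x::real. inverse (1 + x^2))"
    by (simp add: set_integrable_def)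
  then show "integrable lborel (\<lambda>x::'a. \<Prod>b\<in>Basis. inverse (1 + (x \<bullet> b)^2))"
    by (rule prod_lborel_integrable)
  show "AE x::'a in lborel. norm (1 / (1 + norm x) ^ (2 * DIM('a))) \<le> norm (\<Prod>b\<in>Basis. inverse (1 + (x \<bullet> b)^2))"
  proof (rule AE_I2)
    fix x :: 'a
    have "(\<Prod>b\<in>Basis. 1 + (x \<bullet> b)^2) \<le> (\<Prod>b\<in>(Basis::'a set). (1 + norm x)^2)"
    proof (rule prod_mono, safe)
      fix b :: 'a assume "b \<in> Basis"
      then have "(x \<bullet> b)^2 \<le> (norm x)^2" by (metis Basis_le_norm abs_le_square_iff abs_norm_cancel)
      also have "1 + (norm x)^2 \<le> (1 + norm x)^2" by (simp add: power2_eq_square algebra_simps)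
      finally show "1 + (x \<bullet> b)^2 \<le> (1 + norm x)^2" by simp
    qed auto
    also have "\<dots> = (1 + norm x) ^ (2 * DIM('a))" by (simp add: power_mult)
    finally have le: "(\<Prod>b\<in>Basis. 1 + (x \<bullet> b)^2) \<le> (1 + norm x) ^ (2 * DIM('a))" .
    have pos: "(\<Prod>b\<in>Basis. 1 + (x \<bullet> b)^2) > 0" by (intro prod_pos) (auto intro: add_pos_nonneg)
    have "inverse ((1 + norm x) ^ (2 * DIM('a))) \<le> inverse (\<Prod>b\<in>Basis. 1 + (x \<bullet> b)^2)"
      by (rule le_imp_inverse_le[OF le pos])
    then show "norm (1 / (1 + norm x) ^ (2 * DIM('a))) \<le> norm (\<Prod>b\<in>Basis. inverse (1 + (x \<bullet> b)^2))"
      using pos by (simp add: prod_dividef abs_of_pos inverse_eq_divide)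
  qed
qed measurable

lemma schwartz_decay:
  assumes "rapid f"
  obtains C where "\<And>x. cmod (f x) \<le> C / (1 + norm x) ^ n" "C > 0"
proof -
  obtain C0 where C0: "\<And>x. norm x ^ 0 * cmod (f x) \<le> C0" "C0 > 0" using rapidE[OF assms] by metis
  obtain C where C: "\<And>x. norm x ^ n * cmod (f x) \<le> C" "C > 0" using rapidE[OF assms] by metis
  have "cmod (f x) \<le> (2 ^ n * (C0 + C)) / (1 + norm x) ^ n" for x
  proof -
    have p: "(1 + norm x) ^ n > 0" by (simp add: add_pos_nonneg)
    have "(1 + norm x) ^ n \<le> (2 * max 1 (norm x)) ^ n" by (intro power_mono) auto
    also have "\<dots> = 2 ^ n * max 1 (norm x) ^ n" by (simp add: power_mult_distrib)
    also have "\<dots> \<le> 2 ^ n * (1 + norm x ^ n)"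
      by (intro mult_left_mono) (auto simp: max_def)
    finally have "(1 + norm x) ^ n * cmod (f x) \<le> 2 ^ n * (1 + norm x ^ n) * cmod (f x)"
      by (intro mult_right_mono) auto
    also have "\<dots> = 2 ^ n * (norm x ^ 0 * cmod (f x) + norm x ^ n * cmod (f x))" by (simp add: algebra_simps)
    also have "\<dots> \<le> 2 ^ n * (C0 + C)" using C0(1)[of x] C(1)[of x] by (intro mult_left_mono add_mono) auto
    finally show ?thesis using p by (simp add: field_simps)
  qed
  moreover have "2 ^ n * (C0 + C) > 0" using C0 C by (simp add: add_pos_pos)
  ultimately show ?thesis using that by blast
qed

lemma rapid_integrable:
  fixes f :: "'a::euclidean_space \<Rightarrow> complex"
  assumes "rapid f" and [measurable]: "f \<in> borel_measurable borel"
  shows "integrable lborel f"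
proof -
  obtain C where C: "\<And>x. cmod (f x) \<le> C / (1 + norm x) ^ (2 * DIM('a))" "C > 0"
    using schwartz_decay[OF assms(1)] by metis
  have "integrable lborel (\<lambda>x::'a. C * (1 / (1 + norm x) ^ (2 * DIM('a))))"
    by (intro integrable_mult_right integrable_decay)
  then show ?thesis
    by (rule Bochner_Integration.integrable_bound) (use C in \<open>auto simp: abs_of_pos\<close>)
qed

lemma schwartz_integrable: "f \<in> schwartz \<Longrightarrow> integrable lborel f"
  by (intro rapid_integrable schwartz_rapid schwartz_measurable)

lemma schwartz_mult_integrable:
  "f \<in> schwartz \<Longrightarrow> g \<in> schwartz \<Longrightarrow> integrable lborel (\<lambda>x. f x * g x)"
  by (intro schwartz_integrable schwartz_mult)

abbreviation dil :: "real \<Rightarrow> ('a::euclidean_space \<Rightarrow> complex) \<Rightarrow> 'a \<Rightarrow> complex" where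
  "dil s a \<equiv> (\<lambda>\<xi>. a (\<xi> /\<^sub>R s))"

section \<open>The Fourier transform on the Schwartz space\<close>

lemma lborel_nn_integral_affine:
  fixes f :: "'a::euclidean_space \<Rightarrow> ennreal"
  assumes "c \<noteq> 0" and [measurable]: "f \<in> borel_measurable borel"
  shows "(\<integral>\<^sup>+x. f x \<partial>lborel) = ennreal (\<bar>c\<bar> ^ DIM('a)) * (\<integral>\<^sup>+x. f (t + c *\<^sub>R x) \<partial>lborel)"
  by (subst lborel_affine[OF assms(1), of t])
     (simp add: nn_integral_density nn_integral_distr nn_integral_cmult)

lemma lborel_integrable_affine:
  fixes f :: "'a::euclidean_space \<Rightarrow> 'b::{banach,second_countable_topology}"
  assumes "c \<noteq> 0" "integrable lborel f"
  shows "integrable lborel (\<lambda>x. f (t + c *\<^sub>R x))"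
proof -
  have [measurable]: "f \<in> borel_measurable borel" using assms(2) by auto
  have "(\<integral>\<^sup>+x. ennreal (norm (f x)) \<partial>lborel) =
      ennreal (\<bar>c\<bar> ^ DIM('a)) * (\<integral>\<^sup>+x. ennreal (norm (f (t + c *\<^sub>R x))) \<partial>lborel)"
    by (rule lborel_nn_integral_affine[OF assms(1)]) measurable
  moreover have "(\<integral>\<^sup>+x. ennreal (norm (f x)) \<partial>lborel) < \<infinity>"
    using assms(2) unfolding integrable_iff_bounded by auto
  ultimately have "(\<integral>\<^sup>+x. ennreal (norm (f (t + c *\<^sub>R x))) \<partial>lborel) < \<infinity>"
    using assms(1) by (auto simp: ennreal_mult_less_top)
  then show ?thesis unfolding integrable_iff_bounded by auto
qed

lemma lborel_integral_affine:
  fixes f :: "'a::euclidean_space \<Rightarrow> 'b::{banach,second_countable_topology}"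
  assumes "c \<noteq> 0" and [measurable]: "f \<in> borel_measurable borel"
  shows "(LINT x|lborel. f x) = (\<bar>c\<bar> ^ DIM('a)) *\<^sub>R (LINT x|lborel. f (t + c *\<^sub>R x))"
  by (subst lborel_affine[OF assms(1), of t])
     (simp add: integral_density integral_distr)

lemma rapid_norm_mult: "rapid f \<Longrightarrow> rapid (\<lambda>x. of_real (norm x) * f x)"
  by (rule rapid_poly_mult[where K=1]) auto

lemma norm_fourier_kernel [simp]: "cmod (exp (- \<i> * of_real (x \<bullet> \<xi>))) = 1"
  by (simp add: norm_exp_eq_Re)

lemma fourier_kernel_measurable [measurable]:
  "(\<lambda>x::'a::euclidean_space. exp (- \<i> * of_real (x \<bullet> \<xi>))) \<in> borel_measurable borel"
  by (intro borel_measurable_continuous_onI continuous_intros)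

lemma integrable_bounded_mult:
  fixes f g :: "'a \<Rightarrow> complex"
  assumes "integrable M f" "g \<in> borel_measurable M" "\<And>x. cmod (g x) \<le> K"
  shows "integrable M (\<lambda>x. g x * f x)"
proof (rule Bochner_Integration.integrable_bound)
  show "integrable M (\<lambda>x. of_real K * f x)" using assms(1) by simp
  have "cmod (g x) * cmod (f x) \<le> \<bar>K\<bar> * cmod (f x)" for x
    using assms(3)[of x] by (intro mult_right_mono) auto
  then show "AE x in M. norm (g x * f x) \<le> norm (of_real K * f x)"
    by (simp add: norm_mult)
qed (use assms in measurable)

lemma fourier_integrand_integrable:
  assumes "integrable lborel f"
  shows "integrable lborel (\<lambda>x::'a::euclidean_space. exp (- \<i> * of_real (x \<bullet> \<xi>)) * f x)"
  by (rule integrable_bounded_mult[OF assms, where K=1]) (use norm_fourier_kernel in auto)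

lemma fourier_scale: "fourier (\<lambda>x. c * f x) \<xi> = c * fourier f \<xi>"
proof -
  have "(LINT x|lborel. exp (- \<i> * of_real (x \<bullet> \<xi>)) * (c * f x))
      = (LINT x|lborel. c * (exp (- \<i> * of_real (x \<bullet> \<xi>)) * f x))"
    by (simp add: algebra_simps)
  then show ?thesis by (simp add: fourier_def)
qed

lemma norm_fourier_le:
  fixes f :: "'a::euclidean_space \<Rightarrow> complex"
  shows "cmod (fourier f \<xi>) \<le> (2 * pi) powr (- real DIM('a) / 2) * (LINT x|lborel. cmod (f x))"
proof -
  have "cmod (LINT x|lborel. exp (- \<i> * of_real (x \<bullet> \<xi>)) * f x) \<le>
      (LINT x|lborel. cmod (exp (- \<i> * of_real (x \<bullet> \<xi>)) * f x))"
    by (rule integral_norm_bound)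
  then show ?thesis by (simp add: fourier_def norm_mult mult_left_mono)
qed

lemma exp_linearization_bound: "cmod (exp (- \<i> * of_real t) - 1 + \<i> * of_real t) \<le> t\<^sup>2"
proof -
  have "cmod (exp (- \<i> * of_real t) - 1 + \<i> * of_real t) \<le> t\<^sup>2 / 2"
    using iexp_approx1[of "- t" 1] by (simp add: numeral_2_eq_2 algebra_simps)
  also have "\<dots> \<le> t\<^sup>2" by simp
  finally show ?thesis .
qed

text \<open>Linearizing the kernel \<open>exp (- i x \<xi>)\<close> in \<open>\<xi>\<close> leaves an error of at most \<open>\<bar>x\<bar>\<^sup>2 \<bar>h\<bar>\<^sup>2\<close>, and \<open>\<bar>x\<bar>\<^sup>2 f\<close> is integrable; so the
integrated error is quadratic in \<open>h\<close>.\<close>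

lemma fourier_has_derivative:
  fixes f :: "'a::euclidean_space \<Rightarrow> complex"
  assumes f: "f \<in> schwartz"
  shows "(fourier f has_derivative
     (\<lambda>h. \<Sum>b\<in>Basis. of_real (h \<bullet> b) * fourier (\<lambda>x. - \<i> * (of_real (x \<bullet> b) * f x)) \<xi>)) (at \<xi>)"
    (is "(_ has_derivative ?G) _")
proof -
  define c where "c = (2 * pi) powr (- real DIM('a) / 2)"
  define e where "e = (\<lambda>\<xi> x::'a. exp (- \<i> * of_real (x \<bullet> \<xi>)))"
  have int: "integrable lborel (\<lambda>x. e \<xi> x * g x)" if "integrable lborel g" for g \<xi>
    unfolding e_def by (rule fourier_integrand_integrable[OF that])
  have fe: "fourier F \<xi> = of_real c * (LINT x|lborel. e \<xi> x * F x)" for F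
    by (simp add: fourier_def c_def e_def)
  have fx: "integrable lborel (\<lambda>x. of_real (x \<bullet> b) * f x)" if "b \<in> Basis" for b
    by (intro schwartz_integrable schwartz_coord f that)
  have "rapid (\<lambda>x. of_real (norm x) * (of_real (norm x) * f x))"
    by (intro rapid_norm_mult schwartz_rapid f)
  then have "integrable lborel (\<lambda>x. of_real (norm x) * (of_real (norm x) * f x))"
    by (rule rapid_integrable) (use schwartz_measurable[OF f] in measurable)
  then have int2: "integrable lborel (\<lambda>x. (norm x)\<^sup>2 * cmod (f x))"
    using integrable_norm[of lborel "\<lambda>x. of_real (norm x) * (of_real (norm x) * f x)"]
    by (simp add: norm_mult power2_eq_square mult.assoc)
  define K where "K = c * (LINT x|lborel. (norm x)\<^sup>2 * cmod (f x))"
  have Gh: "?G h = of_real c * (LINT x|lborel. e \<xi> x * (- \<i> * of_real (x \<bullet> h) * f x))"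
    and Gi: "integrable lborel (\<lambda>x. e \<xi> x * (- \<i> * of_real (x \<bullet> h) * f x))" for h
  proof -
    have eq: "e \<xi> x * (- \<i> * of_real (x \<bullet> h) * f x)
        = (\<Sum>b\<in>Basis. of_real (h \<bullet> b) * (e \<xi> x * (- \<i> * (of_real (x \<bullet> b) * f x))))" for x
      by (subst euclidean_inner) (simp add: sum_distrib_left sum_distrib_right algebra_simps)
    have i: "integrable lborel (\<lambda>x. of_real (h \<bullet> b) * (e \<xi> x * (- \<i> * (of_real (x \<bullet> b) * f x))))"
      if "b \<in> Basis" for b
      using fx[OF that] by (intro integrable_mult_right int) simp
    show "integrable lborel (\<lambda>x. e \<xi> x * (- \<i> * of_real (x \<bullet> h) * f x))"
      unfolding eq by (intro Bochner_Integration.integrable_sum i)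
    show "?G h = of_real c * (LINT x|lborel. e \<xi> x * (- \<i> * of_real (x \<bullet> h) * f x))"
      unfolding eq fe using i
      by (subst Bochner_Integration.integral_sum)
         (simp_all only: sum_distrib_left mult.left_commute[of "e \<xi> _"] integral_mult_right_zero mult.left_commute[of "of_real c"])
  qed
  have main: "cmod (fourier f \<zeta> - fourier f \<xi> - ?G (\<zeta> - \<xi>)) \<le> K * (norm (\<zeta> - \<xi>))\<^sup>2" for \<zeta>
  proof -
    define h where "h = \<zeta> - \<xi>"
    have fi: "integrable lborel f" by (rule schwartz_integrable[OF f])
    have "fourier f \<zeta> - fourier f \<xi> - ?G h = of_real c * (LINT x|lborel. e \<zeta> x * f x)
        - of_real c * (LINT x|lborel. e \<xi> x * f x)
        - of_real c * (LINT x|lborel. e \<xi> x * (- \<i> * of_real (x \<bullet> h) * f x))"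
      unfolding Gh by (simp add: fourier_def c_def e_def)
    also have "\<dots> = of_real c * (LINT x|lborel. e \<zeta> x * f x - e \<xi> x * f x - e \<xi> x * (- \<i> * of_real (x \<bullet> h) * f x))"
      using int[OF fi] Gi[of h] by (simp add: right_diff_distrib distrib_left)
    finally have eq: "cmod (fourier f \<zeta> - fourier f \<xi> - ?G h)
       = c * cmod (LINT x|lborel. e \<zeta> x * f x - e \<xi> x * f x - e \<xi> x * (- \<i> * of_real (x \<bullet> h) * f x))"
      by (simp add: norm_mult c_def)
    have bd: "cmod (e \<zeta> x * f x - e \<xi> x * f x - e \<xi> x * (- \<i> * of_real (x \<bullet> h) * f x))
          \<le> (norm h)\<^sup>2 * ((norm x)\<^sup>2 * cmod (f x))" for x
    proof -
      have "e \<zeta> x = e \<xi> x * exp (- \<i> * of_real (x \<bullet> h))"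
        by (simp add: e_def h_def inner_diff_right algebra_simps flip: exp_add)
      then have "e \<zeta> x * f x - e \<xi> x * f x - e \<xi> x * (- \<i> * of_real (x \<bullet> h) * f x)
         = e \<xi> x * (exp (- \<i> * of_real (x \<bullet> h)) - 1 + \<i> * of_real (x \<bullet> h)) * f x"
        by (simp add: algebra_simps)
      then have "cmod (e \<zeta> x * f x - e \<xi> x * f x - e \<xi> x * (- \<i> * of_real (x \<bullet> h) * f x))
         = cmod (exp (- \<i> * of_real (x \<bullet> h)) - 1 + \<i> * of_real (x \<bullet> h)) * cmod (f x)"
        by (simp add: norm_mult e_def)
      also have "\<dots> \<le> (x \<bullet> h)\<^sup>2 * cmod (f x)"
        by (intro mult_right_mono exp_linearization_bound) auto
      also have "\<dots> \<le> (norm x * norm h)\<^sup>2 * cmod (f x)"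
        by (intro mult_right_mono) (auto simp: Cauchy_Schwarz_ineq2 abs_le_square_iff[symmetric] abs_mult)
      finally show "cmod (e \<zeta> x * f x - e \<xi> x * f x - e \<xi> x * (- \<i> * of_real (x \<bullet> h) * f x))
          \<le> (norm h)\<^sup>2 * ((norm x)\<^sup>2 * cmod (f x))"
        by (simp add: power_mult_distrib mult_ac)
    qed
    have "cmod (LINT x|lborel. e \<zeta> x * f x - e \<xi> x * f x - e \<xi> x * (- \<i> * of_real (x \<bullet> h) * f x))
       \<le> (LINT x|lborel. (norm h)\<^sup>2 * ((norm x)\<^sup>2 * cmod (f x)))"
      by (rule Bochner_Integration.integral_norm_bound_integral)
         (intro Bochner_Integration.integrable_diff int fi Gi integrable_mult_right int2 bd)+
    then have le: "c * cmod (LINT x|lborel. e \<zeta> x * f x - e \<xi> x * f x - e \<xi> x * (- \<i> * of_real (x \<bullet> h) * f x))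
       \<le> c * (LINT x|lborel. (norm h)\<^sup>2 * ((norm x)\<^sup>2 * cmod (f x)))"
      by (intro mult_left_mono) (auto simp: c_def)
    note eq
    also note le
    also have "\<dots> = K * (norm h)\<^sup>2" by (simp add: K_def)
    finally show ?thesis unfolding h_def .
  qed
  show ?thesis
  proof (rule has_derivativeI_sandwich[of 1])
    show "bounded_linear ?G"
      by (intro bounded_linear_sum bounded_linear_mult_const bounded_linear_compose[OF bounded_linear_of_real] bounded_linear_inner_left)
    show "((\<lambda>\<zeta>. K * norm (\<zeta> - \<xi>)) \<longlongrightarrow> 0) (at \<xi>)"
      by (auto intro!: tendsto_eq_intros)
    fix \<zeta> assume "\<zeta> \<noteq> \<xi>"
    then show "norm (fourier f \<zeta> - fourier f \<xi> - ?G (\<zeta> - \<xi>)) / norm (\<zeta> - \<xi>) \<le> K * norm (\<zeta> - \<xi>)"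
      using main[of \<zeta>] by (simp add: divide_le_eq power2_eq_square mult.assoc)
  qed auto
qed

text \<open>Difference quotients have integral \<open>0\<close> because Lebesgue measure is invariant under translations. They are
dominated by the decay of the derivative and converge to it.\<close>

lemma integral_pd_eq_0:
  fixes g :: "'a::euclidean_space \<Rightarrow> complex"
  assumes g: "g \<in> schwartz" and b: "b \<in> Basis"
  shows "(LINT x|lborel. partial b g x) = 0"
proof -
  define s where "s = (\<lambda>n x. of_real (real (Suc n)) * (g (x + (1 / real (Suc n)) *\<^sub>R b) - g x))"
  have line: "((\<lambda>t. g (x + t *\<^sub>R b)) has_vector_derivative partial b g (x + t *\<^sub>R b)) (at t within A)" for x t A
  proof -
    have "((\<lambda>t. g (x + t *\<^sub>R b)) has_derivative (\<lambda>k. frechet_derivative g (at (x + t *\<^sub>R b)) (k *\<^sub>R b))) (at t within A)"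
      by (rule has_derivative_compose[OF _ schwartz_has_derivative[OF g]])
         (auto intro!: derivative_eq_intros)
    then show ?thesis
      using linear_cmul[OF has_derivative_linear[OF schwartz_has_derivative[OF g]]]
      by (simp add: has_vector_derivative_def)
  qed
  obtain C where C: "\<And>x. cmod (partial b g x) \<le> C / (1 + norm x) ^ (2 * DIM('a))" "C > 0"
    using schwartz_decay[OF schwartz_rapid[OF schwartz_pd[OF g b]]] by metis
  \<comment> \<open>A unit step changes \<open>1 + \<bar>x\<bar>\<close> at most by a factor \<open>2\<close>.\<close>
  define W where "W = (\<lambda>x::'a. (C * 2 ^ (2 * DIM('a))) * (1 / (1 + norm x) ^ (2 * DIM('a))))"
  have bound: "cmod (g (x + t *\<^sub>R b) - g x) \<le> W x * t" if t: "0 \<le> t" "t \<le> 1" for x t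
  proof -
    have arith: "X \<le> A + N \<Longrightarrow> N \<le> 1 \<Longrightarrow> 0 \<le> A \<Longrightarrow> 1 + X \<le> 2 * (1 + A)" for X A N :: real
      by argo
    have "norm (g (x + t *\<^sub>R b) - g (x + 0 *\<^sub>R b)) \<le> W x * norm (t - 0)"
    proof (rule differentiable_bound[where S="{0..1}" and f'="\<lambda>t k. k *\<^sub>R partial b g (x + t *\<^sub>R b)"])
      fix s :: real assume s: "s \<in> {0..1}"
      show "((\<lambda>t. g (x + t *\<^sub>R b)) has_derivative (\<lambda>k. k *\<^sub>R partial b g (x + s *\<^sub>R b))) (at s within {0..1})"
        using line unfolding has_vector_derivative_def .
      have "norm x \<le> norm (x + s *\<^sub>R b) + norm (s *\<^sub>R b)" by (metis add_diff_cancel_right' norm_triangle_ineq4)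
      moreover have "norm (s *\<^sub>R b) \<le> 1" using s b by simp
      ultimately have "1 + norm x \<le> 2 * (1 + norm (x + s *\<^sub>R b))"
        using norm_ge_zero[of "x + s *\<^sub>R b"] arith by blast
      then have "(1 + norm x) ^ (2 * DIM('a)) \<le> (2 * (1 + norm (x + s *\<^sub>R b))) ^ (2 * DIM('a))"
        by (intro power_mono) auto
      then have le: "(1 + norm x) ^ (2 * DIM('a)) \<le> 2 ^ (2 * DIM('a)) * (1 + norm (x + s *\<^sub>R b)) ^ (2 * DIM('a))"
        by (simp only: power_mult_distrib)
      have p: "(1 + norm x) ^ (2 * DIM('a)) > 0" "(1 + norm (x + s *\<^sub>R b)) ^ (2 * DIM('a)) > 0"
        by (auto intro!: zero_less_power add_pos_nonneg)
      have "cmod (partial b g (x + s *\<^sub>R b)) \<le> C / (1 + norm (x + s *\<^sub>R b)) ^ (2 * DIM('a))" by (rule C)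
      also have "\<dots> \<le> W x" unfolding W_def using p le C(2)
        by (simp add: divide_le_eq le_divide_eq field_simps mult_left_mono)
      finally have "cmod (partial b g (x + s *\<^sub>R b)) \<le> W x" .
      then show "onorm (\<lambda>k. k *\<^sub>R partial b g (x + s *\<^sub>R b)) \<le> W x"
        by (intro onorm_le) (use mult_left_mono abs_ge_zero in \<open>force simp: mult.commute[of "W x"]\<close>)
    qed (use t in auto)
    then show ?thesis using t by simp
  qed
  have "(\<lambda>n. integral\<^sup>L lborel (s n)) \<longlonglongrightarrow> (LINT x|lborel. partial b g x)"
  proof (rule integral_dominated_convergence[where w=W])
    show "(\<lambda>x. partial b g x) \<in> borel_measurable lborel"
      using schwartz_measurable[OF schwartz_pd[OF g b]] by simp
    show "s n \<in> borel_measurable lborel" for n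
      using schwartz_measurable[OF g] unfolding s_def by measurable
    show "integrable lborel W" unfolding W_def by (intro integrable_mult_right integrable_decay)
    show "AE x in lborel. (\<lambda>n. s n x) \<longlonglongrightarrow> partial b g x"
    proof (rule AE_I2)
      fix x
      have "((\<lambda>t. g (x + t *\<^sub>R b)) has_vector_derivative partial b g x) (at 0)"
        using line[of x 0 UNIV] by simp
      then have "((\<lambda>h. norm (g (x + h *\<^sub>R b) - g x - h *\<^sub>R partial b g x) / norm h) \<longlongrightarrow> 0) (at 0)"
        unfolding has_vector_derivative_def has_derivative_at by simp
      moreover have "norm (g (x + h *\<^sub>R b) - g x - h *\<^sub>R partial b g x) / norm h =
          norm ((g (x + h *\<^sub>R b) - g x) /\<^sub>R h - partial b g x)" if "h \<noteq> 0" for h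
      proof -
        have "(g (x + h *\<^sub>R b) - g x) /\<^sub>R h - partial b g x = (g (x + h *\<^sub>R b) - g x - h *\<^sub>R partial b g x) /\<^sub>R h"
          using that by (simp add: algebra_simps)
        then show ?thesis by (simp add: divide_inverse)
      qed
      ultimately have "((\<lambda>h. norm ((g (x + h *\<^sub>R b) - g x) /\<^sub>R h - partial b g x)) \<longlongrightarrow> 0) (at 0)"
        by (subst (asm) LIM_equal[of 0]) auto
      then have "((\<lambda>t. (g (x + t *\<^sub>R b) - g x) /\<^sub>R t) \<longlongrightarrow> partial b g x) (at 0)"
        by (subst Lim_null) (rule tendsto_norm_zero_cancel)
      then have "((\<lambda>n. (g (x + (1 / real (Suc n)) *\<^sub>R b) - g x) /\<^sub>R (1 / real (Suc n))) \<longlongrightarrow> partial b g x) sequentially"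
        by (rule filterlim_compose)
           (use LIMSEQ_Suc[OF lim_1_over_n] in \<open>auto simp: filterlim_at simp del: of_nat_Suc\<close>)
      then show "(\<lambda>n. s n x) \<longlonglongrightarrow> partial b g x"
        by (simp add: s_def scaleR_conv_of_real)
    qed
    show "AE x in lborel. norm (s n x) \<le> W x" for n
    proof (rule AE_I2)
      fix x
      have "norm (s n x) = real (Suc n) * cmod (g (x + (1 / real (Suc n)) *\<^sub>R b) - g x)"
        unfolding s_def norm_mult norm_of_real by simp
      also have "\<dots> \<le> real (Suc n) * (W x * (1 / real (Suc n)))"
        by (intro mult_left_mono bound) auto
      also have "\<dots> = W x" by simp
      finally show "norm (s n x) \<le> W x" .
    qed
  qed
  moreover have "integral\<^sup>L lborel (s n) = 0" for n
  proof -
    let ?t = "(1 / real (Suc n)) *\<^sub>R b"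
    have gi: "integrable lborel g" by (rule schwartz_integrable[OF g])
    have gt: "integrable lborel (\<lambda>x. g (x + ?t))"
      using lborel_integrable_affine[OF _ gi, of 1 ?t] by (simp add: add.commute)
    have "(LINT x|lborel. g x) = (LINT x|lborel. g (x + ?t))"
      using lborel_integral_affine[of 1 g ?t] schwartz_measurable[OF g] by (simp add: add.commute)
    then have "(LINT x|lborel. g (x + ?t) - g x) = 0"
      using gi gt by simp
    then show ?thesis unfolding s_def by simp
  qed
  ultimately show ?thesis using LIMSEQ_unique[OF _ tendsto_const] by force
qed

text \<open>Integration by parts: the derivative of \<open>exp (- i x \<xi>) f\<close> has integral \<open>0\<close>.\<close>

lemma fourier_pd:
  assumes f: "f \<in> schwartz" and b: "b \<in> Basis"
  shows "fourier (partial b f) \<xi> = \<i> * of_real (\<xi> \<bullet> b) * fourier f \<xi>"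
proof -
  let ?e = "\<lambda>x. exp (- \<i> * of_real (x \<bullet> \<xi>))"
  have d: "partial b (\<lambda>x. ?e x * f x) x = ?e x * partial b f x + (- \<i> * of_real (\<xi> \<bullet> b)) * (?e x * f x)" for x
  proof -
    have e: "(?e has_derivative (\<lambda>h. (- \<i> * of_real (h \<bullet> \<xi>)) * ?e x)) (at x)" for x
      by (rule has_derivative_compose[where g=exp and f="\<lambda>x. - \<i> * of_real (x \<bullet> \<xi>)",
          OF _ DERIV_exp[unfolded has_field_derivative_def], THEN has_derivative_eq_rhs])
         (auto intro!: derivative_eq_intros simp: algebra_simps)
    show ?thesis
      by (subst pd_eq[OF has_derivative_mult[OF e schwartz_has_derivative[OF f]]])
         (simp add: algebra_simps inner_commute)
  qed
  have "0 = (LINT x|lborel. partial b (\<lambda>x. ?e x * f x) x)"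
    by (rule integral_pd_eq_0[symmetric, OF schwartz_modulate[OF f] b])
  also have "\<dots> = (LINT x|lborel. ?e x * partial b f x) + (- \<i> * of_real (\<xi> \<bullet> b)) * (LINT x|lborel. ?e x * f x)"
    unfolding d
    using fourier_integrand_integrable[OF schwartz_integrable[OF f], of \<xi>]
      fourier_integrand_integrable[OF schwartz_integrable[OF schwartz_pd[OF f b]], of \<xi>]
    by (subst Bochner_Integration.integral_add) auto
  finally have "(LINT x|lborel. ?e x * partial b f x) = \<i> * of_real (\<xi> \<bullet> b) * (LINT x|lborel. ?e x * f x)"
    by (simp add: algebra_simps eq_neg_iff_add_eq_0)
  then show ?thesis by (simp add: fourier_def)
qed

text \<open>Each factor \<open>\<bar>\<xi>\<bar>\<close> is at most the sum of the \<open>\<bar>\<xi>\<^sub>b\<bar>\<close>, and each of these is traded for a derivative of \<open>f\<close>.\<close>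

lemma rapid_fourier:
  assumes "f \<in> schwartz"
  shows "rapid (fourier f)"
proof (rule rapidI)
  fix n show "\<exists>C. \<forall>x. norm x ^ n * cmod (fourier f x) \<le> C"
    using assms
  proof (induction n arbitrary: f)
    case 0
    then show ?case using norm_fourier_le by auto
  next
    case (Suc n)
    have "\<exists>C. \<forall>x. norm x ^ n * cmod (fourier (partial b f) x) \<le> C" if "b \<in> Basis" for b
      by (rule Suc.IH[OF schwartz_pd[OF Suc.prems that]])
    then obtain C where C: "\<And>b x. b \<in> Basis \<Longrightarrow> norm x ^ n * cmod (fourier (partial b f) x) \<le> C b"
      by metis
    have "norm x ^ Suc n * cmod (fourier f x) \<le> (\<Sum>b\<in>Basis. C b)" for x
    proof -
      have "norm x ^ Suc n * cmod (fourier f x) = norm x * (norm x ^ n * cmod (fourier f x))" by simp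
      also have "\<dots> \<le> (\<Sum>b\<in>Basis. \<bar>x \<bullet> b\<bar>) * (norm x ^ n * cmod (fourier f x))"
        by (intro mult_right_mono norm_le_l1) auto
      also have "\<dots> = (\<Sum>b\<in>Basis. norm x ^ n * cmod (fourier (partial b f) x))"
        unfolding sum_distrib_right
        by (rule sum.cong[OF refl]) (simp add: fourier_pd[OF Suc.prems] norm_mult)
      also have "\<dots> \<le> (\<Sum>b\<in>Basis. C b)" by (intro sum_mono C)
      finally show ?thesis .
    qed
    then show ?case by blast
  qed
qed

lemma fourier_schwartz:
  assumes "f \<in> schwartz"
  shows "fourier f \<in> schwartz"
proof (rule schwartz_coinduct_derivative[where S="fourier ` schwartz"])
  show "fourier f \<in> fourier ` schwartz" using assms by blast
  fix h :: "'a \<Rightarrow> complex" assume "h \<in> fourier ` schwartz"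
  then obtain f where h: "h = fourier f" and f: "f \<in> schwartz" by blast
  show "rapid h" unfolding h by (rule rapid_fourier[OF f])
  define h' where "h' = (\<lambda>\<xi> k. \<Sum>b\<in>Basis. of_real (k \<bullet> b) * fourier (\<lambda>x. - \<i> * (of_real (x \<bullet> b) * f x)) \<xi>)"
  have "(h has_derivative h' \<xi>) (at \<xi>)" for \<xi>
    unfolding h h'_def by (rule fourier_has_derivative[OF f])
  moreover have "(\<lambda>\<xi>. h' \<xi> b) \<in> fourier ` schwartz" if b: "b \<in> Basis" for b
  proof -
    have "h' \<xi> b = fourier (\<lambda>x. - \<i> * (of_real (x \<bullet> b) * f x)) \<xi>" for \<xi>
    proof -
      have "h' \<xi> b = (\<Sum>c\<in>Basis. (if c = b then fourier (\<lambda>x. - \<i> * (of_real (x \<bullet> c) * f x)) \<xi> else 0))"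
        unfolding h'_def by (rule sum.cong) (use b in \<open>auto simp: inner_Basis\<close>)
      then show ?thesis using b by simp
    qed
    then have "(\<lambda>\<xi>. h' \<xi> b) = fourier (\<lambda>x. - \<i> * (of_real (x \<bullet> b) * f x))" by auto
    moreover have "(\<lambda>x. - \<i> * (of_real (x \<bullet> b) * f x)) \<in> schwartz"
      by (intro schwartz_scale schwartz_coord f b)
    ultimately show ?thesis by blast
  qed
  ultimately show "\<exists>h'. (\<forall>x. (h has_derivative h' x) (at x)) \<and> (\<forall>b\<in>Basis. (\<lambda>x. h' x b) \<in> fourier ` schwartz)"
    by blast
qed

lemma inv_fourier_eq: "inv_fourier f x = fourier f (- x)"
  by (simp add: inv_fourier_def fourier_def inner_commute)

lemma inv_fourier_schwartz:
  assumes "f \<in> schwartz"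
  shows "inv_fourier f \<in> schwartz"
proof -
  have "(\<lambda>x. fourier f ((-1) *\<^sub>R x)) \<in> schwartz"
    by (intro schwartz_dilate fourier_schwartz assms) auto
  moreover have "inv_fourier f = (\<lambda>x. fourier f ((-1) *\<^sub>R x))" by (rule ext) (simp add: inv_fourier_eq)
  ultimately show ?thesis by simp
qed

text \<open>Fubini's theorem for the symmetric kernel \<open>exp (- i x \<xi>)\<close>.\<close>

lemma fourier_multiplication_formula:
  fixes f g :: "'a::euclidean_space \<Rightarrow> complex"
  assumes f: "integrable lborel f" and g: "integrable lborel g"
  shows "(LINT \<xi>|lborel. fourier f \<xi> * g \<xi>) = (LINT x|lborel. f x * fourier g x)"
proof -
  define c where "c = complex_of_real ((2 * pi) powr (- real DIM('a) / 2))"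
  have [measurable]: "f \<in> borel_measurable borel" "g \<in> borel_measurable borel" using f g by auto
  have int: "integrable (lborel \<Otimes>\<^sub>M lborel) (\<lambda>(x, \<xi>). exp (- \<i> * of_real (x \<bullet> \<xi>)) * f x * g \<xi>)"
  proof (rule lborel_pair.Fubini_integrable)
    show "(\<lambda>(x::'a, \<xi>). exp (- \<i> * of_real (x \<bullet> \<xi>)) * f x * g \<xi>) \<in> borel_measurable (lborel \<Otimes>\<^sub>M lborel)"
      by measurable
    have "integrable lborel (\<lambda>x. cmod (f x) * (LINT y|lborel. cmod (g y)))" using f by simp
    then show "integrable lborel (\<lambda>x. LINT y|lborel. norm (case (x, y) of (x, \<xi>) \<Rightarrow> exp (- \<i> * of_real (x \<bullet> \<xi>)) * f x * g \<xi>))"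
      by (simp add: norm_mult)
    have "integrable lborel (\<lambda>y. f x * (exp (- \<i> * of_real (y \<bullet> x)) * g y))" for x
      by (intro integrable_mult_right fourier_integrand_integrable g)
    then show "AE x in lborel. integrable lborel (\<lambda>y. case (x, y) of (x, \<xi>) \<Rightarrow> exp (- \<i> * of_real (x \<bullet> \<xi>)) * f x * g \<xi>)"
      by (simp add: mult_ac inner_commute)
  qed
  have "(LINT \<xi>|lborel. fourier f \<xi> * g \<xi>) = c * (LINT \<xi>|lborel. (LINT x|lborel. exp (- \<i> * of_real (x \<bullet> \<xi>)) * f x * g \<xi>))"
    unfolding fourier_def c_def[symmetric]
    by (simp only: mult.assoc[of c] integral_mult_right_zero integral_mult_left_zero)
  also have "(LINT \<xi>|lborel. (LINT x|lborel. exp (- \<i> * of_real (x \<bullet> \<xi>)) * f x * g \<xi>))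
     = (LINT x|lborel. (LINT \<xi>|lborel. exp (- \<i> * of_real (x \<bullet> \<xi>)) * f x * g \<xi>))"
    by (rule lborel_pair.Fubini_integral[OF int])
  also have "\<dots> = (LINT x|lborel. f x * (LINT \<xi>|lborel. exp (- \<i> * of_real (\<xi> \<bullet> x)) * g \<xi>))"
    by (subst integral_mult_right_zero[symmetric]) (simp only: mult_ac inner_commute)
  also have "c * \<dots> = (LINT x|lborel. f x * fourier g x)"
    unfolding fourier_def c_def[symmetric] integral_mult_right_zero[symmetric] by (simp only: mult_ac)
  finally show ?thesis .
qed


definition gauss :: "'a::euclidean_space \<Rightarrow> real" where
  "gauss x = exp (- (norm x)\<^sup>2 / 2)"

lemma gauss_prod: "gauss (x::'a::euclidean_space) = (\<Prod>b\<in>Basis. exp (- (x \<bullet> b)\<^sup>2 / 2))"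
proof -
  have "(norm x)\<^sup>2 = (\<Sum>b\<in>Basis. (x \<bullet> b)\<^sup>2)"
    by (subst power2_norm_eq_inner, subst euclidean_inner) (simp add: power2_eq_square)
  then have "- (norm x)\<^sup>2 / 2 = (\<Sum>b\<in>Basis. - (x \<bullet> b)\<^sup>2 / 2)"
    by (simp add: sum_negf sum_divide_distrib)
  then show ?thesis unfolding gauss_def by (simp only: exp_sum[OF finite_Basis])
qed

lemma gauss_measurable [measurable]: "gauss \<in> borel_measurable borel"
  unfolding gauss_def by measurable

text \<open>Up to normalization this is the characteristic function of the standard normal distribution.\<close>

lemma gauss_1d:
  "integrable lborel (\<lambda>t::real. exp (- \<i> * of_real (t * s)) * of_real (exp (- t\<^sup>2 / 2)))"
  "(LINT t|lborel. exp (- \<i> * of_real (t * s)) * of_real (exp (- t\<^sup>2 / 2)))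
     = of_real (sqrt (2 * pi) * exp (- s\<^sup>2 / 2))"
proof -
  have i: "integrable lborel (\<lambda>t::real. exp (- t\<^sup>2 / 2))"
  proof -
    have "integrable lborel (\<lambda>t. sqrt (2 * pi) * std_normal_density t)"
      by (intro integrable_mult_right integrable_normal_density) simp
    then show ?thesis by (simp add: std_normal_density_def)
  qed
  then have "integrable lborel (\<lambda>t::real. complex_of_real (exp (- t\<^sup>2 / 2)))"
    by (rule integrable_of_real)
  then show "integrable lborel (\<lambda>t::real. exp (- \<i> * of_real (t * s)) * of_real (exp (- t\<^sup>2 / 2)))"
    using fourier_integrand_integrable[of "\<lambda>t::real. complex_of_real (exp (- t\<^sup>2 / 2))" s] by simp
  have "char std_normal_distribution (- s) = (LINT t|lborel. std_normal_density t *\<^sub>R iexp (- s * t))"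
    unfolding char_def by (subst integral_density) auto
  also have "\<dots> = (LINT t|lborel. of_real (1 / sqrt (2 * pi)) * (exp (- \<i> * of_real (t * s)) * of_real (exp (- t\<^sup>2 / 2))))"
    by (rule Bochner_Integration.integral_cong[OF refl])
       (simp add: std_normal_density_def scaleR_conv_of_real mult_ac)
  also have "\<dots> = of_real (1 / sqrt (2 * pi)) * (LINT t|lborel. exp (- \<i> * of_real (t * s)) * of_real (exp (- t\<^sup>2 / 2)))"
    by (rule integral_mult_right_zero)
  finally have "of_real (1 / sqrt (2 * pi)) * (LINT t|lborel. exp (- \<i> * of_real (t * s)) * of_real (exp (- t\<^sup>2 / 2)))
     = complex_of_real (exp (- s\<^sup>2 / 2))"
    unfolding char_std_normal_distribution by simp
  then have "of_real (sqrt (2 * pi)) * (of_real (1 / sqrt (2 * pi)) * (LINT t|lborel. exp (- \<i> * of_real (t * s)) * of_real (exp (- t\<^sup>2 / 2))))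
     = of_real (sqrt (2 * pi)) * complex_of_real (exp (- s\<^sup>2 / 2))" by (rule arg_cong)
  moreover have "of_real (sqrt (2 * pi)) * of_real (1 / sqrt (2 * pi)) = (1::complex)"
    unfolding of_real_mult[symmetric] by (simp del: of_real_mult)
  ultimately show "(LINT t|lborel. exp (- \<i> * of_real (t * s)) * of_real (exp (- t\<^sup>2 / 2)))
     = of_real (sqrt (2 * pi) * exp (- s\<^sup>2 / 2))"
    unfolding mult.assoc[symmetric] of_real_mult by simp
qed

lemma gauss_fourier:
  fixes z :: "'a::euclidean_space"
  shows "integrable lborel (\<lambda>x::'a. complex_of_real (gauss x))"
    and "(LINT x|lborel. exp (- \<i> * of_real (x \<bullet> z)) * of_real (gauss x))
      = of_real ((2 * pi) powr (real DIM('a) / 2) * gauss z)"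
proof -
  have eq: "exp (- \<i> * of_real (x \<bullet> z)) * of_real (gauss x)
     = (\<Prod>b\<in>Basis. exp (- \<i> * of_real ((x \<bullet> b) * (z \<bullet> b))) * of_real (exp (- (x \<bullet> b)\<^sup>2 / 2)))" for x z :: 'a
  proof -
    have "- \<i> * of_real (x \<bullet> z) = (\<Sum>b\<in>Basis. - \<i> * of_real ((x \<bullet> b) * (z \<bullet> b)))"
      by (subst euclidean_inner) (simp add: sum_distrib_left)
    then show ?thesis
      unfolding gauss_prod of_real_prod prod.distrib by (simp only: exp_sum[OF finite_Basis])
  qed
  have "integrable lborel (\<lambda>x::'a. exp (- \<i> * of_real (x \<bullet> 0)) * of_real (gauss x))"
    unfolding eq
    by (rule prod_lborel_integrable(1)[where g="\<lambda>b t. exp (- \<i> * of_real (t * (0 \<bullet> b))) * of_real (exp (- t\<^sup>2 / 2))"])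
       (rule gauss_1d)
  then show "integrable lborel (\<lambda>x::'a. complex_of_real (gauss x))" by simp
  have "(LINT x|lborel. exp (- \<i> * of_real (x \<bullet> z)) * of_real (gauss x))
     = (\<Prod>b\<in>Basis. of_real (sqrt (2 * pi) * exp (- (z \<bullet> b)\<^sup>2 / 2)))"
    unfolding eq
    by (subst prod_lborel_integrable(2)[where g="\<lambda>b t. exp (- \<i> * of_real (t * (z \<bullet> b))) * of_real (exp (- t\<^sup>2 / 2))"])
       (auto simp only: gauss_1d)
  also have "\<dots> = of_real (sqrt (2 * pi) ^ DIM('a) * gauss z)"
    unfolding gauss_prod of_real_prod[symmetric] prod.distrib by simp
  also have "sqrt (2 * pi) ^ DIM('a) = (2 * pi) powr (real DIM('a) / 2)"
    by (simp add: powr_half_sqrt[symmetric] powr_realpow[symmetric] powr_powr)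
  finally show "(LINT x|lborel. exp (- \<i> * of_real (x \<bullet> z)) * of_real (gauss x))
      = of_real ((2 * pi) powr (real DIM('a) / 2) * gauss z)" .
qed

text \<open>Pair the transform of \<open>f\<close> with \<open>exp (i x\<^sub>0 \<xi>)\<close> times a Gaussian of width \<open>1 / \<epsilon>\<close>. By the multiplication formula the
result is the mean of \<open>f\<close> over a Gaussian of width \<open>\<epsilon>\<close> centred at \<open>x\<^sub>0\<close>. As \<open>\<epsilon>\<close> tends to \<open>0\<close>, one side tends to the
inversion integral and the other to a multiple of \<open>f x\<^sub>0\<close>.\<close>

theorem fourier_inversion:
  fixes f :: "'a::euclidean_space \<Rightarrow> complex"
  assumes f: "f \<in> schwartz"
  shows "inv_fourier (fourier f) x0 = f x0"
proof -
  define c where "c = complex_of_real ((2 * pi) powr (- real DIM('a) / 2))"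
  define c' where "c' = complex_of_real ((2 * pi) powr (real DIM('a) / 2))"
  have cc: "c * c' = 1" unfolding c_def c'_def of_real_mult[symmetric] powr_add[symmetric] by simp
  define \<epsilon> where "\<epsilon> = (\<lambda>n. 1 / real (Suc n))"
  have \<epsilon>: "\<epsilon> n > 0" for n by (simp add: \<epsilon>_def)
  have \<epsilon>0: "\<epsilon> \<longlonglongrightarrow> 0" unfolding \<epsilon>_def by (rule LIMSEQ_Suc[OF lim_1_over_n])
  have gauss_le: "gauss x \<le> 1" "gauss x \<ge> 0" for x :: 'a by (auto simp: gauss_def)
  have cont_gauss: "continuous_on UNIV (gauss :: 'a \<Rightarrow> real)"
    unfolding gauss_def by (intro continuous_intros) auto
  have lim_gauss: "(\<lambda>n. gauss (\<epsilon> n *\<^sub>R y)) \<longlonglongrightarrow> 1" for y :: 'a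
  proof -
    have "(\<lambda>n. gauss (\<epsilon> n *\<^sub>R y)) \<longlonglongrightarrow> gauss (0 *\<^sub>R y)"
      by (rule continuous_on_tendsto_compose[OF cont_gauss tendsto_scaleR[OF \<epsilon>0 tendsto_const]]) auto
    then show ?thesis by (simp add: gauss_def)
  qed
  define h where "h = (\<lambda>n \<xi>. exp (\<i> * of_real (x0 \<bullet> \<xi>)) * complex_of_real (gauss (\<epsilon> n *\<^sub>R \<xi>)))"
  have kern: "(\<lambda>\<xi>::'a. exp (\<i> * of_real (x0 \<bullet> \<xi>))) \<in> borel_measurable borel"
    by (intro borel_measurable_continuous_onI continuous_intros)
  have hi: "integrable lborel (h n)" for n
  proof -
    have "integrable lborel (\<lambda>\<xi>::'a. complex_of_real (gauss (0 + \<epsilon> n *\<^sub>R \<xi>)))"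
      using \<epsilon>[of n] by (intro lborel_integrable_affine gauss_fourier) simp
    then show ?thesis unfolding h_def using kern
      by (intro integrable_bounded_mult[where K=1]) auto
  qed
  have Fh: "fourier (h n) y = of_real (1 / \<epsilon> n ^ DIM('a)) * of_real (gauss ((y - x0) /\<^sub>R \<epsilon> n))" for n y
  proof -
    let ?q = "\<lambda>\<xi>::'a. exp (- \<i> * of_real (\<xi> \<bullet> ((y - x0) /\<^sub>R \<epsilon> n))) * of_real (gauss \<xi>)"
    have [simp]: "complex_of_real (\<epsilon> n) * (inverse (complex_of_real (\<epsilon> n)) * z) = z" for z
      using \<epsilon>[of n] by simp
    have "exp (- \<i> * of_real (\<xi> \<bullet> y)) * h n \<xi> = ?q (0 + \<epsilon> n *\<^sub>R \<xi>)" for \<xi>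
      unfolding h_def mult.assoc[symmetric] exp_add[symmetric]
      by (simp add: inner_diff_right algebra_simps inner_commute)
    then have "fourier (h n) y = c * (LINT \<xi>|lborel. ?q (0 + \<epsilon> n *\<^sub>R \<xi>))"
      unfolding fourier_def c_def by simp
    also have "(LINT \<xi>|lborel. ?q \<xi>) = of_real (\<epsilon> n ^ DIM('a)) * (LINT \<xi>|lborel. ?q (0 + \<epsilon> n *\<^sub>R \<xi>))"
      using \<epsilon>[of n] by (subst lborel_integral_affine[of "\<epsilon> n" ?q 0]) (auto simp: scaleR_conv_of_real)
    then have "(LINT \<xi>|lborel. ?q (0 + \<epsilon> n *\<^sub>R \<xi>)) = of_real (1 / \<epsilon> n ^ DIM('a)) * (LINT \<xi>|lborel. ?q \<xi>)"
      using \<epsilon>[of n] by (simp add: field_simps)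
    also have "(LINT \<xi>|lborel. ?q \<xi>) = c' * of_real (gauss ((y - x0) /\<^sub>R \<epsilon> n))"
      unfolding gauss_fourier(2) c'_def by simp
    finally show ?thesis using cc by (simp add: field_simps)
  qed
  have conv: "(LINT y|lborel. f y * fourier (h n) y) = (LINT z|lborel. f (x0 + \<epsilon> n *\<^sub>R z) * of_real (gauss z))" for n
  proof -
    have m: "(\<lambda>y. f y * fourier (h n) y) \<in> borel_measurable borel"
      unfolding Fh using schwartz_measurable[OF f] by measurable
    have "(LINT y|lborel. f y * fourier (h n) y) = of_real (\<epsilon> n ^ DIM('a)) *
        (LINT z|lborel. f (x0 + \<epsilon> n *\<^sub>R z) * fourier (h n) (x0 + \<epsilon> n *\<^sub>R z))"
      using \<epsilon>[of n] by (subst lborel_integral_affine[OF _ m, of "\<epsilon> n" x0]) (auto simp: scaleR_conv_of_real)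
    also have "f (x0 + \<epsilon> n *\<^sub>R z) * fourier (h n) (x0 + \<epsilon> n *\<^sub>R z)
       = of_real (1 / \<epsilon> n ^ DIM('a)) * (f (x0 + \<epsilon> n *\<^sub>R z) * of_real (gauss z))" for z
      using \<epsilon>[of n] by (simp add: Fh)
    then have "(LINT z|lborel. f (x0 + \<epsilon> n *\<^sub>R z) * fourier (h n) (x0 + \<epsilon> n *\<^sub>R z))
       = of_real (1 / \<epsilon> n ^ DIM('a)) * (LINT z|lborel. f (x0 + \<epsilon> n *\<^sub>R z) * of_real (gauss z))"
      by (simp only: integral_mult_right_zero)
    also have "of_real (\<epsilon> n ^ DIM('a)) * \<dots> = (LINT z|lborel. f (x0 + \<epsilon> n *\<^sub>R z) * of_real (gauss z))"
      using \<epsilon>[of n] by simp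
    finally show ?thesis .
  qed
  obtain M where M: "\<And>x. cmod (f x) \<le> M" "M > 0" using schwartz_bdd[OF f] by metis
  have "(\<lambda>n. LINT z|lborel. f (x0 + \<epsilon> n *\<^sub>R z) * of_real (gauss z)) \<longlonglongrightarrow> (LINT z::'a|lborel. f x0 * of_real (gauss z))"
  proof (rule integral_dominated_convergence[where w="\<lambda>z::'a. M * cmod (of_real (gauss z))"])
    show "(\<lambda>z::'a. f x0 * of_real (gauss z)) \<in> borel_measurable lborel" by measurable
    show "(\<lambda>z. f (x0 + \<epsilon> n *\<^sub>R z) * of_real (gauss z)) \<in> borel_measurable lborel" for n
      using schwartz_measurable[OF f] by measurable
    show "integrable lborel (\<lambda>z::'a. M * cmod (of_real (gauss z)))"
      by (intro integrable_mult_right integrable_norm gauss_fourier)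
    show "AE z in lborel. norm (f (x0 + \<epsilon> n *\<^sub>R z) * of_real (gauss z)) \<le> M * cmod (of_real (gauss z))" for n
      unfolding norm_mult by (intro AE_I2 mult_right_mono M) auto
    have "(\<lambda>n. f (x0 + \<epsilon> n *\<^sub>R z)) \<longlonglongrightarrow> f (x0 + 0 *\<^sub>R z)" for z :: 'a
      by (rule continuous_on_tendsto_compose[OF schwartz_continuous[OF f, of UNIV]
            tendsto_add[OF tendsto_const tendsto_scaleR[OF \<epsilon>0 tendsto_const]]]) auto
    then show "AE z in lborel. (\<lambda>n. f (x0 + \<epsilon> n *\<^sub>R z) * of_real (gauss z)) \<longlonglongrightarrow> f x0 * of_real (gauss z)"
      by (intro AE_I2 tendsto_mult tendsto_const) simp
  qed
  also have "(LINT z::'a|lborel. f x0 * of_real (gauss z)) = f x0 * c'"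
    using gauss_fourier(2)[of "0::'a"] by (simp add: c'_def gauss_def)
  finally have lim1: "(\<lambda>n. LINT y|lborel. f y * fourier (h n) y) \<longlonglongrightarrow> f x0 * c'"
    unfolding conv .
  have Fi: "integrable lborel (fourier f)" by (intro schwartz_integrable fourier_schwartz f)
  have "(\<lambda>n. LINT \<xi>|lborel. fourier f \<xi> * h n \<xi>) \<longlonglongrightarrow> (LINT \<xi>|lborel. fourier f \<xi> * exp (\<i> * of_real (x0 \<bullet> \<xi>)))"
  proof (rule integral_dominated_convergence[where w="\<lambda>\<xi>. cmod (fourier f \<xi>)"])
    show "(\<lambda>\<xi>. fourier f \<xi> * exp (\<i> * of_real (x0 \<bullet> \<xi>))) \<in> borel_measurable lborel"
      using kern Fi by auto
    show "(\<lambda>\<xi>. fourier f \<xi> * h n \<xi>) \<in> borel_measurable lborel" for n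
      using hi[of n] Fi by auto
    show "integrable lborel (\<lambda>\<xi>. cmod (fourier f \<xi>))" using Fi by (rule integrable_norm)
    show "AE \<xi> in lborel. norm (fourier f \<xi> * h n \<xi>) \<le> cmod (fourier f \<xi>)" for n
      using gauss_le by (auto simp: norm_mult h_def abs_of_nonneg intro!: mult_left_le)
    have "(\<lambda>n. fourier f \<xi> * (exp (\<i> * of_real (x0 \<bullet> \<xi>)) * complex_of_real (gauss (\<epsilon> n *\<^sub>R \<xi>)))) \<longlonglongrightarrow>
        fourier f \<xi> * (exp (\<i> * of_real (x0 \<bullet> \<xi>)) * complex_of_real 1)" for \<xi>
      by (intro tendsto_mult tendsto_const tendsto_of_real lim_gauss)
    then show "AE \<xi> in lborel. (\<lambda>n. fourier f \<xi> * h n \<xi>) \<longlonglongrightarrow> fourier f \<xi> * exp (\<i> * of_real (x0 \<bullet> \<xi>))"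
      by (intro AE_I2) (simp add: h_def)
  qed
  also have "(\<lambda>n. LINT \<xi>|lborel. fourier f \<xi> * h n \<xi>) = (\<lambda>n. LINT y|lborel. f y * fourier (h n) y)"
    by (rule ext) (rule fourier_multiplication_formula[OF schwartz_integrable[OF f] hi])
  finally have "(LINT \<xi>|lborel. fourier f \<xi> * exp (\<i> * of_real (x0 \<bullet> \<xi>))) = f x0 * c'"
    using lim1 LIMSEQ_unique by blast
  then have "inv_fourier (fourier f) x0 = c * (f x0 * c')"
    unfolding inv_fourier_def c_def by (simp add: mult.commute)
  then show ?thesis using cc by (simp add: mult_ac)
qed


lemma fourier_reflect:
  fixes f :: "'a::euclidean_space \<Rightarrow> complex"
  assumes "f \<in> borel_measurable borel"
  shows "fourier (\<lambda>x. f (- x)) \<xi> = inv_fourier f \<xi>"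
proof -
  have m: "(\<lambda>x. exp (\<i> * of_real (\<xi> \<bullet> x)) * f x) \<in> borel_measurable borel"
    by (intro borel_measurable_times assms borel_measurable_continuous_onI continuous_intros)
  show ?thesis
    unfolding fourier_def inv_fourier_def
    by (subst lborel_integral_affine[OF _ m, of "-1" 0]) (simp_all add: inner_commute)
qed

corollary fourier_inversion':
  fixes f :: "'a::euclidean_space \<Rightarrow> complex"
  assumes f: "f \<in> schwartz"
  shows "fourier (inv_fourier f) \<xi> = f \<xi>"
proof -
  have "fourier (inv_fourier f) \<xi> = fourier (\<lambda>x. fourier f (- x)) \<xi>"
    by (simp add: inv_fourier_eq[abs_def])
  also have "\<dots> = inv_fourier (fourier f) \<xi>"
    by (intro fourier_reflect schwartz_measurable fourier_schwartz f)
  also have "\<dots> = f \<xi>" by (rule fourier_inversion[OF f])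
  finally show ?thesis .
qed

lemma fourier_cnj: "fourier (\<lambda>x. cnj (f x)) \<xi> = cnj (inv_fourier f \<xi>)"
proof -
  have "cnj (LINT x|lborel. exp (\<i> * of_real (\<xi> \<bullet> x)) * f x) = (LINT x|lborel. cnj (exp (\<i> * of_real (\<xi> \<bullet> x)) * f x))"
    by (rule Bochner_Integration.integral_cnj[symmetric])
  then show ?thesis
    unfolding fourier_def inv_fourier_def by (simp add: exp_cnj inner_commute)
qed

text \<open>The multiplication formula for \<open>f\<close> and the conjugate of the transform of \<open>g\<close>, whose transform is the conjugate
of \<open>g\<close> by inversion.\<close>

theorem plancherel:
  fixes f g :: "'a::euclidean_space \<Rightarrow> complex"
  assumes f: "f \<in> schwartz" and g: "g \<in> schwartz"
  shows "(LINT \<xi>|lborel. fourier f \<xi> * cnj (fourier g \<xi>)) = (LINT x|lborel. f x * cnj (g x))"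
proof -
  have "(LINT \<xi>|lborel. fourier f \<xi> * cnj (fourier g \<xi>))
     = (LINT x|lborel. f x * fourier (\<lambda>\<xi>. cnj (fourier g \<xi>)) x)"
    by (intro fourier_multiplication_formula schwartz_integrable schwartz_cnj fourier_schwartz f g)
  then show ?thesis by (simp add: fourier_cnj fourier_inversion[OF g])
qed

corollary plancherel_norm:
  fixes f :: "'a::euclidean_space \<Rightarrow> complex"
  assumes f: "f \<in> schwartz"
  shows "(LINT \<xi>|lborel. (cmod (fourier f \<xi>))\<^sup>2) = (LINT x|lborel. (cmod (f x))\<^sup>2)"
proof -
  have "complex_of_real (LINT \<xi>|lborel. (cmod (fourier f \<xi>))\<^sup>2) = complex_of_real (LINT x|lborel. (cmod (f x))\<^sup>2)"
    using plancherel[OF f f] by (simp only: complex_norm_square[symmetric] integral_complex_of_real)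
  then show ?thesis by (simp only: of_real_eq_iff)
qed

subsection \<open>Multipliers as convolutions\<close>

text \<open>The multiplication formula for \<open>f\<close> and \<open>exp (i x \<xi>) a\<close>: the transform of the latter is a reflected translate of the
inverse transform of \<open>a\<close>.\<close>

lemma multiplier_eq_convolution:
  fixes a f :: "'a::euclidean_space \<Rightarrow> complex"
  assumes a: "a \<in> schwartz" and f: "f \<in> schwartz"
  shows "inv_fourier (\<lambda>\<xi>. a \<xi> * fourier f \<xi>) x
     = of_real ((2 * pi) powr (- real DIM('a) / 2)) * (LINT y|lborel. inv_fourier a (x - y) * f y)"
proof -
  let ?g = "\<lambda>\<xi>. exp (- \<i> * of_real (\<xi> \<bullet> (- x))) * a \<xi>"
  have "(LINT \<xi>|lborel. exp (\<i> * of_real (x \<bullet> \<xi>)) * (a \<xi> * fourier f \<xi>)) = (LINT \<xi>|lborel. fourier f \<xi> * ?g \<xi>)"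
    by (simp add: mult_ac inner_commute)
  also have "\<dots> = (LINT y|lborel. f y * fourier ?g y)"
    by (intro fourier_multiplication_formula fourier_integrand_integrable schwartz_integrable a f)
  also have "\<dots> = (LINT y|lborel. inv_fourier a (x - y) * f y)"
  proof (rule Bochner_Integration.integral_cong[OF refl])
    fix y
    have "fourier ?g y = inv_fourier a (x - y)"
      unfolding fourier_def inv_fourier_def mult.assoc[symmetric] exp_add[symmetric]
      by (simp add: inner_diff_left inner_commute algebra_simps)
    then show "f y * fourier ?g y = inv_fourier a (x - y) * f y" by simp
  qed
  finally show ?thesis unfolding inv_fourier_def[of "\<lambda>\<xi>. a \<xi> * fourier f \<xi>"] by (simp add: mult.commute)
qed

lemma inv_fourier_dilate:
  fixes a :: "'a::euclidean_space \<Rightarrow> complex"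
  assumes [measurable]: "a \<in> borel_measurable borel" and s: "s > 0"
  shows "inv_fourier (dil s a) x = of_real (s ^ DIM('a)) * inv_fourier a (s *\<^sub>R x)"
proof -
  have m: "(\<lambda>\<xi>. exp (\<i> * of_real (x \<bullet> \<xi>)) * a (\<xi> /\<^sub>R s)) \<in> borel_measurable borel"
    by (rule borel_measurable_times, (intro borel_measurable_continuous_onI continuous_intros)[1], measurable)
  show ?thesis
    unfolding inv_fourier_def
    using s by (subst lborel_integral_affine[OF _ m, of s 0]) (auto simp: scaleR_conv_of_real mult_ac)
qed

lemma coord_inv_fourier:
  assumes g: "g \<in> schwartz" and b: "b \<in> Basis"
  shows "of_real (x \<bullet> b) * inv_fourier g x = inv_fourier (\<lambda>\<xi>. \<i> * partial b g \<xi>) x"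
  unfolding inv_fourier_eq fourier_scale fourier_pd[OF g b] by (simp add: algebra_simps)

lemma pd_fourier:
  assumes f: "f \<in> schwartz" and b: "b \<in> Basis"
  shows "partial b (fourier f) \<xi> = fourier (\<lambda>x. - \<i> * (of_real (x \<bullet> b) * f x)) \<xi>"
proof -
  have "partial b (fourier f) \<xi> = (\<Sum>c\<in>Basis. of_real (b \<bullet> c) * fourier (\<lambda>x. - \<i> * (of_real (x \<bullet> c) * f x)) \<xi>)"
    by (rule pd_eq[OF fourier_has_derivative[OF f]])
  also have "\<dots> = (\<Sum>c\<in>Basis. (if c = b then fourier (\<lambda>x. - \<i> * (of_real (x \<bullet> c) * f x)) \<xi> else 0))"
    by (rule sum.cong) (use b in \<open>auto simp: inner_Basis\<close>)
  finally show ?thesis using b by simp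
qed

section \<open>Fourier multipliers acting on Schwartz functions\<close>

definition fmul :: "('a::euclidean_space \<Rightarrow> complex) \<Rightarrow> ('a \<Rightarrow> complex) \<Rightarrow> 'a \<Rightarrow> complex" where
  "fmul a f = inv_fourier (\<lambda>\<xi>. a \<xi> * fourier f \<xi>)"

abbreviation LP_piece :: "('a::euclidean_space \<Rightarrow> complex) \<Rightarrow> int \<Rightarrow> ('a \<Rightarrow> complex) \<Rightarrow> 'a \<Rightarrow> complex" where
  "LP_piece \<phi> k f \<equiv> fmul (dil (2 powi k) (LP_psi \<phi>)) f"

lemma fmul_schwartz: "a \<in> schwartz \<Longrightarrow> f \<in> schwartz \<Longrightarrow> fmul a f \<in> schwartz"
  unfolding fmul_def by (intro inv_fourier_schwartz schwartz_mult fourier_schwartz)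

lemma fourier_fmul:
  "a \<in> schwartz \<Longrightarrow> f \<in> schwartz \<Longrightarrow> fourier (fmul a f) \<xi> = a \<xi> * fourier f \<xi>"
  unfolding fmul_def by (intro fourier_inversion' schwartz_mult fourier_schwartz)

lemma inv_fourier_multiplication_formula:
  assumes "g \<in> schwartz" "h \<in> schwartz"
  shows "(LINT x|lborel. h x * inv_fourier g x) = (LINT x|lborel. inv_fourier h x * g x)"
  using fourier_multiplication_formula[OF schwartz_integrable[OF inv_fourier_schwartz[OF assms(2)]]
      schwartz_integrable[OF inv_fourier_schwartz[OF assms(1)]]]
  by (simp add: fourier_inversion' assms)

lemma fourier_mult_distr_of:
  assumes a: "a \<in> schwartz" and f: "f \<in> schwartz" and g: "g \<in> schwartz"
  shows "fourier_mult a (distr_of f) g = (LINT \<xi>|lborel. a \<xi> * fourier f \<xi> * inv_fourier g \<xi>)"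
proof -
  have ag: "(\<lambda>\<xi>. a \<xi> * inv_fourier g \<xi>) \<in> schwartz"
    by (intro schwartz_mult inv_fourier_schwartz a g)
  have "fourier_mult a (distr_of f) g = (LINT x|lborel. f x * fourier (\<lambda>\<xi>. a \<xi> * inv_fourier g \<xi>) x)"
    using g ag inv_fourier_schwartz[OF g] fourier_schwartz[OF ag]
    by (simp add: fourier_mult_def inv_fourier_distr_def mult_distr_def fourier_distr_def distr_of_def)
  also have "\<dots> = (LINT \<xi>|lborel. fourier f \<xi> * (a \<xi> * inv_fourier g \<xi>))"
    by (rule fourier_multiplication_formula[symmetric]) (intro schwartz_integrable f ag)+
  finally show ?thesis by (simp only: mult_ac)
qed

text \<open>On the distribution of a Schwartz function a multiplier acts by the classical formula. As \<open>distr_norm\<close> is an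
infimum over representing functions, this gives upper bounds for the norms of Littlewood--Paley pieces.\<close>

lemma represents_fmul:
  assumes a: "a \<in> schwartz" and f: "f \<in> schwartz"
  shows "represents (fmul a f) (fourier_mult a (distr_of f))"
proof -
  have "fourier_mult a (distr_of f) g = (LINT x|lborel. fmul a f x * g x)" if g: "g \<in> schwartz" for g
    unfolding fourier_mult_distr_of[OF a f g] fmul_def
    by (rule inv_fourier_multiplication_formula[OF g]) (intro schwartz_mult fourier_schwartz a f)
  then show ?thesis
    unfolding represents_def
    using schwartz_measurable[OF fmul_schwartz[OF a f]] schwartz_mult_integrable[OF fmul_schwartz[OF a f]]
    by simp
qed

lemma represents_fourier_fmul:
  assumes a: "a \<in> schwartz" and f: "f \<in> schwartz"
  shows "represents (\<lambda>\<xi>. a \<xi> * fourier f \<xi>) (fourier_distr (fourier_mult a (distr_of f)))"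
proof -
  have af: "(\<lambda>\<xi>. a \<xi> * fourier f \<xi>) \<in> schwartz" by (intro schwartz_mult fourier_schwartz a f)
  have "fourier_distr (fourier_mult a (distr_of f)) g = (LINT \<xi>|lborel. a \<xi> * fourier f \<xi> * g \<xi>)"
    if g: "g \<in> schwartz" for g
    using fourier_mult_distr_of[OF a f fourier_schwartz[OF g]] g
    by (simp add: fourier_distr_def fourier_inversion)
  then show ?thesis
    unfolding represents_def
    using schwartz_measurable[OF af] schwartz_mult_integrable[OF af] by simp
qed

lemma distr_norm_le: "represents g T \<Longrightarrow> distr_norm N T \<le> N g"
  unfolding distr_norm_def by (rule INF_lower) simp

lemma distr_of_tempered:
  fixes f :: "'a::euclidean_space \<Rightarrow> complex"
  assumes f: "f \<in> schwartz"
  shows "distr_of f \<in> tempered"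
proof -
  have sn: "schwartz_seminorm 0 g = (SUP x. cmod (g x))" for g :: "'a \<Rightarrow> complex"
  proof -
    have "{bs. set bs \<subseteq> Basis \<and> length bs \<le> 0} = {[] :: 'a list}" by auto
    then show ?thesis by (simp add: schwartz_seminorm_def)
  qed
  have bd: "cmod (distr_of f g) \<le> (LINT x|lborel. cmod (f x)) * schwartz_seminorm 0 g"
    if g: "g \<in> schwartz" for g
  proof -
    obtain M where M: "\<And>x. cmod (g x) \<le> M" using schwartz_bdd[OF g] by metis
    have le: "cmod (g x) \<le> (SUP x. cmod (g x))" for x
      by (rule cSUP_upper) (auto intro!: bdd_aboveI2 M)
    have "cmod (LINT x|lborel. f x * g x) \<le> (LINT x|lborel. cmod (f x) * (SUP x. cmod (g x)))"
    proof (rule Bochner_Integration.integral_norm_bound_integral)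
      show "integrable lborel (\<lambda>x. f x * g x)" by (rule schwartz_mult_integrable[OF f g])
      show "integrable lborel (\<lambda>x. cmod (f x) * (SUP x. cmod (g x)))"
        by (intro integrable_mult_left integrable_norm schwartz_integrable f)
      show "norm (f x * g x) \<le> cmod (f x) * (SUP x. cmod (g x))" for x
        unfolding norm_mult by (intro mult_left_mono le) auto
    qed
    then show ?thesis using g by (simp add: distr_of_def sn)
  qed
  have add: "distr_of f (\<lambda>x. g x + h x) = distr_of f g + distr_of f h"
    if "g \<in> schwartz" "h \<in> schwartz" for g h
    using that schwartz_add[OF that] schwartz_mult_integrable[OF f that(1)] schwartz_mult_integrable[OF f that(2)]
    by (simp add: distr_of_def distrib_left)
  have scale: "distr_of f (\<lambda>x. c * g x) = c * distr_of f g" if "g \<in> schwartz" for g c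
  proof -
    have "(LINT x|lborel. f x * (c * g x)) = (LINT x|lborel. c * (f x * g x))" by (simp only: mult_ac)
    then show ?thesis using that schwartz_scale[OF that] by (simp add: distr_of_def)
  qed
  show ?thesis
    unfolding tempered_def using bd add scale by (auto simp: distr_of_def)
qed

section \<open>Lebesgue norms of Schwartz functions\<close>

definition Lpow :: "real \<Rightarrow> ('a::euclidean_space \<Rightarrow> complex) \<Rightarrow> real" where
  "Lpow t f = (LINT x|lborel. cmod (f x) powr t)"

lemma schwartz_powr_integrable:
  assumes f: "f \<in> schwartz" and t: "t \<ge> 1"
  shows "integrable lborel (\<lambda>x. cmod (f x) powr t)"
proof -
  obtain M where M: "\<And>x. cmod (f x) \<le> M" "M > 0" using schwartz_bdd[OF f] by metis
  have [measurable]: "f \<in> borel_measurable borel" by (rule schwartz_measurable[OF f])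
  show ?thesis
  proof (rule Bochner_Integration.integrable_bound)
    show "integrable lborel (\<lambda>x. M powr (t - 1) * cmod (f x))"
      by (intro integrable_mult_right integrable_norm schwartz_integrable f)
    have "cmod (f x) powr t \<le> M powr (t - 1) * cmod (f x)" for x
    proof (cases "f x = 0")
      case False
      have "cmod (f x) powr t = cmod (f x) powr (t - 1) * cmod (f x)"
        using False by (simp add: powr_diff)
      also have "\<dots> \<le> M powr (t - 1) * cmod (f x)"
        using M t by (intro mult_right_mono powr_mono2) auto
      finally show ?thesis .
    qed auto
    then show "AE x in lborel. norm (cmod (f x) powr t) \<le> norm (M powr (t - 1) * cmod (f x))"
      by (auto simp: abs_mult)
  qed measurable
qed

lemma Lpow_nonneg [simp]: "Lpow t f \<ge> 0"
  by (simp add: Lpow_def)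

lemma Lp_norm_eq_Lpow:
  assumes f: "f \<in> schwartz" and t: "t \<ge> 1"
  shows "Lp_norm t f = ennreal (Lpow t f powr (1 / t))"
proof -
  have "(\<integral>\<^sup>+x. ennreal (cmod (f x) powr t) * indicator UNIV x \<partial>lborel) = ennreal (Lpow t f)"
    unfolding Lpow_def using schwartz_powr_integrable[OF f t]
    by (subst nn_integral_eq_integral[symmetric]) auto
  then show ?thesis by (simp add: Lp_norm_on_def enn_powr_def)
qed

lemma Lpow_scale: "c \<ge> 0 \<Longrightarrow> Lpow t (\<lambda>x. of_real c * f x) = c powr t * Lpow t f"
  by (simp add: Lpow_def norm_mult powr_mult)

lemma enn_powr_mono: "x \<le> y \<Longrightarrow> 0 \<le> a \<Longrightarrow> enn_powr x a \<le> enn_powr y a"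
  unfolding enn_powr_def
  by (auto simp: top_unique intro!: ennreal_leI powr_mono2 enn2real_mono simp: less_top)

lemma enn_powr_ennreal: "0 \<le> x \<Longrightarrow> enn_powr (ennreal x) a = ennreal (x powr a)"
  by (simp add: enn_powr_def)

text \<open>The graph of the convex function \<open>u \<mapsto> u\<^sup>t\<close> lies above its tangent at \<open>m\<close>. Young's inequality for \<open>u m\<^bsup>t-1\<^esup>\<close>
says the same.\<close>

lemma powr_tangent:
  fixes u m t :: real
  assumes "u \<ge> 0" "m > 0" "t \<ge> 1"
  shows "m powr t + t * m powr (t - 1) * (u - m) \<le> u powr t"
proof (cases "u = 0 \<or> t = 1")
  case True
  have "m powr (t - 1) * m = m powr t" using assms by (simp add: powr_diff)
  moreover have "m powr t * (1 - t) \<le> 0" using assms by (intro mult_nonneg_nonpos) auto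
  ultimately show ?thesis using True assms by (auto simp: algebra_simps)
next
  case False
  then have u: "u > 0" and t: "t > 1" using assms by auto
  have "(u powr t) powr (1/t) * (m powr t) powr (1 - 1/t) \<le> (1/t) * u powr t + (1 - 1/t) * m powr t"
    by (rule Youngs_inequality_0) (use u t assms in auto)
  moreover have "(u powr t) powr (1/t) = u" using u t by (simp add: powr_powr)
  moreover have "(m powr t) powr (1 - 1/t) = m powr (t - 1)"
    using t by (simp add: powr_powr algebra_simps)
  ultimately have "u * m powr (t - 1) \<le> (1/t) * u powr t + (1 - 1/t) * m powr t" by simp
  then have "t * (u * m powr (t - 1)) \<le> t * ((1/t) * u powr t + (1 - 1/t) * m powr t)"
    using t by (intro mult_left_mono) auto
  also have "\<dots> = u powr t + (t - 1) * m powr t" using t by (simp add: field_simps)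
  finally have 1: "t * (u * m powr (t - 1)) \<le> u powr t + (t - 1) * m powr t" .
  have "m powr (t - 1) * m = m powr t" using assms by (simp add: powr_diff)
  then have 2: "t * (m powr (t - 1) * m) = t * m powr t" by (rule arg_cong)
  have "m powr t + t * m powr (t - 1) * (u - m)
      = m powr t + t * (u * m powr (t - 1)) - t * (m powr (t - 1) * m)"
    by (simp add: algebra_simps)
  also have "\<dots> \<le> u powr t" using 1 unfolding 2 by (simp add: algebra_simps)
  finally show ?thesis .
qed

text \<open>Jensen's inequality for the measure with density \<open>K\<close>: integrate the tangent inequality at the point
\<open>v = (\<integral> K u) / m\<close>. As \<open>t \<ge> 1\<close>, replacing the mass of \<open>K\<close> by an upper bound \<open>m\<close> keeps the inequality.\<close>

lemma jensen_kernel: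
  fixes K u :: "'a \<Rightarrow> real"
  assumes K: "integrable M K" "\<And>x. K x \<ge> 0" and u: "\<And>x. u x \<ge> 0"
    and Ku: "integrable M (\<lambda>x. K x * u x)" and Kut: "integrable M (\<lambda>x. K x * u x powr t)"
    and m: "integral\<^sup>L M K \<le> m" "m > 0" and t: "t \<ge> 1"
  shows "(integral\<^sup>L M (\<lambda>x. K x * u x)) powr t \<le> m powr (t - 1) * integral\<^sup>L M (\<lambda>x. K x * u x powr t)"
proof -
  define I where "I = integral\<^sup>L M (\<lambda>x. K x * u x)"
  define J where "J = integral\<^sup>L M (\<lambda>x. K x * u x powr t)"
  define \<kappa> where "\<kappa> = integral\<^sup>L M K"
  have I0: "I \<ge> 0" and J0: "J \<ge> 0" unfolding I_def J_def using K u by (auto intro!: Bochner_Integration.integral_nonneg)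
  show ?thesis
  proof (cases "I = 0")
    case True
    then show ?thesis using J0 t unfolding I_def[symmetric] J_def[symmetric] by simp
  next
    case False
    define v where "v = I / m"
    have v: "v > 0" using False I0 m by (simp add: v_def)
    have Iv: "I = v * m" using m by (simp add: v_def)
    have "v powr t * \<kappa> + t * v powr (t - 1) * (I - v * \<kappa>)
       = integral\<^sup>L M (\<lambda>x. v powr t * K x + t * v powr (t - 1) * (K x * u x - v * K x))"
      using K Ku by (simp add: I_def \<kappa>_def)
    also have "\<dots> \<le> J" unfolding J_def
    proof (rule integral_mono)
      show "integrable M (\<lambda>x. v powr t * K x + t * v powr (t - 1) * (K x * u x - v * K x))"
        using K Ku by simp
      show "integrable M (\<lambda>x. K x * u x powr t)" by fact
      fix x
      have "K x * (v powr t + t * v powr (t - 1) * (u x - v)) \<le> K x * u x powr t"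
        by (intro mult_left_mono powr_tangent u v t K)
      then show "v powr t * K x + t * v powr (t - 1) * (K x * u x - v * K x) \<le> K x * u x powr t"
        by (simp add: algebra_simps)
    qed
    finally have 1: "v powr t * \<kappa> + t * v powr (t - 1) * (I - v * \<kappa>) \<le> J" .
    have "v powr (t - 1) * v = v powr t" using v by (simp add: powr_diff)
    then have "t * v powr (t - 1) * (I - v * \<kappa>) = t * (v powr t * (m - \<kappa>))"
      unfolding Iv by (simp add: algebra_simps)
    also have "\<dots> \<ge> 1 * (v powr t * (m - \<kappa>))"
      using t m \<kappa>_def by (intro mult_right_mono) auto
    finally have "v powr t * m \<le> J" using 1 by (simp add: algebra_simps)
    then have "m powr (t - 1) * (v powr t * m) \<le> m powr (t - 1) * J"
      by (intro mult_left_mono) auto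
    also have "m powr (t - 1) * (v powr t * m) = I powr t"
      using m v I0 unfolding Iv by (simp add: powr_mult powr_diff)
    finally show ?thesis unfolding I_def J_def .
  qed
qed


section \<open>Kernels of multipliers and Bernstein's inequality\<close>

text \<open>Mass and height are all that the estimates below use of the kernel of a multiplier with symbol
\<open>a (\<xi> / s)\<close>.\<close>

definition scaled_kernel :: "real \<Rightarrow> real \<Rightarrow> ('a::euclidean_space \<Rightarrow> real) \<Rightarrow> bool" where
  "scaled_kernel M s K \<longleftrightarrow> integrable lborel K \<and> integral\<^sup>L lborel K \<le> M \<and>
     (\<forall>z. 0 \<le> K z \<and> K z \<le> M * s ^ DIM('a))"

text \<open>The kernel of \<open>a (\<xi> / s)\<close> is \<open>s\<^sup>d k (s x)\<close>, where \<open>k\<close> is the kernel of \<open>a\<close>: its mass does not depend on \<open>s\<close> and its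
height is proportional to \<open>s\<^sup>d\<close>.\<close>

lemma fmul_kernel:
  fixes a :: "'a::euclidean_space \<Rightarrow> complex"
  assumes a: "a \<in> schwartz"
  obtains M where "M > 0"
    "\<And>s. s > 0 \<Longrightarrow> \<exists>K. scaled_kernel M s K \<and>
       (\<forall>f\<in>schwartz. \<forall>x. cmod (fmul (dil s a) f x) \<le> (LINT y|lborel. K (x - y) * cmod (f y)))"
proof -
  define c where "c = (2 * pi) powr (- real DIM('a) / 2)"
  have c: "c \<ge> 0" by (simp add: c_def)
  have ia: "inv_fourier a \<in> schwartz" by (rule inv_fourier_schwartz[OF a])
  obtain M0 where M0: "\<And>x. cmod (inv_fourier a x) \<le> M0" "M0 > 0" using schwartz_bdd[OF ia] by metis
  define M1 where "M1 = (LINT x|lborel. cmod (inv_fourier a x))"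
  have M1: "M1 \<ge> 0" by (simp add: M1_def)
  define M where "M = c * M0 + c * M1 + 1"
  have M: "M > 0" "c * M0 \<le> M" "c * M1 \<le> M" using c M0 M1 by (auto simp: M_def add_nonneg_pos)
  show ?thesis
  proof (rule that[OF M(1)])
    fix s :: real assume s: "s > 0"
    define K where "K = (\<lambda>z. c * cmod (inv_fourier (dil s a) z))"
    have as: "(dil s a) \<in> schwartz" using s by (intro schwartz_dilate a) auto
    have Kz: "K z = c * (s ^ DIM('a) * cmod (inv_fourier a (s *\<^sub>R z)))" for z
      unfolding K_def inv_fourier_dilate[OF schwartz_measurable[OF a] s] using s
      by (simp add: norm_mult norm_power)
    have iK: "integrable lborel K" unfolding K_def
      by (intro integrable_mult_right integrable_norm schwartz_integrable inv_fourier_schwartz as)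
    have "integral\<^sup>L lborel K = c * (s ^ DIM('a) * (LINT z|lborel. cmod (inv_fourier a (s *\<^sub>R z))))"
      unfolding Kz[abs_def] by simp
    also have "s ^ DIM('a) * (LINT z|lborel. cmod (inv_fourier a (s *\<^sub>R z))) = M1"
      unfolding M1_def using s schwartz_measurable[OF ia]
      by (subst (2) lborel_integral_affine[of s _ 0]) auto
    finally have "integral\<^sup>L lborel K \<le> M" using M by simp
    moreover have "0 \<le> K z \<and> K z \<le> M * s ^ DIM('a)" for z
    proof -
      have "K z = s ^ DIM('a) * (c * cmod (inv_fourier a (s *\<^sub>R z)))" by (simp add: Kz)
      also have "\<dots> \<le> s ^ DIM('a) * (c * M0)" using s c by (intro mult_left_mono M0) auto
      also have "\<dots> \<le> s ^ DIM('a) * M" using s M by (intro mult_left_mono) auto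
      finally show ?thesis using c s by (simp add: Kz mult.commute)
    qed
    ultimately have "scaled_kernel M s K" using iK by (simp add: scaled_kernel_def)
    moreover have "cmod (fmul (dil s a) f x) \<le> (LINT y|lborel. K (x - y) * cmod (f y))"
      if f: "f \<in> schwartz" for f x
    proof -
      have "cmod (fmul (dil s a) f x) =
          c * cmod (LINT y|lborel. inv_fourier (dil s a) (x - y) * f y)"
        unfolding fmul_def multiplier_eq_convolution[OF as f] by (simp add: norm_mult c_def)
      also have "\<dots> \<le> c * (LINT y|lborel. cmod (inv_fourier (dil s a) (x - y) * f y))"
        by (intro mult_left_mono integral_norm_bound c)
      also have "\<dots> = (LINT y|lborel. K (x - y) * cmod (f y))"
        by (simp add: K_def norm_mult mult.assoc)
      finally show ?thesis .
    qed
    ultimately show "\<exists>K. scaled_kernel M s K \<and>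
       (\<forall>f\<in>schwartz. \<forall>x. cmod (fmul (dil s a) f x) \<le> (LINT y|lborel. K (x - y) * cmod (f y)))"
      by blast
  qed
qed

context
  fixes M s :: real and K :: "'a::euclidean_space \<Rightarrow> real"
  assumes K: "scaled_kernel M s K" and M: "M > 0" and s: "s > 0"
begin

lemma scaled_kernel_bounds: "0 \<le> K z" "K z \<le> M * s ^ DIM('a)"
  using K by (auto simp: scaled_kernel_def)

lemma scaled_kernel_measurable [measurable]: "K \<in> borel_measurable borel"
  using K by (auto simp: scaled_kernel_def)

lemma scaled_kernel_integral:
  "integrable lborel (\<lambda>y. K (x - y))" "(LINT y|lborel. K (x - y)) \<le> M"
  "integrable lborel (\<lambda>y. K (y - x))" "(LINT y|lborel. K (y - x)) \<le> M"
proof -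
  have i: "integrable lborel K" "integral\<^sup>L lborel K \<le> M" using K by (auto simp: scaled_kernel_def)
  show "integrable lborel (\<lambda>y. K (x - y))"
    using lborel_integrable_affine[OF _ i(1), of "-1" x] by simp
  show "(LINT y|lborel. K (x - y)) \<le> M"
    using lborel_integral_affine[of "-1" K x] i by simp
  show "integrable lborel (\<lambda>y. K (y - x))"
    using lborel_integrable_affine[OF _ i(1), of 1 "-x"] by simp
  show "(LINT y|lborel. K (y - x)) \<le> M"
    using lborel_integral_affine[of 1 K "-x"] i by simp
qed

lemma scaled_kernel_nn_integral:
  "(\<integral>\<^sup>+y. ennreal (K (x - y)) \<partial>lborel) \<le> ennreal M"
  "(\<integral>\<^sup>+y. ennreal (K (y - x)) \<partial>lborel) \<le> ennreal M"
  using scaled_kernel_integral[of x] scaled_kernel_bounds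
  by (auto simp: nn_integral_eq_integral intro!: ennreal_leI)

lemma scaled_kernel_mult_integrable:
  assumes "u \<in> borel_measurable borel" "\<And>y. \<bar>u y\<bar> \<le> B"
  shows "integrable lborel (\<lambda>y. K (x - y) * u y)"
proof (rule Bochner_Integration.integrable_bound)
  show "integrable lborel (\<lambda>y. B * K (x - y))"
    by (intro integrable_mult_right scaled_kernel_integral)
  have "\<bar>K (x - y)\<bar> * \<bar>u y\<bar> \<le> \<bar>B\<bar> * \<bar>K (x - y)\<bar>" for y
    using mult_right_mono[OF order_trans[OF assms(2)[of y] abs_ge_self], of "\<bar>K (x - y)\<bar>"]
    by (simp add: mult.commute)
  then show "AE y in lborel. norm (K (x - y) * u y) \<le> norm (B * K (x - y))"
    by (simp add: abs_mult)
qed (use assms(1) in measurable)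

text \<open>Young's inequality. By Jensen's inequality the \<open>t\<close>-th power of the convolution of \<open>K\<close> with \<open>\<bar>f\<bar>\<close> is at most a
multiple of the convolution \<open>h\<close> of \<open>K\<close> with \<open>\<bar>f\<bar>\<^sup>t\<close>. The height of \<open>K\<close> bounds \<open>h\<close>, its mass bounds the integral of \<open>h\<close>, and
together they bound the integral of \<open>h\<^bsup>r/t\<^esup>\<close>.\<close>

lemma scaled_kernel_young:
  fixes f :: "'a \<Rightarrow> complex"
  assumes f: "f \<in> schwartz" and t: "1 \<le> t" "t \<le> r"
  shows "(\<integral>\<^sup>+x. ennreal ((LINT y|lborel. K (x - y) * cmod (f y)) powr r) \<partial>lborel)
     \<le> ennreal (M powr r * s powr (real DIM('a) * (r / t - 1)) * Lpow t f powr (r / t))"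
proof -
  have [measurable]: "f \<in> borel_measurable borel" by (rule schwartz_measurable[OF f])
  obtain B where B: "\<And>x. cmod (f x) \<le> B" "B > 0" using schwartz_bdd[OF f] by metis
  define G where "G = (\<lambda>x. LINT y|lborel. K (x - y) * cmod (f y))"
  define h where "h = (\<lambda>x. LINT y|lborel. K (x - y) * cmod (f y) powr t)"
  define F where "F = Lpow t f"
  define H where "H = M * s ^ DIM('a) * F"
  have it: "integrable lborel (\<lambda>y. cmod (f y) powr t)" by (rule schwartz_powr_integrable[OF f t(1)])
  have i1: "integrable lborel (\<lambda>y. K (x - y) * cmod (f y))" for x
    by (rule scaled_kernel_mult_integrable) (use B in auto)
  have i2: "integrable lborel (\<lambda>y. K (x - y) * cmod (f y) powr t)" for x
    by (rule scaled_kernel_mult_integrable[where B="B powr t"]) (use B t in \<open>auto intro!: powr_mono2\<close>)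
  have G0: "G x \<ge> 0" and h0: "h x \<ge> 0" for x
    unfolding G_def h_def using scaled_kernel_bounds by (auto intro!: Bochner_Integration.integral_nonneg)
  have F0: "F \<ge> 0" by (simp add: F_def)
  have H0: "H \<ge> 0" using M s F0 by (simp add: H_def)
  have hH: "h x \<le> H" for x
  proof -
    have "h x \<le> (LINT y|lborel. M * s ^ DIM('a) * cmod (f y) powr t)"
      unfolding h_def by (intro integral_mono i2 integrable_mult_right it mult_right_mono scaled_kernel_bounds) auto
    then show ?thesis by (simp add: H_def F_def Lpow_def)
  qed
  have Gt: "G x powr t \<le> M powr (t - 1) * h x" for x
    unfolding G_def h_def
    by (rule jensen_kernel) (use i1 i2 scaled_kernel_integral scaled_kernel_bounds M t in auto)
  define C1 where "C1 = M powr ((t - 1) * (r / t)) * H powr (r / t - 1)"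
  have C10: "C1 \<ge> 0" by (simp add: C1_def)
  have Gr: "G x powr r \<le> C1 * h x" for x
  proof -
    have "G x powr r = (G x powr t) powr (r / t)" using t by (simp add: powr_powr)
    also have "\<dots> \<le> (M powr (t - 1) * h x) powr (r / t)" using t by (intro powr_mono2 Gt) auto
    also have "\<dots> = M powr ((t - 1) * (r / t)) * h x powr (r / t)"
      using h0 by (simp add: powr_mult powr_powr)
    also have "h x powr (r / t) \<le> H powr (r / t - 1) * h x"
    proof (cases "h x = 0")
      case False
      then have "h x > 0" using h0[of x] by simp
      then have "h x powr (r / t) = h x powr (r / t - 1) * h x" by (simp add: powr_diff)
      also have "\<dots> \<le> H powr (r / t - 1) * h x"
        using t h0 hH by (intro mult_right_mono powr_mono2) auto
      finally show ?thesis .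
    qed simp
    finally show ?thesis by (simp add: C1_def mult.assoc mult_left_mono)
  qed
  have "(\<integral>\<^sup>+x. ennreal (G x powr r) \<partial>lborel) \<le> (\<integral>\<^sup>+x. ennreal C1 * ennreal (h x) \<partial>lborel)"
    using Gr C10 by (intro nn_integral_mono) (auto simp flip: ennreal_mult' intro!: ennreal_leI)
  also have "\<dots> = ennreal C1 * (\<integral>\<^sup>+x. ennreal (h x) \<partial>lborel)"
    unfolding h_def by (rule nn_integral_cmult) measurable
  also have "(\<integral>\<^sup>+x. ennreal (h x) \<partial>lborel) = (\<integral>\<^sup>+x. (\<integral>\<^sup>+y. ennreal (K (x - y)) * ennreal (cmod (f y) powr t) \<partial>lborel) \<partial>lborel)"
    unfolding h_def using scaled_kernel_bounds
    by (intro nn_integral_cong) (subst nn_integral_eq_integral[symmetric, OF i2], auto simp: ennreal_mult)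
  also have "\<dots> = (\<integral>\<^sup>+y. (\<integral>\<^sup>+x. ennreal (K (x - y)) * ennreal (cmod (f y) powr t) \<partial>lborel) \<partial>lborel)"
    by (rule lborel_pair.Fubini') measurable
  also have "\<dots> = (\<integral>\<^sup>+y. (\<integral>\<^sup>+x. ennreal (K (x - y)) \<partial>lborel) * ennreal (cmod (f y) powr t) \<partial>lborel)"
    by (intro nn_integral_cong nn_integral_multc) measurable
  also have "\<dots> \<le> (\<integral>\<^sup>+y. ennreal M * ennreal (cmod (f y) powr t) \<partial>lborel)"
    by (intro nn_integral_mono mult_right_mono scaled_kernel_nn_integral) auto
  also have "\<dots> = ennreal M * ennreal F"
    unfolding F_def Lpow_def using nn_integral_eq_integral[OF it] by (simp add: nn_integral_cmult)
  finally have "(\<integral>\<^sup>+x. ennreal (G x powr r) \<partial>lborel) \<le> ennreal C1 * (ennreal M * ennreal F)"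
    by (simp add: mult_left_mono)
  also have "\<dots> = ennreal (C1 * M * F)" using C10 M F0 by (simp add: ennreal_mult mult.assoc)
  also have "C1 * M * F = M powr r * s powr (real DIM('a) * (r / t - 1)) * F powr (r / t)"
  proof (cases "F = 0")
    case False
    then have F: "F > 0" using F0 by simp
    have "C1 * M * F = M powr ((t - 1) * (r / t)) * (M powr (r / t - 1) * s powr (real DIM('a) * (r / t - 1)) * F powr (r / t - 1)) * (M powr 1) * (F powr 1)"
      using M s F unfolding C1_def H_def by (simp add: powr_mult powr_powr flip: powr_realpow)
    also have "\<dots> = (M powr ((t - 1) * (r / t)) * M powr (r / t - 1) * M powr 1) * s powr (real DIM('a) * (r / t - 1)) * (F powr (r / t - 1) * F powr 1)"
      by (simp only: mult_ac)
    also have "\<dots> = M powr ((t - 1) * (r / t) + (r / t - 1) + 1) * s powr (real DIM('a) * (r / t - 1)) * F powr ((r / t - 1) + 1)"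
      by (simp only: powr_add)
    also have "(t - 1) * (r / t) + (r / t - 1) + 1 = r" using t by (simp add: field_simps)
    also have "(r / t - 1) + 1 = r / t" by simp
    finally show ?thesis .
  qed simp
  finally show ?thesis unfolding G_def F_def .
qed

end

text \<open>Young's inequality applied to the kernel of the multiplier; the exponent of \<open>s\<close> comes from the height of the
kernel alone.\<close>

theorem bernstein:
  fixes a :: "'a::euclidean_space \<Rightarrow> complex"
  assumes a: "a \<in> schwartz"
  obtains C where "C > 0"
    "\<And>s f t r. s > 0 \<Longrightarrow> f \<in> schwartz \<Longrightarrow> 1 \<le> t \<Longrightarrow> t \<le> r \<Longrightarrow>
      Lpow r (fmul (dil s a) f) powr (1 / r)
      \<le> C * s powr (real DIM('a) * (1 / t - 1 / r)) * Lpow t f powr (1 / t)"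
proof -
  obtain M where M: "M > 0" and ker:
    "\<And>s. s > 0 \<Longrightarrow> \<exists>K. scaled_kernel M s K \<and>
       (\<forall>f\<in>schwartz. \<forall>x. cmod (fmul (dil s a) f x) \<le> (LINT y|lborel. K (x - y) * cmod (f y)))"
    using fmul_kernel[OF a] by metis
  show ?thesis
  proof (rule that[OF M])
    fix s t r :: real and f :: "'a \<Rightarrow> complex"
    assume s: "s > 0" and f: "f \<in> schwartz" and t: "1 \<le> t" "t \<le> r"
    define g where "g = fmul (dil s a) f"
    have g: "g \<in> schwartz" unfolding g_def using s by (intro fmul_schwartz schwartz_dilate a f) auto
    obtain K where K: "scaled_kernel M s K"
      and le: "\<And>x. cmod (g x) \<le> (LINT y|lborel. K (x - y) * cmod (f y))"
      using ker[OF s] f unfolding g_def by blast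
    define R where "R = M powr r * s powr (real DIM('a) * (r / t - 1)) * Lpow t f powr (r / t)"
    have "ennreal (Lpow r g) = (\<integral>\<^sup>+x. ennreal (cmod (g x) powr r) \<partial>lborel)"
      unfolding Lpow_def using schwartz_powr_integrable[OF g, of r] t
      by (subst nn_integral_eq_integral[symmetric]) auto
    also have "\<dots> \<le> (\<integral>\<^sup>+x. ennreal ((LINT y|lborel. K (x - y) * cmod (f y)) powr r) \<partial>lborel)"
      using t le by (intro nn_integral_mono ennreal_leI powr_mono2) auto
    also have "\<dots> \<le> ennreal R"
      unfolding R_def by (rule scaled_kernel_young[OF K M s f t])
    finally have "Lpow r g \<le> R" by (simp add: R_def)
    then have "Lpow r g powr (1 / r) \<le> R powr (1 / r)" using t by (intro powr_mono2) auto
    also have "R powr (1 / r) = M powr (r * (1 / r)) * s powr (real DIM('a) * (r / t - 1) * (1 / r)) * Lpow t f powr (r / t * (1 / r))"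
      unfolding R_def by (simp add: powr_mult powr_powr)
    also have "r * (1 / r) = 1" using t by simp
    also have "real DIM('a) * (r / t - 1) * (1 / r) = real DIM('a) * (1 / t - 1 / r)" using t by (simp add: field_simps)
    also have "r / t * (1 / r) = 1 / t" using t by simp
    finally show "Lpow r (fmul (dil s a) f) powr (1 / r)
      \<le> M * s powr (real DIM('a) * (1 / t - 1 / r)) * Lpow t f powr (1 / t)"
      using M by (simp add: g_def)
  qed
qed

section \<open>The endpoint Sobolev inequality in dual form\<close>

lemma sum_geometric_nat_le:
  fixes B :: "nat set"
  assumes "finite B"
  shows "(\<Sum>n\<in>B. (2::real) powr (- real n / 2)) \<le> 4"
proof -
  define q :: real where "q = 2 powr (- 1 / 2)"
  have q0: "q > 0" by (simp add: q_def)
  have "q ^ 2 = 2 powr (- 1 / 2 + - 1 / 2)" unfolding q_def power2_eq_square powr_add ..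
  also have "\<dots> = 1 / 2" by (simp add: powr_minus_divide)
  also have "\<dots> \<le> (3 / 4) ^ 2" by (simp add: power2_eq_square)
  finally have q: "q \<le> 3 / 4" by (rule power2_le_imp_le) simp
  have qn: "(2::real) powr (- real n / 2) = q ^ n" for n
    using q0 by (simp add: q_def powr_powr flip: powr_realpow)
  have sm: "summable (\<lambda>n. q ^ n)" using q q0 by (intro summable_geometric) auto
  have "(\<Sum>n\<in>B. q ^ n) \<le> (\<Sum>n. q ^ n)"
    by (rule sum_le_suminf[OF sm assms]) (use q0 in auto)
  also have "\<dots> = 1 / (1 - q)" using q q0 by (intro suminf_geometric) auto
  also have "\<dots> \<le> 4" using q by (simp add: field_simps)
  finally show ?thesis by (simp only: qn)
qed

lemma sum_geometric_int_le:
  fixes A :: "int set" and x :: real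
  assumes "finite A"
  shows "(\<Sum>k\<in>A. (2::real) powr (- \<bar>real_of_int k - x\<bar> / 2)) \<le> 8"
proof -
  let ?g = "\<lambda>k. (2::real) powr (- \<bar>real_of_int k - x\<bar> / 2)"
  define A1 where "A1 = {k\<in>A. real_of_int k \<ge> x}"
  define A2 where "A2 = {k\<in>A. real_of_int k < x}"
  have A: "A = A1 \<union> A2" "A1 \<inter> A2 = {}" "finite A1" "finite A2"
    using assms by (auto simp: A1_def A2_def)
  have "(\<Sum>k\<in>A1. ?g k) \<le> (\<Sum>k\<in>A1. 2 powr (- real (nat (k - \<lceil>x\<rceil>)) / 2))"
  proof (rule sum_mono)
    fix k assume k: "k \<in> A1"
    then have 1: "k \<ge> \<lceil>x\<rceil>" by (simp add: A1_def ceiling_le_iff)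
    have 2: "x \<le> of_int \<lceil>x\<rceil>" by (rule le_of_int_ceiling)
    have "real (nat (k - \<lceil>x\<rceil>)) = real_of_int k - real_of_int \<lceil>x\<rceil>" using 1 by simp
    also have "\<dots> \<le> real_of_int k - x" by (rule diff_left_mono[OF 2])
    also have "\<dots> \<le> \<bar>real_of_int k - x\<bar>" by (rule abs_ge_self)
    finally show "?g k \<le> 2 powr (- real (nat (k - \<lceil>x\<rceil>)) / 2)" by (intro powr_mono) auto
  qed
  also have "\<dots> = (\<Sum>n\<in>(\<lambda>k. nat (k - \<lceil>x\<rceil>)) ` A1. 2 powr (- real n / 2))"
  proof (subst sum.reindex)
    have ge: "\<lceil>x\<rceil> \<le> k" if "k \<in> A1" for k using that by (simp add: A1_def ceiling_le_iff)
    show "inj_on (\<lambda>k. nat (k - \<lceil>x\<rceil>)) A1"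
    proof (rule inj_onI)
      fix k l assume "k \<in> A1" "l \<in> A1" "nat (k - \<lceil>x\<rceil>) = nat (l - \<lceil>x\<rceil>)"
      then show "k = l" using ge[of k] ge[of l] by (simp add: eq_nat_nat_iff)
    qed
  qed (simp only: o_def)
  also have "\<dots> \<le> 4" using A by (intro sum_geometric_nat_le) auto
  finally have le1: "(\<Sum>k\<in>A1. ?g k) \<le> 4" .
  have "(\<Sum>k\<in>A2. ?g k) \<le> (\<Sum>k\<in>A2. 2 powr (- real (nat (\<lfloor>x\<rfloor> - k)) / 2))"
  proof (rule sum_mono)
    fix k assume k: "k \<in> A2"
    then have 1: "k \<le> \<lfloor>x\<rfloor>" by (simp add: A2_def le_floor_iff)
    have 2: "of_int \<lfloor>x\<rfloor> \<le> x" by (rule of_int_floor_le)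
    have "real (nat (\<lfloor>x\<rfloor> - k)) = real_of_int \<lfloor>x\<rfloor> - real_of_int k" using 1 by simp
    also have "\<dots> \<le> x - real_of_int k" by (rule diff_right_mono[OF 2])
    also have "\<dots> \<le> \<bar>real_of_int k - x\<bar>" by simp
    finally show "?g k \<le> 2 powr (- real (nat (\<lfloor>x\<rfloor> - k)) / 2)" by (intro powr_mono) auto
  qed
  also have "\<dots> = (\<Sum>n\<in>(\<lambda>k. nat (\<lfloor>x\<rfloor> - k)) ` A2. 2 powr (- real n / 2))"
  proof (subst sum.reindex)
    have le: "k \<le> \<lfloor>x\<rfloor>" if "k \<in> A2" for k using that by (simp add: A2_def le_floor_iff)
    show "inj_on (\<lambda>k. nat (\<lfloor>x\<rfloor> - k)) A2"
    proof (rule inj_onI)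
      fix k l assume "k \<in> A2" "l \<in> A2" "nat (\<lfloor>x\<rfloor> - k) = nat (\<lfloor>x\<rfloor> - l)"
      then show "k = l" using le[of k] le[of l] by (simp add: eq_nat_nat_iff)
    qed
  qed (simp only: o_def)
  also have "\<dots> \<le> 4" using A by (intro sum_geometric_nat_le) auto
  finally have le2: "(\<Sum>k\<in>A2. ?g k) \<le> 4" .
  have "(\<Sum>k\<in>A. ?g k) = (\<Sum>k\<in>A1. ?g k) + (\<Sum>k\<in>A2. ?g k)"
    using A by (simp add: sum.union_disjoint)
  then show ?thesis using le1 le2 by simp
qed

text \<open>Write \<open>v = 2\<^bsup>\<alpha>\<kappa>\<^esup>\<close>. For \<open>k \<le> \<kappa>\<close> the summand is \<open>2\<^bsup>(\<alpha>-2)k\<^esup>\<close>, which decays at least like \<open>2\<^bsup>-(\<kappa>-k)/2\<^esup>\<close> below \<open>\<kappa>\<close> because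
\<open>\<alpha> - 2 \<ge> 1/2\<close>; for \<open>k > \<kappa>\<close> it is \<open>v 4\<^sup>-\<^sup>k\<close>. At \<open>k = \<kappa>\<close> both are equal to \<open>v\<^bsup>1-2/\<alpha>\<^esup>\<close>.\<close>

lemma sum_min_powr_le:
  fixes A :: "int set" and v \<alpha> :: real
  assumes A: "finite A" and v: "v > 0" and \<alpha>: "\<alpha> \<ge> 5 / 2"
  shows "(\<Sum>k\<in>A. 2 powr (- 2 * real_of_int k) * min v (2 powr (\<alpha> * real_of_int k))) \<le> 8 * v powr (1 - 2 / \<alpha>)"
proof -
  define \<kappa> where "\<kappa> = log 2 v / \<alpha>"
  have v\<kappa>: "v = 2 powr (\<alpha> * \<kappa>)" using v \<alpha> by (simp add: \<kappa>_def)
  have vp: "v powr (1 - 2 / \<alpha>) = 2 powr ((\<alpha> - 2) * \<kappa>)"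
  proof -
    have "\<alpha> * \<kappa> * (1 - 2 / \<alpha>) = (\<alpha> - 2) * \<kappa>" using \<alpha> by (simp add: field_simps)
    then show ?thesis unfolding v\<kappa> powr_powr by (rule arg_cong)
  qed
  have "2 powr (- 2 * real_of_int k) * min v (2 powr (\<alpha> * real_of_int k))
      \<le> 2 powr ((\<alpha> - 2) * \<kappa>) * 2 powr (- \<bar>real_of_int k - \<kappa>\<bar> / 2)" for k :: int
  proof (cases "real_of_int k \<le> \<kappa>")
    case True
    have "2 powr (- 2 * real_of_int k) * min v (2 powr (\<alpha> * real_of_int k))
        \<le> 2 powr (- 2 * real_of_int k) * 2 powr (\<alpha> * real_of_int k)"
      by (intro mult_left_mono) auto
    also have "\<dots> = 2 powr ((\<alpha> - 2) * real_of_int k)" by (simp add: algebra_simps flip: powr_add)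
    also have "\<dots> \<le> 2 powr ((\<alpha> - 2) * \<kappa> + (- \<bar>real_of_int k - \<kappa>\<bar> / 2))"
    proof (rule powr_mono)
      have "0 \<le> (\<alpha> - 5/2) * (\<kappa> - real_of_int k)" using True \<alpha> by (intro mult_nonneg_nonneg) auto
      then show "(\<alpha> - 2) * real_of_int k \<le> (\<alpha> - 2) * \<kappa> + (- \<bar>real_of_int k - \<kappa>\<bar> / 2)"
        using True by (simp add: field_simps)
    qed simp
    finally show ?thesis by (simp only: powr_add)
  next
    case False
    have "2 powr (- 2 * real_of_int k) * min v (2 powr (\<alpha> * real_of_int k))
        \<le> 2 powr (- 2 * real_of_int k) * 2 powr (\<alpha> * \<kappa>)"
      unfolding v\<kappa>[symmetric] by (intro mult_left_mono) auto
    also have "\<dots> = 2 powr (\<alpha> * \<kappa> - 2 * real_of_int k)" by (simp add: algebra_simps flip: powr_add)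
    also have "\<dots> \<le> 2 powr ((\<alpha> - 2) * \<kappa> + (- \<bar>real_of_int k - \<kappa>\<bar> / 2))"
      using False by (intro powr_mono) (auto simp: field_simps)
    finally show ?thesis by (simp only: powr_add)
  qed
  then have "(\<Sum>k\<in>A. 2 powr (- 2 * real_of_int k) * min v (2 powr (\<alpha> * real_of_int k)))
     \<le> (\<Sum>k\<in>A. 2 powr ((\<alpha> - 2) * \<kappa>) * 2 powr (- \<bar>real_of_int k - \<kappa>\<bar> / 2))"
    by (rule sum_mono)
  also have "\<dots> = 2 powr ((\<alpha> - 2) * \<kappa>) * (\<Sum>k\<in>A. 2 powr (- \<bar>real_of_int k - \<kappa>\<bar> / 2))"
    by (simp add: sum_distrib_left)
  also have "\<dots> \<le> 2 powr ((\<alpha> - 2) * \<kappa>) * 8"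
    by (intro mult_left_mono sum_geometric_int_le A) auto
  finally show ?thesis by (simp add: vp)
qed

context
  fixes M s :: real and K :: "'a::euclidean_space \<Rightarrow> real"
  assumes K: "scaled_kernel M s K" and M: "M > 0" and s: "s > 0"
begin

text \<open>Values of \<open>\<bar>f\<bar>\<close> up to the threshold \<open>\<sigma> = s\<^sup>\<alpha>\<close> are integrated against the mass of \<open>K\<close>, larger values against its height,
where Chebyshev's inequality bounds their integral by \<open>\<sigma>\<^bsup>1-t\<^esup>\<close>. The relation between \<open>\<alpha>\<close> and \<open>t\<close> makes the two
contributions equal at the threshold.\<close>

lemma scaled_kernel_truncated:
  fixes f :: "'a \<Rightarrow> complex" and v \<alpha> t :: real
  assumes f: "f \<in> schwartz" and t: "t \<ge> 1" and F: "Lpow t f \<le> 1" and v: "v \<ge> 0"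
    and \<alpha>: "real DIM('a) + \<alpha> * (1 - t) = \<alpha>"
  shows "(\<integral>\<^sup>+y. ennreal (K (x - y) * cmod (f y)) * indicator {y. cmod (f y) \<le> v} y \<partial>lborel)
     \<le> ennreal (2 * M * min v (s powr \<alpha>))"
proof -
  have [measurable]: "f \<in> borel_measurable borel" by (rule schwartz_measurable[OF f])
  note [measurable] = scaled_kernel_measurable[OF K M s]
  note Kb = scaled_kernel_bounds[OF K M s]
  define \<sigma> where "\<sigma> = s powr \<alpha>"
  have \<sigma>: "\<sigma> > 0" using s by (simp add: \<sigma>_def)
  show ?thesis
  proof (cases "v \<le> \<sigma>")
    case True
    have "(\<integral>\<^sup>+y. ennreal (K (x - y) * cmod (f y)) * indicator {y. cmod (f y) \<le> v} y \<partial>lborel)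
       \<le> (\<integral>\<^sup>+y. ennreal (K (x - y)) * ennreal v \<partial>lborel)"
    proof (rule nn_integral_mono)
      fix y
      have "K (x - y) * cmod (f y) \<le> K (x - y) * v" if "cmod (f y) \<le> v"
        using that by (intro mult_left_mono Kb)
      then have "ennreal (K (x - y) * cmod (f y)) * indicator {y. cmod (f y) \<le> v} y \<le> ennreal (K (x - y) * v)"
        by (simp add: indicator_def ennreal_leI)
      then show "ennreal (K (x - y) * cmod (f y)) * indicator {y. cmod (f y) \<le> v} y \<le> ennreal (K (x - y)) * ennreal v"
        by (simp only: ennreal_mult[OF Kb(1) v])
    qed
    also have "\<dots> = (\<integral>\<^sup>+y. ennreal (K (x - y)) \<partial>lborel) * ennreal v"
      by (rule nn_integral_multc) measurable
    also have "\<dots> \<le> ennreal M * ennreal v"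
      by (intro mult_right_mono scaled_kernel_nn_integral[OF K M s]) auto
    also have "\<dots> \<le> ennreal (2 * M * v)" using M v by (simp flip: ennreal_mult add: ennreal_leI)
    finally show ?thesis using True by (simp add: \<sigma>_def min_def)
  next
    case False
    define c where "c = M * s ^ DIM('a) * \<sigma> powr (1 - t)"
    have c: "c \<ge> 0" using M s by (simp add: c_def)
    have c_eq: "c = M * \<sigma>"
    proof -
      have "c = M * (s powr real DIM('a) * s powr (\<alpha> * (1 - t)))"
        using s by (simp add: c_def \<sigma>_def powr_powr powr_realpow)
      also have "\<dots> = M * s powr (real DIM('a) + \<alpha> * (1 - t))" by (simp only: powr_add)
      finally show ?thesis unfolding \<alpha> \<sigma>_def .
    qed
    have pt: "K (x - y) * cmod (f y) \<le> \<sigma> * K (x - y) + c * cmod (f y) powr t" for y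
    proof (cases "cmod (f y) \<le> \<sigma>")
      case True
      then have "K (x - y) * cmod (f y) \<le> K (x - y) * \<sigma>" by (intro mult_left_mono Kb)
      then show ?thesis using c by (simp add: mult.commute add_increasing2)
    next
      case False
      then have fy: "cmod (f y) > 0" using \<sigma> by linarith
      have "\<sigma> powr (1 - t) * cmod (f y) powr t = \<sigma> powr (1 - t) * (cmod (f y) powr (t - 1) * cmod (f y))"
        using fy by (simp add: powr_diff)
      also have "\<dots> \<ge> \<sigma> powr (1 - t) * (\<sigma> powr (t - 1) * cmod (f y))"
        using False \<sigma> t by (intro mult_left_mono mult_right_mono powr_mono2) auto
      also have "\<sigma> powr (1 - t) * (\<sigma> powr (t - 1) * cmod (f y)) = cmod (f y)"
        using \<sigma> by (simp add: mult.assoc[symmetric] flip: powr_add)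
      finally have "cmod (f y) \<le> \<sigma> powr (1 - t) * cmod (f y) powr t" .
      then have "K (x - y) * cmod (f y) \<le> (M * s ^ DIM('a)) * (\<sigma> powr (1 - t) * cmod (f y) powr t)"
        using Kb[of "x - y"] by (intro mult_mono) auto
      also have "\<dots> = c * cmod (f y) powr t" by (simp add: c_def)
      finally show ?thesis using \<sigma> Kb[of "x - y"] by (simp add: add_increasing)
    qed
    have "(\<integral>\<^sup>+y. ennreal (K (x - y) * cmod (f y)) * indicator {y. cmod (f y) \<le> v} y \<partial>lborel)
       \<le> (\<integral>\<^sup>+y. ennreal \<sigma> * ennreal (K (x - y)) + ennreal c * ennreal (cmod (f y) powr t) \<partial>lborel)"
    proof (rule nn_integral_mono)
      fix y
      have "ennreal (K (x - y) * cmod (f y)) * indicator {y. cmod (f y) \<le> v} y \<le> ennreal (K (x - y) * cmod (f y))"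
        by (simp add: indicator_def)
      also have "\<dots> \<le> ennreal (\<sigma> * K (x - y) + c * cmod (f y) powr t)" by (rule ennreal_leI[OF pt])
      also have "\<dots> = ennreal \<sigma> * ennreal (K (x - y)) + ennreal c * ennreal (cmod (f y) powr t)"
        using \<sigma> c Kb by (simp add: ennreal_mult)
      finally show "ennreal (K (x - y) * cmod (f y)) * indicator {y. cmod (f y) \<le> v} y
        \<le> ennreal \<sigma> * ennreal (K (x - y)) + ennreal c * ennreal (cmod (f y) powr t)" .
    qed
    also have "\<dots> = ennreal \<sigma> * (\<integral>\<^sup>+y. ennreal (K (x - y)) \<partial>lborel) + ennreal c * (\<integral>\<^sup>+y. ennreal (cmod (f y) powr t) \<partial>lborel)"
      by (simp add: nn_integral_add nn_integral_cmult)
    also have "(\<integral>\<^sup>+y. ennreal (cmod (f y) powr t) \<partial>lborel) = ennreal (Lpow t f)"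
      unfolding Lpow_def by (rule nn_integral_eq_integral[OF schwartz_powr_integrable[OF f t]]) auto
    also have "ennreal \<sigma> * (\<integral>\<^sup>+y. ennreal (K (x - y)) \<partial>lborel) + ennreal c * ennreal (Lpow t f)
       \<le> ennreal \<sigma> * ennreal M + ennreal c * ennreal 1"
      by (rule add_mono[OF mult_left_mono[OF scaled_kernel_nn_integral(1)[OF K M s]] mult_left_mono[OF ennreal_leI[OF F]]]) simp_all
    also have "ennreal \<sigma> * ennreal M = ennreal (M * \<sigma>)"
      using \<sigma> M by (simp add: mult.commute ennreal_mult)
    also have "ennreal c * ennreal 1 = ennreal (M * \<sigma>)" by (simp add: c_eq)
    also have "ennreal (M * \<sigma>) + ennreal (M * \<sigma>) = ennreal (M * \<sigma> + M * \<sigma>)"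
      using \<sigma> M by (intro ennreal_plus[symmetric]) auto
    also have "M * \<sigma> + M * \<sigma> = 2 * M * \<sigma>" by simp
    finally show ?thesis using False by (simp add: \<sigma>_def min_def)
  qed
qed

end

text \<open>Up to exchanging \<open>x\<close> and \<open>y\<close>, which reflects the kernel, \<open>\<bar>f y\<bar> \<le> \<bar>f x\<bar>\<close>; then the inner integral is truncated
at the height \<open>\<bar>f x\<bar>\<close>.\<close>

lemma scaled_kernel_bilinear:
  fixes K :: "'a::euclidean_space \<Rightarrow> real" and f :: "'a \<Rightarrow> complex" and \<alpha> t :: real
  assumes K: "scaled_kernel M s K" and M: "M > 0" and s: "s > 0"
    and f: "f \<in> schwartz" and t: "t \<ge> 1" and F: "Lpow t f \<le> 1"
    and \<alpha>: "real DIM('a) + \<alpha> * (1 - t) = \<alpha>"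
  shows "(\<integral>\<^sup>+x. (\<integral>\<^sup>+y. ennreal (K (x - y) * cmod (f y)) \<partial>lborel) * ennreal (cmod (f x)) \<partial>lborel)
     \<le> ennreal (4 * M) * (\<integral>\<^sup>+x. ennreal (cmod (f x) * min (cmod (f x)) (s powr \<alpha>)) \<partial>lborel)"
proof -
  have [measurable]: "f \<in> borel_measurable borel" by (rule schwartz_measurable[OF f])
  note [measurable] = scaled_kernel_measurable[OF K M s]
  note Kb = scaled_kernel_bounds[OF K M s]
  have K': "scaled_kernel M s (\<lambda>z. K (- z))"
    using scaled_kernel_integral(1,2)[OF K M s, of 0] Kb unfolding scaled_kernel_def by simp
  define P where "P = (\<lambda>x y. ennreal (K (x - y) * cmod (f y)) * indicator {y. cmod (f y) \<le> cmod (f x)} y)"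
  define Q where "Q = (\<lambda>x y. ennreal (K (- (y - x)) * cmod (f x)) * indicator {x. cmod (f x) \<le> cmod (f y)} x)"
  define R where "R = (\<integral>\<^sup>+x. ennreal (cmod (f x) * min (cmod (f x)) (s powr \<alpha>)) \<partial>lborel)"
  have pt: "ennreal (K (x - y) * cmod (f y)) * ennreal (cmod (f x))
      \<le> P x y * ennreal (cmod (f x)) + Q x y * ennreal (cmod (f y))" for x y
  proof (cases "cmod (f y) \<le> cmod (f x)")
    case True
    then have "P x y = ennreal (K (x - y) * cmod (f y))" by (simp add: P_def)
    then show ?thesis by simp
  next
    case False
    then have "Q x y = ennreal (K (x - y) * cmod (f x))" by (simp add: Q_def)
    moreover have "ennreal (K (x - y) * cmod (f y)) * ennreal (cmod (f x))
       = ennreal (K (x - y) * cmod (f x)) * ennreal (cmod (f y))"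
      unfolding ennreal_mult[OF Kb(1) norm_ge_zero] by (simp only: mult_ac)
    ultimately show ?thesis by simp
  qed
  have half: "(\<integral>\<^sup>+y. ennreal (2 * M * min (cmod (f y)) (s powr \<alpha>)) * ennreal (cmod (f y)) \<partial>lborel) = ennreal (2 * M) * R"
  proof -
    have "ennreal (2 * M * min (cmod (f y)) (s powr \<alpha>)) * ennreal (cmod (f y))
       = ennreal (2 * M) * ennreal (cmod (f y) * min (cmod (f y)) (s powr \<alpha>))" for y
    proof -
      have m: "0 \<le> min (cmod (f y)) (s powr \<alpha>)" by simp
      show ?thesis
        using M by (simp only: ennreal_mult[OF _ m] ennreal_mult[OF norm_ge_zero m] mult_ac) (simp add: ennreal_mult mult_ac)
    qed
    then show ?thesis unfolding R_def by (simp add: nn_integral_cmult)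
  qed
  have "(\<integral>\<^sup>+x. (\<integral>\<^sup>+y. ennreal (K (x - y) * cmod (f y)) \<partial>lborel) * ennreal (cmod (f x)) \<partial>lborel)
     = (\<integral>\<^sup>+x. (\<integral>\<^sup>+y. ennreal (K (x - y) * cmod (f y)) * ennreal (cmod (f x)) \<partial>lborel) \<partial>lborel)"
    by (intro nn_integral_cong nn_integral_multc[symmetric]) measurable
  also have "\<dots> \<le> (\<integral>\<^sup>+x. (\<integral>\<^sup>+y. P x y * ennreal (cmod (f x)) + Q x y * ennreal (cmod (f y)) \<partial>lborel) \<partial>lborel)"
    by (intro nn_integral_mono pt)
  also have "\<dots> = (\<integral>\<^sup>+x. (\<integral>\<^sup>+y. P x y * ennreal (cmod (f x)) \<partial>lborel) \<partial>lborel)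
      + (\<integral>\<^sup>+x. (\<integral>\<^sup>+y. Q x y * ennreal (cmod (f y)) \<partial>lborel) \<partial>lborel)"
    by (subst nn_integral_add[symmetric]; (intro nn_integral_cong nn_integral_add)?)
       (unfold P_def Q_def indicator_def, measurable)
  also have "(\<integral>\<^sup>+x. (\<integral>\<^sup>+y. P x y * ennreal (cmod (f x)) \<partial>lborel) \<partial>lborel)
      = (\<integral>\<^sup>+x. (\<integral>\<^sup>+y. P x y \<partial>lborel) * ennreal (cmod (f x)) \<partial>lborel)"
    by (intro nn_integral_cong nn_integral_multc) (unfold P_def Q_def indicator_def, measurable)
  also have "\<dots> \<le> (\<integral>\<^sup>+x. ennreal (2 * M * min (cmod (f x)) (s powr \<alpha>)) * ennreal (cmod (f x)) \<partial>lborel)"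
    unfolding P_def by (intro nn_integral_mono mult_right_mono scaled_kernel_truncated[OF K M s f t F _ \<alpha>]) auto
  also have "\<dots> = ennreal (2 * M) * R" by (rule half)
  also have "(\<integral>\<^sup>+x. (\<integral>\<^sup>+y. Q x y * ennreal (cmod (f y)) \<partial>lborel) \<partial>lborel)
      = (\<integral>\<^sup>+y. (\<integral>\<^sup>+x. Q x y * ennreal (cmod (f y)) \<partial>lborel) \<partial>lborel)"
    by (rule lborel_pair.Fubini') (unfold P_def Q_def indicator_def, measurable)
  also have "\<dots> = (\<integral>\<^sup>+y. (\<integral>\<^sup>+x. Q x y \<partial>lborel) * ennreal (cmod (f y)) \<partial>lborel)"
    by (intro nn_integral_cong nn_integral_multc) (unfold P_def Q_def indicator_def, measurable)
  also have "\<dots> \<le> (\<integral>\<^sup>+y. ennreal (2 * M * min (cmod (f y)) (s powr \<alpha>)) * ennreal (cmod (f y)) \<partial>lborel)"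
  proof (intro nn_integral_mono mult_right_mono)
    fix y show "(\<integral>\<^sup>+x. Q x y \<partial>lborel) \<le> ennreal (2 * M * min (cmod (f y)) (s powr \<alpha>))"
      unfolding Q_def
      by (rule scaled_kernel_truncated[OF K' M s f t F _ \<alpha>]) simp
  qed auto
  also have "\<dots> = ennreal (2 * M) * R" by (rule half)
  also have "ennreal (2 * M) * R + ennreal (2 * M) * R = ennreal (4 * M) * R"
    using M by (simp flip: distrib_right ennreal_plus)
  finally show ?thesis unfolding R_def by (simp add: add_mono)
qed

text \<open>Bernstein's inequality bounds each summand by a multiple of the right-hand side, which does not bound
their sum. By Plancherel's theorem each energy is a bilinear form in \<open>f\<close> whose kernel is localized at scale \<open>2\<^sup>-\<^sup>k\<close>. For \<open>f\<close> normalized in \<open>L\<^sup>t\<close> it is at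
most a multiple of \<open>\<integral> \<bar>f\<bar> min \<bar>f\<bar> 2\<^bsup>\<alpha>k\<^esup>\<close> with \<open>\<alpha> = (d + 2) / 2\<close>; weighted by \<open>4\<^sup>-\<^sup>k\<close>, the sum of the integrands over all \<open>k\<close>
is at most a multiple of \<open>\<bar>f\<bar>\<^sup>t\<close> at every point.\<close>

theorem endpoint_sobolev:
  fixes a :: "'a::euclidean_space \<Rightarrow> complex"
  assumes a: "a \<in> schwartz" and d: "DIM('a) \<ge> 3" and t: "t = 2 * real DIM('a) / (real DIM('a) + 2)"
  obtains C where "C > 0"
    "\<And>f A. f \<in> schwartz \<Longrightarrow> finite A \<Longrightarrow>
      (\<Sum>k\<in>A. 2 powr (- 2 * real_of_int k) * Lpow 2 (fmul (dil (2 powi k) a) f)) \<le> C * (Lpow t f powr (1 / t))\<^sup>2"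
proof -
  define d' where "d' = real DIM('a)"
  \<comment> \<open>The exponent for which \<open>2\<^bsup>\<alpha>k\<^esup>\<close> is the natural threshold: \<open>d + \<alpha> (1 - t) = \<alpha>\<close> and \<open>1 - 2 / \<alpha> = t - 1\<close>.\<close>
  define \<alpha> where "\<alpha> = (d' + 2) / 2"
  have d': "d' \<ge> 3" using d by (simp add: d'_def)
  have t1: "t > 1" using d' unfolding t d'_def[symmetric] by (simp add: field_simps)
  have \<alpha>1: "real DIM('a) + \<alpha> * (1 - t) = \<alpha>"
    using d' unfolding t d'_def[symmetric] \<alpha>_def by (simp add: field_simps)
  have \<alpha>2: "1 - 2 / \<alpha> = t - 1"
    using d' unfolding t d'_def[symmetric] \<alpha>_def by (simp add: field_simps)
  have \<alpha>3: "\<alpha> \<ge> 5 / 2" using d' by (simp add: \<alpha>_def)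
  \<comment> \<open>The energy of the multiplier \<open>a\<close> is the pairing of the multiplier \<open>\<bar>a\<bar>\<^sup>2\<close> with \<open>f\<close> itself.\<close>
  define b where "b = (\<lambda>\<xi>. a \<xi> * cnj (a \<xi>))"
  have b: "b \<in> schwartz" unfolding b_def by (intro schwartz_mult schwartz_cnj a)
  obtain M where M: "M > 0" and ker:
    "\<And>s. s > 0 \<Longrightarrow> \<exists>K. scaled_kernel M s K \<and>
       (\<forall>f\<in>schwartz. \<forall>x. cmod (fmul (dil s b) f x) \<le> (LINT y|lborel. K (x - y) * cmod (f y)))"
    using fmul_kernel[OF b] by metis
  have normalized: "(\<Sum>k\<in>A. 2 powr (- 2 * real_of_int k) * Lpow 2 (fmul (dil (2 powi k) a) f)) \<le> 32 * M"
    if f: "f \<in> schwartz" and A: "finite A" and F: "Lpow t f \<le> 1" for f and A :: "int set"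
  proof -
    have [measurable]: "f \<in> borel_measurable borel" by (rule schwartz_measurable[OF f])
    define w where "w = (\<lambda>k x. cmod (f x) * min (cmod (f x)) (2 powr (\<alpha> * real_of_int k)))"
    have w0: "w k x \<ge> 0" for k x by (simp add: w_def)
    have one: "ennreal (Lpow 2 (fmul (dil (2 powi k) a) f)) \<le> ennreal (4 * M) * (\<integral>\<^sup>+x. ennreal (w k x) \<partial>lborel)" for k
    proof -
      define s where "s = (2::real) powi k"
      have s: "s > 0" by (simp add: s_def)
      have s\<alpha>: "s powr \<alpha> = 2 powr (\<alpha> * real_of_int k)"
        by (simp add: s_def powr_real_of_int' powr_powr mult.commute flip: powr_real_of_int')
      have as: "(dil s a) \<in> schwartz" and bs: "(dil s b) \<in> schwartz"
        using s by (auto intro!: schwartz_dilate a b)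
      obtain K where K: "scaled_kernel M s K"
        and le: "\<And>x. cmod (fmul (dil s b) f x) \<le> (LINT y|lborel. K (x - y) * cmod (f y))"
        using ker[OF s] f by blast
      note Kb = scaled_kernel_bounds[OF K M s]
      obtain B where B: "\<And>x. cmod (f x) \<le> B" using schwartz_bdd[OF f] by metis
      let ?g = "fmul (dil s a) f" and ?h = "fmul (dil s b) f"
      have gs: "?g \<in> schwartz" and hs: "?h \<in> schwartz" by (intro fmul_schwartz as bs f)+
      have "Lpow 2 ?g = (LINT x|lborel. (cmod (?g x))\<^sup>2)" by (simp add: Lpow_def)
      also have "\<dots> = (LINT \<xi>|lborel. (cmod (fourier ?g \<xi>))\<^sup>2)" by (rule plancherel_norm[OF gs, symmetric])
      finally have "complex_of_real (Lpow 2 ?g) = (LINT \<xi>|lborel. of_real ((cmod (fourier ?g \<xi>))\<^sup>2))"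
        by (simp only: integral_complex_of_real)
      also have "\<dots> = (LINT \<xi>|lborel. fourier ?h \<xi> * cnj (fourier f \<xi>))"
        unfolding complex_norm_square fourier_fmul[OF as f] fourier_fmul[OF bs f]
        by (simp add: b_def mult_ac)
      also have "\<dots> = (LINT x|lborel. ?h x * cnj (f x))" by (rule plancherel[OF hs f])
      finally have "Lpow 2 ?g = cmod (LINT x|lborel. ?h x * cnj (f x))"
        by (metis Lpow_nonneg abs_of_nonneg norm_of_real)
      then have "ennreal (Lpow 2 ?g) = ennreal (cmod (LINT x|lborel. ?h x * cnj (f x)))" by simp
      also have "\<dots> \<le> (\<integral>\<^sup>+x. ennreal (norm (?h x * cnj (f x))) \<partial>lborel)"
        by (intro integral_norm_bound_ennreal schwartz_mult_integrable hs schwartz_cnj f)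
      also have "\<dots> \<le> (\<integral>\<^sup>+x. (\<integral>\<^sup>+y. ennreal (K (x - y) * cmod (f y)) \<partial>lborel) * ennreal (cmod (f x)) \<partial>lborel)"
      proof (rule nn_integral_mono)
        fix x
        have i: "integrable lborel (\<lambda>y. K (x - y) * cmod (f y))"
          by (rule scaled_kernel_mult_integrable[OF K M s, where B=B]) (use B in auto)
        have "ennreal (norm (?h x * cnj (f x))) = ennreal (cmod (?h x)) * ennreal (cmod (f x))"
          by (simp add: norm_mult ennreal_mult)
        also have "\<dots> \<le> ennreal (LINT y|lborel. K (x - y) * cmod (f y)) * ennreal (cmod (f x))"
          by (intro mult_right_mono ennreal_leI le) simp
        also have "ennreal (LINT y|lborel. K (x - y) * cmod (f y)) = (\<integral>\<^sup>+y. ennreal (K (x - y) * cmod (f y)) \<partial>lborel)"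
          using Kb by (intro nn_integral_eq_integral[symmetric] i) simp
        finally show "ennreal (norm (?h x * cnj (f x))) \<le> (\<integral>\<^sup>+y. ennreal (K (x - y) * cmod (f y)) \<partial>lborel) * ennreal (cmod (f x))" .
      qed
      also have "\<dots> \<le> ennreal (4 * M) * (\<integral>\<^sup>+x. ennreal (cmod (f x) * min (cmod (f x)) (s powr \<alpha>)) \<partial>lborel)"
        by (rule scaled_kernel_bilinear[OF K M s f _ F \<alpha>1]) (use t1 in simp)
      finally show ?thesis unfolding w_def s\<alpha>[symmetric] unfolding s_def .
    qed
    have "ennreal (\<Sum>k\<in>A. 2 powr (- 2 * real_of_int k) * Lpow 2 (fmul (dil (2 powi k) a) f))
       = (\<Sum>k\<in>A. ennreal (2 powr (- 2 * real_of_int k)) * ennreal (Lpow 2 (fmul (dil (2 powi k) a) f)))"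
      by (simp add: sum_ennreal[symmetric] ennreal_mult)
    also have "\<dots> \<le> (\<Sum>k\<in>A. ennreal (2 powr (- 2 * real_of_int k)) * (ennreal (4 * M) * (\<integral>\<^sup>+x. ennreal (w k x) \<partial>lborel)))"
      by (intro sum_mono mult_left_mono one) simp
    also have "\<dots> = ennreal (4 * M) * (\<Sum>k\<in>A. \<integral>\<^sup>+x. ennreal (2 powr (- 2 * real_of_int k)) * ennreal (w k x) \<partial>lborel)"
    proof -
      have "(\<integral>\<^sup>+x. ennreal (2 powr (- 2 * real_of_int k)) * ennreal (w k x) \<partial>lborel)
          = ennreal (2 powr (- 2 * real_of_int k)) * (\<integral>\<^sup>+x. ennreal (w k x) \<partial>lborel)" for k
        unfolding w_def by (rule nn_integral_cmult) measurable
      then show ?thesis by (simp add: sum_distrib_left mult_ac)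
    qed
    also have "(\<Sum>k\<in>A. \<integral>\<^sup>+x. ennreal (2 powr (- 2 * real_of_int k)) * ennreal (w k x) \<partial>lborel)
       = (\<integral>\<^sup>+x. (\<Sum>k\<in>A. ennreal (2 powr (- 2 * real_of_int k)) * ennreal (w k x)) \<partial>lborel)"
      unfolding w_def by (rule nn_integral_sum[symmetric]) measurable
    also have "\<dots> \<le> (\<integral>\<^sup>+x. ennreal 8 * ennreal (cmod (f x) powr t) \<partial>lborel)"
    proof (rule nn_integral_mono)
      fix x
      have "(\<Sum>k\<in>A. 2 powr (- 2 * real_of_int k) * w k x) \<le> 8 * cmod (f x) powr t"
      proof (cases "f x = 0")
        case False
        have "(\<Sum>k\<in>A. 2 powr (- 2 * real_of_int k) * w k x)
           = cmod (f x) * (\<Sum>k\<in>A. 2 powr (- 2 * real_of_int k) * min (cmod (f x)) (2 powr (\<alpha> * real_of_int k)))"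
          unfolding w_def sum_distrib_left by (simp only: mult_ac)
        also have "\<dots> \<le> cmod (f x) * (8 * cmod (f x) powr (1 - 2 / \<alpha>))"
          using False by (intro mult_left_mono sum_min_powr_le A \<alpha>3) auto
        also have "\<dots> = 8 * cmod (f x) powr t" using False by (simp add: \<alpha>2 powr_diff)
        finally show ?thesis .
      qed (simp add: w_def)
      then have "ennreal (\<Sum>k\<in>A. 2 powr (- 2 * real_of_int k) * w k x) \<le> ennreal (8 * cmod (f x) powr t)"
        by (rule ennreal_leI)
      moreover have "ennreal (\<Sum>k\<in>A. 2 powr (- 2 * real_of_int k) * w k x)
         = (\<Sum>k\<in>A. ennreal (2 powr (- 2 * real_of_int k)) * ennreal (w k x))"
        using w0 by (simp add: sum_ennreal[symmetric] ennreal_mult)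
      ultimately show "(\<Sum>k\<in>A. ennreal (2 powr (- 2 * real_of_int k)) * ennreal (w k x)) \<le> ennreal 8 * ennreal (cmod (f x) powr t)"
        by (simp add: ennreal_mult)
    qed
    also have "\<dots> = ennreal 8 * (\<integral>\<^sup>+x. ennreal (cmod (f x) powr t) \<partial>lborel)"
      by (rule nn_integral_cmult) measurable
    also have "(\<integral>\<^sup>+x. ennreal (cmod (f x) powr t) \<partial>lborel) = ennreal (Lpow t f)"
      unfolding Lpow_def by (rule nn_integral_eq_integral[OF schwartz_powr_integrable[OF f]]) (use t1 in auto)
    also have "\<dots> \<le> 1" using F by simp
    finally have "ennreal (\<Sum>k\<in>A. 2 powr (- 2 * real_of_int k) * Lpow 2 (fmul (dil (2 powi k) a) f))
       \<le> ennreal (4 * M) * (ennreal 8 * 1)"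
      by (simp add: mult_left_mono)
    also have "\<dots> = ennreal (32 * M)"
    proof -
      have "ennreal (4 * M) * ennreal 8 = ennreal (4 * M * 8)" using M by (intro ennreal_mult[symmetric]) auto
      then show ?thesis by (simp add: mult.commute)
    qed
    finally show ?thesis using M by simp
  qed
  have "32 * M > 0" using M by simp
  then show ?thesis
  proof (rule that)
    fix f :: "'a \<Rightarrow> complex" and A :: "int set" assume f: "f \<in> schwartz" and A: "finite A"
    show "(\<Sum>k\<in>A. 2 powr (- 2 * real_of_int k) * Lpow 2 (fmul (dil (2 powi k) a) f)) \<le> 32 * M * (Lpow t f powr (1 / t))\<^sup>2"
      (is "?S f \<le> _")
    proof (cases "Lpow t f = 0")
      case True
      have "AE x in lborel. cmod (f x) powr t = 0"
        using True schwartz_powr_integrable[OF f, of t] t1 unfolding Lpow_def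
        by (subst (asm) integral_nonneg_eq_0_iff_AE) auto
      then have ae: "AE x in lborel. f x = 0" by (simp add: powr_eq_0_iff)
      have "fourier f \<xi> = 0" for \<xi>
      proof -
        have "(LINT x|lborel. exp (- \<i> * of_real (x \<bullet> \<xi>)) * f x) = 0"
          using ae by (intro integral_eq_zero_AE) auto
        then show ?thesis by (simp add: fourier_def)
      qed
      then have "fmul b f x = 0" for b x by (simp add: fmul_def inv_fourier_def)
      then have "?S f = 0" by (simp add: Lpow_def)
      then show ?thesis using M by simp
    next
      case False
      define N where "N = Lpow t f powr (1 / t)"
      have Lp: "Lpow t f > 0" using False Lpow_nonneg[of t f] by linarith
      then have N: "N > 0" by (simp add: N_def)
      define g where "g = (\<lambda>x. complex_of_real (1 / N) * f x)"
      have g: "g \<in> schwartz" unfolding g_def by (rule schwartz_scale[OF f])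
      have "Lpow t g = (1 / N) powr t * Lpow t f" unfolding g_def using N by (intro Lpow_scale) simp
      also have "(1 / N) powr t = 1 / Lpow t f"
        using Lp t1 N by (simp add: powr_divide N_def powr_powr)
      finally have "Lpow t g \<le> 1" using Lp by simp
      then have le: "?S g \<le> 32 * M" by (rule normalized[OF g A])
      have "fmul c g x = of_real (1 / N) * fmul c f x" for c x
      proof -
        have "fmul c g x = inv_fourier (\<lambda>\<xi>. of_real (1 / N) * (c \<xi> * fourier f \<xi>)) x"
          unfolding fmul_def g_def fourier_scale by (simp only: mult_ac)
        then show ?thesis unfolding inv_fourier_eq fourier_scale fmul_def .
      qed
      then have "fmul c g = (\<lambda>x. of_real (1 / N) * fmul c f x)" for c by (rule ext)
      then have "Lpow 2 (fmul c g) = (1 / N)\<^sup>2 * Lpow 2 (fmul c f)" for c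
        using Lpow_scale[of "1 / N" 2 "fmul c f"] N by simp
      then have "?S g = (1 / N)\<^sup>2 * ?S f" by (simp add: sum_distrib_left mult_ac)
      then have "?S f = N\<^sup>2 * ?S g" using N by (simp add: field_simps)
      also have "\<dots> \<le> N\<^sup>2 * (32 * M)" using le by (intro mult_left_mono) auto
      finally show ?thesis by (simp add: N_def mult.commute)
    qed
  qed
qed

section \<open>Energy of a multiplier on functions of compact support\<close>

lemma Lpow_2: "Lpow 2 f = (LINT x|lborel. (cmod (f x))\<^sup>2)"
  by (simp add: Lpow_def)

lemma schwartz_square_integrable: "f \<in> schwartz \<Longrightarrow> integrable lborel (\<lambda>x. (cmod (f x))\<^sup>2)"
  using schwartz_powr_integrable[of f 2] by simp

lemma Lpow_2_fourier: "f \<in> schwartz \<Longrightarrow> Lpow 2 (fourier f) = Lpow 2 f"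
  unfolding Lpow_2 by (rule plancherel_norm)

lemma Lpow_2_inv_fourier: "f \<in> schwartz \<Longrightarrow> Lpow 2 (inv_fourier f) = Lpow 2 f"
  using Lpow_2_fourier[OF inv_fourier_schwartz, of f] by (simp add: Lpow_def fourier_inversion')

lemma Lpow_2_fmul:
  "a \<in> schwartz \<Longrightarrow> f \<in> schwartz \<Longrightarrow> Lpow 2 (fmul a f) = Lpow 2 (\<lambda>\<xi>. a \<xi> * fourier f \<xi>)"
  unfolding fmul_def by (intro Lpow_2_inv_fourier schwartz_mult fourier_schwartz)

lemma Lpow_2_mono:
  assumes "f \<in> schwartz" "g \<in> schwartz" "\<And>x. cmod (f x) \<le> c * cmod (g x)"
  shows "Lpow 2 f \<le> c\<^sup>2 * Lpow 2 g"
proof -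
  have "(cmod (f x))\<^sup>2 \<le> c\<^sup>2 * (cmod (g x))\<^sup>2" for x
    using power_mono[OF assms(3)[of x], of 2] by (simp add: power_mult_distrib)
  then have "(LINT x|lborel. (cmod (f x))\<^sup>2) \<le> (LINT x|lborel. c\<^sup>2 * (cmod (g x))\<^sup>2)"
    by (intro integral_mono integrable_mult_right schwartz_square_integrable assms)
  then show ?thesis by (simp add: Lpow_2)
qed

lemma Lpow_2_add_le:
  assumes "f \<in> schwartz" "g \<in> schwartz"
  shows "Lpow 2 (\<lambda>x. f x + g x) \<le> 2 * Lpow 2 f + 2 * Lpow 2 g"
proof -
  have "(cmod (f x + g x))\<^sup>2 \<le> 2 * (cmod (f x))\<^sup>2 + 2 * (cmod (g x))\<^sup>2" for x
  proof -
    have "(cmod (f x + g x))\<^sup>2 \<le> (cmod (f x) + cmod (g x))\<^sup>2"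
      by (intro power_mono norm_triangle_ineq) auto
    also have "\<dots> \<le> 2 * (cmod (f x))\<^sup>2 + 2 * (cmod (g x))\<^sup>2"
      using sum_squares_bound[of "cmod (f x)" "cmod (g x)"] by (simp add: power2_sum)
    finally show ?thesis .
  qed
  then have "(LINT x|lborel. (cmod (f x + g x))\<^sup>2) \<le> (LINT x|lborel. 2 * (cmod (f x))\<^sup>2 + 2 * (cmod (g x))\<^sup>2)"
    by (intro integral_mono Bochner_Integration.integrable_add integrable_mult_right schwartz_square_integrable schwartz_add assms)
  also have "\<dots> = 2 * Lpow 2 f + 2 * Lpow 2 g"
    unfolding Lpow_2 using schwartz_square_integrable[OF assms(1)] schwartz_square_integrable[OF assms(2)] by simp
  finally show ?thesis by (simp add: Lpow_2)
qed

text \<open>The Cauchy--Schwarz inequality on the ball, as an instance of Jensen's inequality.\<close>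

lemma integral_norm_compact_support:
  fixes f :: "'a::euclidean_space \<Rightarrow> complex"
  assumes f: "f \<in> schwartz" and R: "R > 0" and supp: "\<And>x. f x \<noteq> 0 \<Longrightarrow> norm x \<le> R"
  shows "(LINT x|lborel. cmod (f x))\<^sup>2 \<le> unit_ball_vol (real DIM('a)) * R ^ DIM('a) * Lpow 2 f"
proof -
  let ?K = "indicat_real (cball (0::'a) R)"
  define m where "m = unit_ball_vol (real DIM('a)) * R ^ DIM('a)"
  have m: "m > 0" using R by (simp add: m_def)
  have meas: "measure lborel (cball (0::'a) R) = m" using R by (simp add: m_def content_cball)
  have K1: "?K x * cmod (f x) = cmod (f x)" and K2: "?K x * cmod (f x) powr 2 = cmod (f x) powr 2" for x
    using supp[of x] by (auto simp: indicator_def)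
  have iK: "integrable lborel ?K" by (intro integrable_real_indicator emeasure_bounded_finite) auto
  have "(LINT x|lborel. ?K x * cmod (f x)) powr 2 \<le> m powr (2 - 1) * (LINT x|lborel. ?K x * cmod (f x) powr 2)"
    by (rule jensen_kernel)
       (use iK meas m schwartz_integrable[OF f] schwartz_powr_integrable[OF f, of 2] in \<open>auto simp only: K1 K2\<close>, auto)
  then show ?thesis using m unfolding K1 K2 by (simp add: Lpow_def m_def)
qed

text \<open>The bound by the total energy is Plancherel's theorem. For \<open>s R \<le> 1\<close> the transform of \<open>f\<close> is bounded by the \<open>L\<^sup>1\<close> norm
of \<open>f\<close>, hence by \<open>R\<^bsup>d/2\<^esup>\<close> times its \<open>L\<^sup>2\<close> norm, and the symbol has squared \<open>L\<^sup>2\<close> norm proportional to \<open>s\<^sup>d\<close>; this gives even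
\<open>(s R)\<^sup>d\<close>.\<close>

theorem local_energy:
  fixes a :: "'a::euclidean_space \<Rightarrow> complex"
  assumes a: "a \<in> schwartz"
  obtains C where "C > 0"
    "\<And>s R f. s > 0 \<Longrightarrow> R > 0 \<Longrightarrow> f \<in> schwartz \<Longrightarrow> (\<And>x. f x \<noteq> 0 \<Longrightarrow> norm x \<le> R) \<Longrightarrow>
      Lpow 2 (fmul (dil s a) f) \<le> C * min 1 (s * R) * Lpow 2 f"
proof -
  obtain M where M: "\<And>x. cmod (a x) \<le> M" "M > 0" using schwartz_bdd[OF a] by metis
  define c where "c = (2 * pi) powr (- real DIM('a) / 2)"
  define V where "V = unit_ball_vol (real DIM('a))"
  define C where "C = M\<^sup>2 + c\<^sup>2 * V * Lpow 2 a"
  have V: "V \<ge> 0" by (simp add: V_def)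
  have C: "C > 0" using M V by (simp add: C_def add_pos_nonneg)
  show ?thesis
  proof (rule that[OF C])
    fix s R :: real and f :: "'a \<Rightarrow> complex"
    assume s: "s > 0" and R: "R > 0" and f: "f \<in> schwartz" and supp: "\<And>x. f x \<noteq> 0 \<Longrightarrow> norm x \<le> R"
    have as: "(dil s a) \<in> schwartz" using s by (intro schwartz_dilate a) auto
    have prod: "(\<lambda>\<xi>. a (\<xi> /\<^sub>R s) * fourier f \<xi>) \<in> schwartz" by (intro schwartz_mult as fourier_schwartz f)
    have F0: "Lpow 2 f \<ge> 0" by simp
    have 1: "Lpow 2 (fmul (dil s a) f) \<le> M\<^sup>2 * Lpow 2 f"
    proof -
      have "Lpow 2 (\<lambda>\<xi>. a (\<xi> /\<^sub>R s) * fourier f \<xi>) \<le> M\<^sup>2 * Lpow 2 (fourier f)"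
        by (rule Lpow_2_mono[OF prod fourier_schwartz[OF f]]) (simp add: norm_mult M mult_right_mono)
      then show ?thesis by (simp add: Lpow_2_fmul[OF as f] Lpow_2_fourier[OF f])
    qed
    have 2: "Lpow 2 (fmul (dil s a) f) \<le> (c\<^sup>2 * V * Lpow 2 a) * (s * R) ^ DIM('a) * Lpow 2 f"
    proof -
      define I where "I = (LINT x|lborel. cmod (f x))"
      have "Lpow 2 (\<lambda>\<xi>. a (\<xi> /\<^sub>R s) * fourier f \<xi>) \<le> (c * I)\<^sup>2 * Lpow 2 (dil s a)"
      proof (rule Lpow_2_mono[OF prod as])
        fix \<xi>
        show "cmod (a (\<xi> /\<^sub>R s) * fourier f \<xi>) \<le> c * I * cmod (a (\<xi> /\<^sub>R s))"
          using mult_left_mono[OF norm_fourier_le[of f \<xi>], of "cmod (a (\<xi> /\<^sub>R s))"]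
          by (simp add: norm_mult c_def I_def mult_ac)
      qed
      also have "Lpow 2 (dil s a) = s ^ DIM('a) * Lpow 2 a"
        unfolding Lpow_2 using s schwartz_measurable[OF a] schwartz_measurable[OF as]
        by (subst lborel_integral_affine[of s _ 0]) auto
      also have "(c * I)\<^sup>2 * (s ^ DIM('a) * Lpow 2 a) = c\<^sup>2 * (s ^ DIM('a) * Lpow 2 a) * I\<^sup>2"
        by (simp add: power_mult_distrib)
      also have "\<dots> \<le> c\<^sup>2 * (s ^ DIM('a) * Lpow 2 a) * (V * R ^ DIM('a) * Lpow 2 f)"
        unfolding I_def V_def using s
        by (intro mult_left_mono integral_norm_compact_support f R supp) auto
      also have "\<dots> = (c\<^sup>2 * V * Lpow 2 a) * (s * R) ^ DIM('a) * Lpow 2 f"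
        by (simp add: power_mult_distrib)
      finally show ?thesis by (simp add: Lpow_2_fmul[OF as f])
    qed
    show "Lpow 2 (fmul (dil s a) f) \<le> C * min 1 (s * R) * Lpow 2 f"
    proof (cases "s * R \<le> 1")
      case True
      have "(s * R) ^ DIM('a) \<le> (s * R) ^ 1"
        using True s R DIM_positive[where 'a='a] by (intro power_decreasing) auto
      then have "(c\<^sup>2 * V * Lpow 2 a) * (s * R) ^ DIM('a) * Lpow 2 f \<le> (c\<^sup>2 * V * Lpow 2 a) * (s * R) * Lpow 2 f"
        using V by (intro mult_right_mono mult_left_mono) auto
      also have "\<dots> \<le> C * (s * R) * Lpow 2 f"
        using s R by (intro mult_right_mono) (auto simp: C_def)
      finally show ?thesis using 2 True by (simp add: min_def)
    next
      case False
      have "M\<^sup>2 * Lpow 2 f \<le> C * Lpow 2 f" using V by (intro mult_right_mono) (auto simp: C_def)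
      then show ?thesis using 1 False by (simp add: min_def)
    qed
  qed
qed

text \<open>The first moment of a multiplier: a derivative falling on the symbol costs \<open>1 / s\<close>, one falling
  on the transform costs \<open>R\<close>.\<close>

lemma local_moment:
  fixes a :: "'a::euclidean_space \<Rightarrow> complex"
  assumes a: "a \<in> schwartz"
  obtains C where "C > 0"
    "\<And>s R f. s > 0 \<Longrightarrow> R > 0 \<Longrightarrow> f \<in> schwartz \<Longrightarrow> (\<And>x. f x \<noteq> 0 \<Longrightarrow> norm x \<le> R) \<Longrightarrow>
      (\<Sum>b\<in>Basis. Lpow 2 (\<lambda>x. of_real (x \<bullet> b) * fmul (dil s a) f x))
      \<le> C * (min 1 (s * R) / s\<^sup>2 + R\<^sup>2) * Lpow 2 f"
proof -
  have "\<exists>C>0. \<forall>s R f. s > 0 \<longrightarrow> R > 0 \<longrightarrow> f \<in> schwartz \<longrightarrow> (\<forall>x. f x \<noteq> 0 \<longrightarrow> norm x \<le> R) \<longrightarrow>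
      Lpow 2 (fmul (dil s (partial b a)) f) \<le> C * min 1 (s * R) * Lpow 2 f" if b: "b \<in> Basis" for b
    using local_energy[OF schwartz_pd[OF a b]] by metis
  then obtain C1 where C1: "\<And>b. b \<in> Basis \<Longrightarrow> C1 b > 0"
    "\<And>b s R f. b \<in> Basis \<Longrightarrow> s > 0 \<Longrightarrow> R > 0 \<Longrightarrow> f \<in> schwartz \<Longrightarrow> (\<forall>x. f x \<noteq> 0 \<longrightarrow> norm x \<le> R) \<Longrightarrow>
      Lpow 2 (fmul (dil s (partial b a)) f) \<le> C1 b * min 1 (s * R) * Lpow 2 f" by metis
  obtain M where M: "\<And>x. cmod (a x) \<le> M" "M > 0" using schwartz_bdd[OF a] by metis
  define C where "C = (\<Sum>b\<in>(Basis::'a set). 2 * C1 b + 2 * M\<^sup>2)"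
  have C: "C > 0" unfolding C_def using M C1(1) by (intro sum_pos) (auto intro: add_pos_pos)
  show ?thesis
  proof (rule that[OF C])
    fix s R :: real and f :: "'a \<Rightarrow> complex"
    assume s: "s > 0" and R: "R > 0" and f: "f \<in> schwartz" and supp: "\<And>x. f x \<noteq> 0 \<Longrightarrow> norm x \<le> R"
    define X where "X = min 1 (s * R) / s\<^sup>2"
    have X: "X \<ge> 0" using s R by (simp add: X_def)
    have "Lpow 2 (\<lambda>x. of_real (x \<bullet> b) * fmul (dil s a) f x) \<le> (2 * C1 b + 2 * M\<^sup>2) * (X + R\<^sup>2) * Lpow 2 f"
      if b: "b \<in> Basis" for b
    proof -
      have as: "(dil s a) \<in> schwartz" using s by (intro schwartz_dilate a) auto
      have pas: "(dil s (partial b a)) \<in> schwartz"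
        using s schwartz_dilate[OF schwartz_pd[OF a b], of "inverse s"] by simp
      define g where "g = (\<lambda>x. complex_of_real (x \<bullet> b) * f x)"
      have g: "g \<in> schwartz" unfolding g_def by (rule schwartz_coord[OF f b])
      let ?q1 = "\<lambda>\<xi>. complex_of_real (1 / s) * (partial b a (\<xi> /\<^sub>R s) * fourier f \<xi>)"
      let ?q2 = "\<lambda>\<xi>. - \<i> * (a (\<xi> /\<^sub>R s) * fourier g \<xi>)"
      have dil: "((dil s a) has_derivative (\<lambda>k. frechet_derivative a (at (\<xi> /\<^sub>R s)) (k /\<^sub>R s))) (at \<xi>)" for \<xi>
        by (rule has_derivative_compose[OF _ schwartz_has_derivative[OF a]]) (auto intro!: derivative_eq_intros)
      have lin: "frechet_derivative a (at y) (b /\<^sub>R s) = of_real (1 / s) * partial b a y" for y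
        using linear_cmul[OF has_derivative_linear[OF schwartz_has_derivative[OF a]], of y "inverse s" b]
        by (simp add: scaleR_conv_of_real inverse_eq_divide)
      have deriv: "\<i> * partial b (\<lambda>\<xi>. a (\<xi> /\<^sub>R s) * fourier f \<xi>) \<xi> = \<i> * (?q1 \<xi> + ?q2 \<xi>)" for \<xi>
      proof -
        have "partial b (\<lambda>\<xi>. a (\<xi> /\<^sub>R s) * fourier f \<xi>) \<xi>
            = a (\<xi> /\<^sub>R s) * partial b (fourier f) \<xi> + frechet_derivative a (at (\<xi> /\<^sub>R s)) (b /\<^sub>R s) * fourier f \<xi>"
          by (rule pd_eq[OF has_derivative_mult[OF dil schwartz_has_derivative[OF fourier_schwartz[OF f]]]])
        also have "partial b (fourier f) \<xi> = - \<i> * fourier g \<xi>"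
          unfolding pd_fourier[OF f b] g_def by (rule fourier_scale)
        finally have "partial b (\<lambda>\<xi>. a (\<xi> /\<^sub>R s) * fourier f \<xi>) \<xi> = ?q1 \<xi> + ?q2 \<xi>"
          unfolding lin by (simp only: mult_ac add_ac)
        then show ?thesis by (rule arg_cong)
      qed
      have q1: "?q1 \<in> schwartz" by (intro schwartz_scale schwartz_mult pas fourier_schwartz f)
      have q2: "?q2 \<in> schwartz" by (intro schwartz_scale schwartz_mult as fourier_schwartz g)
      have iq: "(\<lambda>\<xi>. \<i> * (?q1 \<xi> + ?q2 \<xi>)) \<in> schwartz" by (intro schwartz_scale schwartz_add q1 q2)
      have "Lpow 2 (\<lambda>x. of_real (x \<bullet> b) * fmul (dil s a) f x) = Lpow 2 (inv_fourier (\<lambda>\<xi>. \<i> * (?q1 \<xi> + ?q2 \<xi>)))"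
        unfolding fmul_def coord_inv_fourier[OF schwartz_mult[OF as fourier_schwartz[OF f]] b] deriv by simp
      also have "\<dots> = Lpow 2 (\<lambda>\<xi>. ?q1 \<xi> + ?q2 \<xi>)"
        unfolding Lpow_2_inv_fourier[OF iq] by (simp add: Lpow_def norm_mult)
      also have "\<dots> \<le> 2 * Lpow 2 ?q1 + 2 * Lpow 2 ?q2" by (rule Lpow_2_add_le[OF q1 q2])
      also have "Lpow 2 ?q1 = (1 / s)\<^sup>2 * Lpow 2 (fmul (dil s (partial b a)) f)"
        unfolding Lpow_2_fmul[OF pas f] using s by (subst Lpow_scale) auto
      also have "\<dots> \<le> (1 / s)\<^sup>2 * (C1 b * min 1 (s * R) * Lpow 2 f)"
        by (intro mult_left_mono C1(2) b s R f) (use supp in auto)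
      also have "\<dots> = C1 b * X * Lpow 2 f" by (simp add: X_def power_divide)
      also have "Lpow 2 ?q2 \<le> M\<^sup>2 * Lpow 2 g"
      proof -
        have "Lpow 2 ?q2 \<le> M\<^sup>2 * Lpow 2 (fourier g)"
          by (rule Lpow_2_mono[OF q2 fourier_schwartz[OF g]]) (simp add: norm_mult M mult_right_mono)
        then show ?thesis by (simp add: Lpow_2_fourier[OF g])
      qed
      also have "M\<^sup>2 * Lpow 2 g \<le> M\<^sup>2 * (R\<^sup>2 * Lpow 2 f)"
      proof (intro mult_left_mono Lpow_2_mono g f)
        fix x
        show "cmod (g x) \<le> R * cmod (f x)"
        proof (cases "f x = 0")
          case False
          then have "\<bar>x \<bullet> b\<bar> \<le> R" using supp[of x] Basis_le_norm[OF b, of x] by linarith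
          then show ?thesis by (simp add: g_def norm_mult mult_right_mono)
        qed (simp add: g_def)
      qed auto
      finally have "Lpow 2 (\<lambda>x. of_real (x \<bullet> b) * fmul (dil s a) f x)
          \<le> (2 * C1 b * X + 2 * M\<^sup>2 * R\<^sup>2) * Lpow 2 f"
        by (simp add: algebra_simps)
      also have "\<dots> \<le> (2 * C1 b + 2 * M\<^sup>2) * (X + R\<^sup>2) * Lpow 2 f"
        using C1(1)[OF b] X by (intro mult_right_mono) (auto simp: algebra_simps)
      finally show ?thesis .
    qed
    then have "(\<Sum>b\<in>Basis. Lpow 2 (\<lambda>x. of_real (x \<bullet> b) * fmul (dil s a) f x))
       \<le> (\<Sum>b\<in>Basis. (2 * C1 b + 2 * M\<^sup>2) * (X + R\<^sup>2) * Lpow 2 f)" by (rule sum_mono)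
    also have "\<dots> = C * (X + R\<^sup>2) * Lpow 2 f" by (simp add: C_def sum_distrib_right)
    finally show "(\<Sum>b\<in>Basis. Lpow 2 (\<lambda>x. of_real (x \<bullet> b) * fmul (dil s a) f x))
      \<le> C * (min 1 (s * R) / s\<^sup>2 + R\<^sup>2) * Lpow 2 f" unfolding X_def .
  qed
qed

lemma Lp_norm_on_2_le:
  assumes h: "integrable lborel h" "\<And>x. h x \<ge> 0" and le: "\<And>x. x \<in> S \<Longrightarrow> (cmod (f x))\<^sup>2 \<le> h x"
  shows "Lp_norm_on 2 S f \<le> ennreal (sqrt (LINT x|lborel. h x))"
proof -
  have "(\<integral>\<^sup>+x. ennreal (cmod (f x) powr 2) * indicator S x \<partial>lborel) \<le> (\<integral>\<^sup>+x. ennreal (h x) \<partial>lborel)"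
    using le by (intro nn_integral_mono) (auto simp: indicator_def intro!: ennreal_leI)
  also have "\<dots> = ennreal (LINT x|lborel. h x)" using h by (intro nn_integral_eq_integral) auto
  finally have "Lp_norm_on 2 S f \<le> enn_powr (ennreal (LINT x|lborel. h x)) (1 / 2)"
    unfolding Lp_norm_on_def by (rule enn_powr_mono) simp
  also have "\<dots> = ennreal (sqrt (LINT x|lborel. h x))"
    using h(2) by (subst enn_powr_ennreal) (auto simp: powr_half_sqrt intro!: Bochner_Integration.integral_nonneg)
  finally show ?thesis .
qed

lemma sqrt_two_power: "sqrt (2 ^ n) = 2 powr (real n / 2)"
proof (rule real_sqrt_unique)
  have "(2 powr (real n / 2))\<^sup>2 = 2 powr (real n / 2 + real n / 2)"
    unfolding power2_eq_square powr_add ..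
  also have "\<dots> = 2 ^ n" by (simp add: powr_realpow)
  finally show "(2 powr (real n / 2))\<^sup>2 = 2 ^ n" .
qed simp

text \<open>On the \<open>i\<close>-th shell the norm of \<open>g\<close> is at most its \<open>L\<^sup>2\<close> norm, and at most \<open>2\<^bsup>1-i\<^esup>\<close> times the \<open>L\<^sup>2\<close> norm of \<open>\<bar>x\<bar> g\<close>. With
the first bound for \<open>i \<le> J\<close> and the second for \<open>i > J\<close>, the terms of the \<open>B\<close> norm decay geometrically on both
sides of \<open>J\<close>.\<close>

lemma B_norm_le:
  fixes g :: "'a::euclidean_space \<Rightarrow> complex"
  assumes g: "g \<in> schwartz"
    and A: "2 ^ J * Lpow 2 g \<le> E\<^sup>2"
    and W: "(\<Sum>b\<in>Basis. Lpow 2 (\<lambda>x. of_real (x \<bullet> b) * g x)) \<le> 2 ^ J * E\<^sup>2" and E: "E \<ge> 0"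
  shows "B_norm g \<le> ennreal (16 * E)"
proof -
  define W2 where "W2 = (\<Sum>b\<in>Basis. Lpow 2 (\<lambda>x. of_real (x \<bullet> b) * g x))"
  have gb: "(\<lambda>x. of_real (x \<bullet> b) * g x) \<in> schwartz" if "b \<in> Basis" for b by (rule schwartz_coord[OF g that])
  have W2: "integrable lborel (\<lambda>x. (norm x)\<^sup>2 * (cmod (g x))\<^sup>2)" "(LINT x|lborel. (norm x)\<^sup>2 * (cmod (g x))\<^sup>2) = W2"
  proof -
    have eq: "(norm x)\<^sup>2 * (cmod (g x))\<^sup>2 = (\<Sum>b\<in>Basis. (cmod (of_real (x \<bullet> b) * g x))\<^sup>2)" for x
    proof -
      have "(norm x)\<^sup>2 = (\<Sum>b\<in>Basis. (x \<bullet> b)\<^sup>2)"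
        by (subst power2_norm_eq_inner, subst euclidean_inner) (simp add: power2_eq_square)
      then show ?thesis by (simp add: norm_mult power_mult_distrib sum_distrib_right)
    qed
    show "integrable lborel (\<lambda>x. (norm x)\<^sup>2 * (cmod (g x))\<^sup>2)"
      unfolding eq by (intro Bochner_Integration.integrable_sum schwartz_square_integrable gb)
    show "(LINT x|lborel. (norm x)\<^sup>2 * (cmod (g x))\<^sup>2) = W2"
      unfolding eq W2_def Lpow_2 by (intro Bochner_Integration.integral_sum schwartz_square_integrable gb)
  qed
  have shell: "ennreal (2 powr (real i / 2)) * Lp_norm_on 2 (dyadic_shell i) g
      \<le> ennreal (2 * E * 2 powr (- \<bar>real_of_int (int i) - real J\<bar> / 2))" for i
  proof (cases "i \<le> J")
    case True
    have "Lp_norm_on 2 (dyadic_shell i) g \<le> ennreal (sqrt (LINT x|lborel. (cmod (g x))\<^sup>2))"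
      by (rule Lp_norm_on_2_le[OF schwartz_square_integrable[OF g]]) auto
    also have "\<dots> \<le> ennreal (E * 2 powr (- real J / 2))"
    proof (rule ennreal_leI)
      have "Lpow 2 g \<le> E\<^sup>2 / 2 ^ J" using A by (simp add: field_simps)
      then have "sqrt (Lpow 2 g) \<le> sqrt (E\<^sup>2 / 2 ^ J)" by (rule real_sqrt_le_mono)
      also have "\<dots> = E * 2 powr (- real J / 2)"
        using E by (simp add: real_sqrt_divide sqrt_two_power powr_minus_divide)
      finally show "sqrt (LINT x|lborel. (cmod (g x))\<^sup>2) \<le> E * 2 powr (- real J / 2)" by (simp add: Lpow_2)
    qed
    finally have "ennreal (2 powr (real i / 2)) * Lp_norm_on 2 (dyadic_shell i) g
       \<le> ennreal (2 powr (real i / 2)) * ennreal (E * 2 powr (- real J / 2))" by (rule mult_left_mono) simp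
    also have "\<dots> = ennreal (E * (2 powr (real i / 2) * 2 powr (- real J / 2)))"
      using E by (subst ennreal_mult[symmetric]) (simp_all add: mult_ac)
    also have "2 powr (real i / 2) * 2 powr (- real J / 2) = 2 powr (- \<bar>real_of_int (int i) - real J\<bar> / 2)"
      unfolding powr_add[symmetric] using True by (intro arg_cong[where f="\<lambda>x. 2 powr x"]) (simp add: field_simps)
    also have "ennreal (E * 2 powr (- \<bar>real_of_int (int i) - real J\<bar> / 2)) \<le> ennreal (2 * E * 2 powr (- \<bar>real_of_int (int i) - real J\<bar> / 2))"
      using E by (intro ennreal_leI mult_right_mono) auto
    finally show ?thesis .
  next
    case False
    then have i: "i > 0" "i > J" by auto
    have "Lp_norm_on 2 (dyadic_shell i) g \<le> ennreal (sqrt (LINT x|lborel. (1 / 2 ^ (i - 1))\<^sup>2 * ((norm x)\<^sup>2 * (cmod (g x))\<^sup>2)))"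
    proof (rule Lp_norm_on_2_le)
      show "integrable lborel (\<lambda>x. (1 / 2 ^ (i - 1))\<^sup>2 * ((norm x)\<^sup>2 * (cmod (g x))\<^sup>2))"
        by (intro integrable_mult_right W2)
      fix x :: 'a assume "x \<in> dyadic_shell i"
      then have "2 ^ (i - 1) < norm x" using i by (simp add: dyadic_shell_def)
      then have "1 \<le> (1 / 2 ^ (i - 1)) * norm x" by (simp add: field_simps)
      then have "1 ^ 2 \<le> ((1 / 2 ^ (i - 1)) * norm x)\<^sup>2" by (intro power_mono) auto
      then have "1 \<le> ((1 / 2 ^ (i - 1)) * norm x)\<^sup>2" by simp
      then have "1 * (cmod (g x))\<^sup>2 \<le> ((1 / 2 ^ (i - 1)) * norm x)\<^sup>2 * (cmod (g x))\<^sup>2"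
        by (intro mult_right_mono) auto
      then show "(cmod (g x))\<^sup>2 \<le> (1 / 2 ^ (i - 1))\<^sup>2 * ((norm x)\<^sup>2 * (cmod (g x))\<^sup>2)"
        by (simp only: power_mult_distrib mult.assoc mult_1)
    qed auto
    also have "\<dots> \<le> ennreal (2 * E * 2 powr (real J / 2 - real i))"
    proof (rule ennreal_leI)
      have p2: "1 / 2 ^ (i - 1) = 2 * 2 powr (- real i)"
      proof -
        have "2 powr (- real i) = 1 / 2 ^ i" by (simp add: powr_minus_divide powr_realpow)
        moreover have "(2::real) ^ i = 2 * 2 ^ (i - 1)" using i by (cases i) auto
        ultimately show ?thesis by simp
      qed
      have "sqrt (LINT x|lborel. (1 / 2 ^ (i - 1))\<^sup>2 * ((norm x)\<^sup>2 * (cmod (g x))\<^sup>2)) = sqrt ((1 / 2 ^ (i - 1))\<^sup>2 * W2)"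
        using W2 by simp
      also have "\<dots> \<le> sqrt ((1 / 2 ^ (i - 1))\<^sup>2 * (2 ^ J * E\<^sup>2))"
        using W unfolding W2_def by (intro real_sqrt_le_mono mult_left_mono) auto
      also have "\<dots> = (1 / 2 ^ (i - 1)) * (sqrt (2 ^ J) * E)"
        using E by (simp add: real_sqrt_mult real_sqrt_divide)
      also note sqrt_two_power
      also have "(1 / 2 ^ (i - 1)) * (2 powr (real J / 2) * E) = 2 * E * (2 powr (real J / 2) * 2 powr (- real i))"
        unfolding p2 by simp
      also have "2 powr (real J / 2) * 2 powr (- real i) = 2 powr (real J / 2 - real i)"
        unfolding powr_add[symmetric] by simp
      finally show "sqrt (LINT x|lborel. (1 / 2 ^ (i - 1))\<^sup>2 * ((norm x)\<^sup>2 * (cmod (g x))\<^sup>2)) \<le> 2 * E * 2 powr (real J / 2 - real i)" .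
    qed
    finally have "ennreal (2 powr (real i / 2)) * Lp_norm_on 2 (dyadic_shell i) g
       \<le> ennreal (2 powr (real i / 2)) * ennreal (2 * E * 2 powr (real J / 2 - real i))" by (rule mult_left_mono) simp
    also have "\<dots> = ennreal (2 * E * (2 powr (real i / 2) * 2 powr (real J / 2 - real i)))"
      using E by (subst ennreal_mult[symmetric]) (simp_all add: mult_ac)
    also have "2 powr (real i / 2) * 2 powr (real J / 2 - real i) = 2 powr (- \<bar>real_of_int (int i) - real J\<bar> / 2)"
      unfolding powr_add[symmetric] using i by (intro arg_cong[where f="\<lambda>x. 2 powr x"]) (simp add: field_simps)
    finally show ?thesis .
  qed
  have "(\<Sum>i<n. ennreal (2 powr (real i / 2)) * Lp_norm_on 2 (dyadic_shell i) g) \<le> ennreal (16 * E)" for n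
  proof -
    have "(\<Sum>i<n. ennreal (2 powr (real i / 2)) * Lp_norm_on 2 (dyadic_shell i) g)
       \<le> (\<Sum>i<n. ennreal (2 * E * 2 powr (- \<bar>real_of_int (int i) - real J\<bar> / 2)))"
      by (intro sum_mono shell)
    also have "\<dots> = ennreal (\<Sum>i<n. 2 * E * 2 powr (- \<bar>real_of_int (int i) - real J\<bar> / 2))"
      using E by (intro sum_ennreal) auto
    also have "(\<Sum>i<n. 2 * E * 2 powr (- \<bar>real_of_int (int i) - real J\<bar> / 2))
       = 2 * E * (\<Sum>k\<in>int ` {..<n}. 2 powr (- \<bar>real_of_int k - real J\<bar> / 2))"
      by (subst sum.reindex) (auto simp: sum_distrib_left)
    also have "\<dots> \<le> 2 * E * 8"
      using E by (intro mult_left_mono sum_geometric_int_le) auto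
    finally show ?thesis by (simp add: ennreal_leI)
  qed
  then show ?thesis
    unfolding B_norm_def suminf_eq_SUP by (intro SUP_least) auto
qed

text \<open>The ball has radius \<open>2\<^sup>j\<close> and the multiplier acts on the scale \<open>2\<^sup>-\<^sup>k\<close>; the piece is essentially spread over the larger
of the two, which is the length at which energy and first moment are compared.\<close>

theorem B_norm_fmul:
  fixes a :: "'a::euclidean_space \<Rightarrow> complex"
  assumes a: "a \<in> schwartz"
  obtains C where "C > 0"
    "\<And>k j f. f \<in> schwartz \<Longrightarrow> (\<And>x. f x \<noteq> 0 \<Longrightarrow> norm x \<le> 2 ^ j) \<Longrightarrow>
      (B_norm (fmul (dil (2 powi k) a) f))\<^sup>2 \<le> ennreal (C * 2 ^ j * Lpow 2 f)"
proof -
  obtain C1 where C1: "C1 > 0"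
    "\<And>s R f. s > 0 \<Longrightarrow> R > 0 \<Longrightarrow> f \<in> schwartz \<Longrightarrow> (\<And>x. f x \<noteq> 0 \<Longrightarrow> norm x \<le> R) \<Longrightarrow>
      Lpow 2 (fmul (dil s a) f) \<le> C1 * min 1 (s * R) * Lpow 2 f"
    by (rule local_energy[OF a]) blast
  obtain C2 where C2: "C2 > 0"
    "\<And>s R f. s > 0 \<Longrightarrow> R > 0 \<Longrightarrow> f \<in> schwartz \<Longrightarrow> (\<And>x. f x \<noteq> 0 \<Longrightarrow> norm x \<le> R) \<Longrightarrow>
      (\<Sum>b\<in>Basis. Lpow 2 (\<lambda>x. of_real (x \<bullet> b) * fmul (dil s a) f x))
      \<le> C2 * (min 1 (s * R) / s\<^sup>2 + R\<^sup>2) * Lpow 2 f"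
    by (rule local_moment[OF a]) blast
  define C where "C = C1 + 2 * C2"
  have C: "C > 0" "C1 \<le> C" "2 * C2 \<le> C" using C1(1) C2(1) by (auto simp: C_def)
  show ?thesis
  proof (rule that[of "256 * C"])
    show "256 * C > 0" using C by simp
    fix k :: int and j :: nat and f :: "'a \<Rightarrow> complex"
    assume f: "f \<in> schwartz" and supp: "\<And>x. f x \<noteq> 0 \<Longrightarrow> norm x \<le> 2 ^ j"
    define s where "s = (2::real) powi k"
    define R where "R = (2::real) ^ j"
    have s: "s > 0" and R: "R > 0" by (auto simp: s_def R_def)
    define g where "g = fmul (dil s a) f"
    have g: "g \<in> schwartz" unfolding g_def using s by (intro fmul_schwartz schwartz_dilate a f) auto
    define F where "F = Lpow 2 f"
    have F: "F \<ge> 0" by (simp add: F_def)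
    \<comment> \<open>The larger of the radius \<open>2\<^sup>j\<close> and the scale \<open>2\<^sup>-\<^sup>k\<close> is \<open>2\<^sup>J\<close>.\<close>
    define J where "J = nat (max (int j) (- k))"
    define E where "E = sqrt (C * R * F)"
    have E2: "E\<^sup>2 = C * R * F" and E0: "E \<ge> 0" using C R F by (auto simp: E_def)
    have g1: "Lpow 2 g \<le> C1 * min 1 (s * R) * F" unfolding g_def F_def
      by (rule C1(2)[OF s R f]) (use supp in \<open>auto simp: R_def\<close>)
    have g2: "(\<Sum>b\<in>Basis. Lpow 2 (\<lambda>x. of_real (x \<bullet> b) * g x)) \<le> C2 * (min 1 (s * R) / s\<^sup>2 + R\<^sup>2) * F"
      unfolding g_def F_def by (rule C2(2)[OF s R f]) (use supp in \<open>auto simp: R_def\<close>)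
    have TJ: "(2::real) ^ J = 2 powi (max (int j) (- k))" by (simp add: J_def power_int_def)
    have sR: "s * R = 2 powi (k + int j)" by (simp add: s_def R_def power_int_add)
    have core: "2 ^ J * min 1 (s * R) \<le> R \<and> min 1 (s * R) / s\<^sup>2 + R\<^sup>2 \<le> 2 * (2 ^ J * R)"
    proof (cases "- k \<le> int j")
      case True
      then have T: "(2::real) ^ J = R" unfolding TJ R_def by (simp add: max_def)
      have 1: "1 \<le> s * R" unfolding sR using True by (simp add: one_le_power_int)
      then have "1 ^ 2 \<le> (s * R)\<^sup>2" by (intro power_mono) auto
      then have "1 / s\<^sup>2 \<le> R\<^sup>2" using s by (simp add: field_simps power_mult_distrib)
      then show ?thesis unfolding T using 1 R by (simp add: min_def power2_eq_square)
    next
      case False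
      then have T: "(2::real) ^ J = 1 / s" unfolding TJ s_def by (simp add: max_def power_int_minus_divide)
      have 1: "s * R \<le> 1" unfolding sR using False power_int_increasing[of "k + int j" 0 "2::real"] by simp
      have "R * R \<le> R * (1 / s)" using 1 s R by (intro mult_left_mono) (auto simp: field_simps)
      then have "s * R / s\<^sup>2 + R\<^sup>2 \<le> 2 * (1 / s * R)" using s by (simp add: power2_eq_square)
      then show ?thesis unfolding T using 1 s by (simp add: min_def)
    qed
    have "B_norm g \<le> ennreal (16 * E)"
    proof (rule B_norm_le[OF g _ _ E0, of J])
      have "2 ^ J * Lpow 2 g \<le> 2 ^ J * (C1 * min 1 (s * R) * F)" using g1 by (intro mult_left_mono) auto
      also have "\<dots> = C1 * (2 ^ J * min 1 (s * R)) * F" by simp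
      also have "\<dots> \<le> C * R * F" using core C C1(1) F s R by (intro mult_right_mono mult_mono) auto
      finally show "2 ^ J * Lpow 2 g \<le> E\<^sup>2" unfolding E2 .
      note g2
      also have "C2 * (min 1 (s * R) / s\<^sup>2 + R\<^sup>2) * F \<le> C2 * (2 * (2 ^ J * R)) * F"
        using core C2(1) F by (intro mult_right_mono mult_left_mono) auto
      also have "\<dots> = (2 * C2) * (2 ^ J * R * F)" by simp
      also have "\<dots> \<le> C * (2 ^ J * R * F)" using C R F by (intro mult_right_mono) auto
      also have "\<dots> = 2 ^ J * E\<^sup>2" unfolding E2 by simp
      finally show "(\<Sum>b\<in>Basis. Lpow 2 (\<lambda>x. of_real (x \<bullet> b) * g x)) \<le> 2 ^ J * E\<^sup>2" .
    qed
    then have "(B_norm g)\<^sup>2 \<le> (ennreal (16 * E))\<^sup>2" by (intro power_mono) auto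
    also have "\<dots> = ennreal ((16 * E)\<^sup>2)" using E0 by (intro ennreal_power) auto
    also have "(16 * E)\<^sup>2 = 256 * C * 2 ^ j * Lpow 2 f" by (simp add: power_mult_distrib E2 R_def F_def)
    finally show "(B_norm (fmul (dil (2 powi k) a) f))\<^sup>2 \<le> ennreal (256 * C * 2 ^ j * Lpow 2 f)"
      unfolding g_def s_def .
  qed
qed

section \<open>Bounds for the norms of \<open>Y\<close> and \<open>Z\<close>\<close>

text \<open>The weight is at most \<open>\<mu>\<^bsup>-1/2\<^esup>\<close> where the symbol does not vanish; the rest is Plancherel's theorem.\<close>

lemma weighted_norm_fourier_mult_le:
  assumes a: "a \<in> schwartz" and f: "f \<in> schwartz" and \<mu>: "\<mu> > 0"
    and m: "\<And>\<xi>. a \<xi> \<noteq> 0 \<Longrightarrow> \<mu> \<le> m_sym l \<xi>"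
  shows "(weighted_norm l (fourier_mult a (distr_of f)))\<^sup>2 \<le> ennreal (Lpow 2 (fmul a f) / \<mu>)"
proof -
  let ?w = "\<lambda>\<xi>. a \<xi> * fourier f \<xi>"
  have w: "?w \<in> schwartz" by (intro schwartz_mult fourier_schwartz a f)
  have "weighted_norm l (fourier_mult a (distr_of f)) \<le> Lp_norm 2 (\<lambda>\<xi>. of_real (m_sym l \<xi> powr (- 1 / 2)) * ?w \<xi>)"
    unfolding weighted_norm_def by (rule distr_norm_le[OF represents_fourier_fmul[OF a f]])
  also have "\<dots> \<le> ennreal (sqrt (LINT \<xi>|lborel. (1 / \<mu>) * (cmod (?w \<xi>))\<^sup>2))"
  proof (rule Lp_norm_on_2_le)
    show "integrable lborel (\<lambda>\<xi>. (1 / \<mu>) * (cmod (?w \<xi>))\<^sup>2)"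
      by (intro integrable_mult_right schwartz_square_integrable w)
    show "0 \<le> (1 / \<mu>) * (cmod (?w \<xi>))\<^sup>2" for \<xi> using \<mu> by simp
    fix \<xi>
    show "(cmod (of_real (m_sym l \<xi> powr (- 1 / 2)) * ?w \<xi>))\<^sup>2 \<le> (1 / \<mu>) * (cmod (?w \<xi>))\<^sup>2"
    proof (cases "a \<xi> = 0")
      case False
      then have m1: "\<mu> \<le> m_sym l \<xi>" by (rule m)
      have "(m_sym l \<xi> powr (- 1 / 2))\<^sup>2 = m_sym l \<xi> powr (- 1 / 2 + - 1 / 2)"
        unfolding power2_eq_square powr_add ..
      also have "\<dots> = 1 / m_sym l \<xi>" using m1 \<mu> by (simp add: powr_minus_divide)
      also have "\<dots> \<le> 1 / \<mu>" using m1 \<mu> by (intro divide_left_mono) auto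
      finally have "(m_sym l \<xi> powr (- 1 / 2))\<^sup>2 * (cmod (?w \<xi>))\<^sup>2 \<le> (1 / \<mu>) * (cmod (?w \<xi>))\<^sup>2"
        by (intro mult_right_mono) auto
      then show ?thesis by (simp only: norm_mult norm_of_real power_mult_distrib power2_abs)
    qed simp
  qed
  also have "(LINT \<xi>|lborel. (1 / \<mu>) * (cmod (?w \<xi>))\<^sup>2) = Lpow 2 (fmul a f) / \<mu>"
    unfolding Lpow_2_fmul[OF a f] Lpow_2[of ?w] by simp
  finally have "(weighted_norm l (fourier_mult a (distr_of f)))\<^sup>2 \<le> (ennreal (sqrt (Lpow 2 (fmul a f) / \<mu>)))\<^sup>2"
    by (intro power_mono) auto
  also have "\<dots> = ennreal (Lpow 2 (fmul a f) / \<mu>)" using \<mu> by (simp add: ennreal_power)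
  finally show ?thesis .
qed

lemma sum_geometric_above_le:
  fixes A :: "int set" and \<theta> :: real
  assumes A: "finite A" "\<And>k. k \<in> A \<Longrightarrow> K < k" and \<theta>: "\<theta> > 0"
  shows "(\<Sum>k\<in>A. 2 powr (- \<theta> * real_of_int k)) \<le> 2 powr (- \<theta> * real_of_int K) / (1 - 2 powr (- \<theta>))"
proof -
  define q :: real where "q = 2 powr (- \<theta>)"
  have q: "q > 0" "q < 1" unfolding q_def using \<theta> powr_less_mono[of "- \<theta>" 0 "2::real"] by auto
  have inj: "inj_on (\<lambda>k. nat (k - K)) A"
  proof (rule inj_onI)
    fix k m assume "k \<in> A" "m \<in> A" "nat (k - K) = nat (m - K)"
    then show "k = m" using A(2)[of k] A(2)[of m] by (simp add: eq_nat_nat_iff)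
  qed
  have "2 powr (- \<theta> * real_of_int k) = 2 powr (- \<theta> * real_of_int K) * q ^ nat (k - K)" if "k \<in> A" for k
  proof -
    have "real (nat (k - K)) = real_of_int k - real_of_int K" using A(2)[OF that] by simp
    then have "q ^ nat (k - K) = 2 powr (- \<theta> * (real_of_int k - real_of_int K))"
      using q(1) unfolding q_def by (simp add: powr_powr flip: powr_realpow)
    then show ?thesis by (simp add: algebra_simps flip: powr_add)
  qed
  then have "(\<Sum>k\<in>A. 2 powr (- \<theta> * real_of_int k)) = 2 powr (- \<theta> * real_of_int K) * (\<Sum>k\<in>A. q ^ nat (k - K))"
    by (simp add: sum_distrib_left)
  also have "(\<Sum>k\<in>A. q ^ nat (k - K)) = (\<Sum>n\<in>(\<lambda>k. nat (k - K)) ` A. q ^ n)"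
    using inj by (simp add: sum.reindex)
  also have "\<dots> \<le> (\<Sum>n. q ^ n)"
    by (rule sum_le_suminf[OF summable_geometric]) (use q A in auto)
  also have "\<dots> = 1 / (1 - q)" using q by (intro suminf_geometric) auto
  finally show ?thesis by (simp add: q_def mult_left_mono)
qed

lemma enn_powr_sum3_le:
  assumes "T1 \<le> ennreal (c1 * Q)" "T2 \<le> ennreal (c2 * Q)" "T3 \<le> ennreal (c3 * Q)"
    and "c1 \<ge> 0" "c2 \<ge> 0" "c3 \<ge> 0" "Q \<ge> 0"
  shows "enn_powr (T1 + T2 + T3) (1 / 2) \<le> ennreal (sqrt (c1 + c2 + c3) * sqrt Q)"
proof -
  have "T1 + T2 + T3 \<le> ennreal (c1 * Q) + ennreal (c2 * Q) + ennreal (c3 * Q)"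
    by (intro add_mono assms)
  also have "\<dots> = ennreal (c1 * Q + c2 * Q + c3 * Q)" using assms by simp
  also have "c1 * Q + c2 * Q + c3 * Q = (c1 + c2 + c3) * Q" by (simp add: algebra_simps)
  finally have "enn_powr (T1 + T2 + T3) (1 / 2) \<le> enn_powr (ennreal ((c1 + c2 + c3) * Q)) (1 / 2)"
    by (rule enn_powr_mono) simp
  also have "\<dots> = ennreal (sqrt (c1 + c2 + c3) * sqrt Q)"
    using assms by (simp add: enn_powr_ennreal powr_half_sqrt real_sqrt_mult)
  finally show ?thesis .
qed

lemma powi_k_of:
  assumes "l > 0"
  shows "2 powi (k_of l - 3) \<le> sqrt l" "4 * (2 powi (k_of l - 3)) < sqrt l"
    and "k \<in> k_range l \<Longrightarrow> 2 powi k \<le> 4 * sqrt l"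
    and "k > k_of l + 1 \<Longrightarrow> 4 * sqrt l \<le> 2 powi k"
    and "sqrt l \<le> 2 powr real_of_int (k_of l + 1)"
proof -
  note b = k_of_bounds[OF assms]
  have "(2::real) powi (k_of l - 1) = 2 powi ((k_of l - 3) + 2)" by simp
  also have "\<dots> = 4 * 2 powi (k_of l - 3)" by (subst power_int_add) auto
  finally have e: "(2::real) powi (k_of l - 1) = 4 * 2 powi (k_of l - 3)" .
  then show "4 * (2 powi (k_of l - 3)) < sqrt l" using b by simp
  moreover have "(2::real) powi (k_of l - 3) > 0" by simp
  ultimately show "2 powi (k_of l - 3) \<le> sqrt l" by linarith
  have "(2::real) powi (k_of l + 1) = 2 powi ((k_of l - 1) + 2)" by (rule arg_cong) simp
  also have "\<dots> = 4 * 2 powi (k_of l - 1)" by (subst power_int_add) auto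
  finally have e2: "(2::real) powi (k_of l + 1) \<le> 4 * sqrt l" using b by simp
  show "2 powi k \<le> 4 * sqrt l" if "k \<in> k_range l"
  proof -
    have "k \<le> k_of l + 1" using that by (auto simp: k_range_def)
    then have "(2::real) powi k \<le> 2 powi (k_of l + 1)" by (intro power_int_increasing) auto
    then show ?thesis using e2 by linarith
  qed
  show "4 * sqrt l \<le> 2 powi k" if "k > k_of l + 1"
  proof -
    have "4 * sqrt l \<le> 4 * 2 powi (k_of l)" using b by simp
    also have "\<dots> = 2 powi (k_of l + 2)" by (subst power_int_add) auto
    also have "\<dots> \<le> 2 powi k" using that by (intro power_int_increasing) auto
    finally show ?thesis .
  qed
  have "sqrt l \<le> 2 powr real_of_int (k_of l)" using b by (simp add: powr_real_of_int')
  also have "\<dots> \<le> 2 powr real_of_int (k_of l + 1)" by (intro powr_mono) auto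
  finally show "sqrt l \<le> 2 powr real_of_int (k_of l + 1)" .
qed

text \<open>The high frequencies \<open>2\<^sup>k\<close> are at least of size \<open>l\<^bsup>1/2\<^esup>\<close>, so a geometric series over them is controlled by a power
of \<open>l\<close>.\<close>

lemma sum_geometric_high_le:
  fixes A :: "int set" and \<theta> :: real
  assumes l: "l > 0" and A: "finite A" "A \<subseteq> {k. k > k_of l + 1}" and \<theta>: "\<theta> > 0"
  shows "(\<Sum>k\<in>A. 2 powr (- \<theta> * real_of_int k)) \<le> l powr (- \<theta> / 2) / (1 - 2 powr (- \<theta>))"
proof -
  have q: "(2::real) powr (- \<theta>) < 1" using \<theta> powr_less_mono[of "- \<theta>" 0 "2::real"] by simp
  have "(\<Sum>k\<in>A. 2 powr (- \<theta> * real_of_int k)) \<le> 2 powr (- \<theta> * real_of_int (k_of l + 1)) / (1 - 2 powr (- \<theta>))"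
    by (rule sum_geometric_above_le) (use A \<theta> in auto)
  also have "2 powr (- \<theta> * real_of_int (k_of l + 1)) = (2 powr real_of_int (k_of l + 1)) powr (- \<theta>)"
    by (simp only: powr_powr mult.commute)
  also have "\<dots> \<le> sqrt l powr (- \<theta>)"
    using l \<theta> by (intro powr_mono2' powi_k_of(5)) auto
  also have "sqrt l powr (- \<theta>) = l powr (- \<theta> / 2)"
    using l by (simp add: powr_half_sqrt[symmetric] powr_powr)
  finally show ?thesis using q by (simp add: divide_right_mono)
qed

context
  fixes \<phi> :: "'a::euclidean_space \<Rightarrow> complex"
  assumes phi: "\<phi> \<in> schwartz"
    and phi_closure: "closure {\<xi>. \<phi> \<xi> \<noteq> 0} \<subseteq> {\<xi>. norm \<xi> \<le> 2}"
    and phi_1: "\<forall>\<xi>. norm \<xi> \<le> 1 \<longrightarrow> \<phi> \<xi> = 1"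
begin

lemma LP_psi_schwartz: "LP_psi \<phi> \<in> schwartz"
proof -
  have "(\<lambda>\<xi>. \<phi> \<xi> + (- 1) * \<phi> (2 *\<^sub>R \<xi>)) \<in> schwartz"
    by (intro schwartz_add schwartz_scale schwartz_dilate phi) auto
  then show ?thesis by (simp add: LP_psi_def[abs_def])
qed

lemma low_symbol:
  assumes l: "l > 0" and nz: "\<phi> (\<xi> /\<^sub>R 2 powi (k_of l - 3)) \<noteq> 0"
  shows "3 / 4 * l \<le> m_sym l \<xi>"
proof -
  have "\<xi> /\<^sub>R 2 powi (k_of l - 3) \<in> {\<xi>. norm \<xi> \<le> 2}"
    by (rule subsetD[OF order_trans[OF closure_subset phi_closure]]) (use nz in simp)
  then have "norm (\<xi> /\<^sub>R 2 powi (k_of l - 3)) \<le> 2" by (rule CollectD)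
  then have "norm \<xi> \<le> 2 * 2 powi (k_of l - 3)" by (simp add: field_simps)
  also have "\<dots> \<le> sqrt l / 2" using powi_k_of(2)[OF l] by simp
  finally have "(norm \<xi>)\<^sup>2 \<le> (sqrt l / 2)\<^sup>2" by (intro power_mono) auto
  then have "(norm \<xi>)\<^sup>2 \<le> l / 4" using l by (simp add: power_divide)
  then show ?thesis unfolding m_sym_def by linarith
qed

lemma high_symbol:
  assumes l: "l > 0" and k: "k > k_of l + 1" and nz: "LP_psi \<phi> (\<xi> /\<^sub>R 2 powi k) \<noteq> 0"
  shows "3 / 16 * (2 powi k)\<^sup>2 \<le> m_sym l \<xi>"
proof -
  define s where "s = (2::real) powi k"
  have s: "s > 0" by (simp add: s_def)
  have "\<not> norm (2 *\<^sub>R (\<xi> /\<^sub>R s)) \<le> 1"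
  proof
    assume 1: "norm (2 *\<^sub>R (\<xi> /\<^sub>R s)) \<le> 1"
    then have "norm (\<xi> /\<^sub>R s) \<le> 1" using norm_ge_zero[of "\<xi> /\<^sub>R s"] unfolding norm_scaleR[of 2] by simp
    then show False using 1 nz phi_1 by (simp add: LP_psi_def s_def)
  qed
  then have "s / 2 < norm \<xi>" using s by (simp add: field_simps)
  then have "(s / 2)\<^sup>2 \<le> (norm \<xi>)\<^sup>2" using s by (intro power_mono) auto
  then have 1: "s\<^sup>2 / 4 \<le> (norm \<xi>)\<^sup>2" by (simp add: power_divide)
  have "(4 * sqrt l)\<^sup>2 \<le> s\<^sup>2" unfolding s_def using l by (intro power_mono powi_k_of k) auto
  then have "16 * l \<le> s\<^sup>2" using l by (simp add: power_mult_distrib)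
  then show ?thesis unfolding m_sym_def s_def[symmetric] using 1 by linarith
qed

lemma weighted_norm_low:
  assumes l: "l > 0" and f: "f \<in> schwartz"
  shows "(weighted_norm l (LP_proj_below \<phi> l (distr_of f)))\<^sup>2
    \<le> ennreal (4 / 3 / l * Lpow 2 (fmul (dil (2 powi (k_of l - 3)) \<phi>) f))"
proof -
  have "(dil (2 powi (k_of l - 3)) \<phi>) \<in> schwartz" by (intro schwartz_dilate phi) auto
  then have "(weighted_norm l (LP_proj_below \<phi> l (distr_of f)))\<^sup>2
    \<le> ennreal (Lpow 2 (fmul (dil (2 powi (k_of l - 3)) \<phi>) f) / (3 / 4 * l))"
    unfolding LP_proj_below_def LP_proj_le_def
    using l by (intro weighted_norm_fourier_mult_le f low_symbol) auto
  then show ?thesis by (simp add: mult.commute)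
qed

lemma LP_psi_dilate_schwartz: "(dil (2 powi k) (LP_psi \<phi>)) \<in> schwartz"
  by (intro schwartz_dilate LP_psi_schwartz) auto

lemma weighted_norm_high:
  assumes l: "l > 0" and f: "f \<in> schwartz" and k: "k > k_of l + 1"
  shows "(weighted_norm l (LP_proj \<phi> k (distr_of f)))\<^sup>2
    \<le> ennreal (16 / 3 * 2 powr (- 2 * real_of_int k) * Lpow 2 (LP_piece \<phi> k f))"
proof -
  have "(weighted_norm l (LP_proj \<phi> k (distr_of f)))\<^sup>2
    \<le> ennreal (Lpow 2 (LP_piece \<phi> k f) / (3 / 16 * (2 powi k)\<^sup>2))"
    unfolding LP_proj_def
    by (intro weighted_norm_fourier_mult_le f high_symbol l k LP_psi_dilate_schwartz) simp_all
  also have "Lpow 2 (LP_piece \<phi> k f) / (3 / 16 * (2 powi k)\<^sup>2)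
     = 16 / 3 * (1 / (2 powi k)\<^sup>2) * Lpow 2 (LP_piece \<phi> k f)"
    by simp
  also have "1 / (2 powi k)\<^sup>2 = 2 powr (- 2 * real_of_int k)"
  proof -
    have "((2::real) powi k)\<^sup>2 = 2 powr (real_of_int k + real_of_int k)"
      unfolding power2_eq_square powr_add by (simp add: powr_real_of_int')
    then show ?thesis by (simp add: powr_minus_divide)
  qed
  finally show ?thesis .
qed

lemma weighted_norm_high_sum:
  assumes l: "l > 0" and f: "f \<in> schwartz"
    and B: "\<And>A. finite A \<Longrightarrow> A \<subseteq> {k. k > k_of l + 1} \<Longrightarrow>
      (\<Sum>k\<in>A. 2 powr (- 2 * real_of_int k) * Lpow 2 (LP_piece \<phi> k f)) \<le> B"
  shows "(\<Sum>\<^sub>\<infinity>k\<in>{k. k > k_of l + 1}. (weighted_norm l (LP_proj \<phi> k (distr_of f)))\<^sup>2) \<le> ennreal (16 / 3 * B)"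
proof (rule infsum_le_finite_sums)
  show "(\<lambda>k. (weighted_norm l (LP_proj \<phi> k (distr_of f)))\<^sup>2) summable_on {k. k > k_of l + 1}"
    by (rule nonneg_summable_on_complete) simp
  fix A assume A: "finite A" "A \<subseteq> {k. k > k_of l + 1}"
  let ?T = "\<lambda>k. 2 powr (- 2 * real_of_int k) * Lpow 2 (LP_piece \<phi> k f)"
  have "(\<Sum>k\<in>A. (weighted_norm l (LP_proj \<phi> k (distr_of f)))\<^sup>2) \<le> (\<Sum>k\<in>A. ennreal (16 / 3 * ?T k))"
    using A weighted_norm_high[OF l f] by (intro sum_mono) (auto simp: mult.assoc)
  also have "\<dots> = ennreal (\<Sum>k\<in>A. 16 / 3 * ?T k)" by (rule sum_ennreal) auto
  also have "(\<Sum>k\<in>A. 16 / 3 * ?T k) = 16 / 3 * (\<Sum>k\<in>A. ?T k)" by (simp add: sum_distrib_left)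
  also have "ennreal \<dots> \<le> ennreal (16 / 3 * B)" by (intro ennreal_leI mult_left_mono B A) auto
  finally show "(\<Sum>k\<in>A. (weighted_norm l (LP_proj \<phi> k (distr_of f)))\<^sup>2) \<le> ennreal (16 / 3 * B)" .
qed

lemma sum_k_range_le:
  fixes g :: "int \<Rightarrow> ennreal"
  assumes "\<And>k. k \<in> k_range l \<Longrightarrow> g k \<le> ennreal B" "B \<ge> 0"
  shows "(\<Sum>k\<in>k_range l. g k) \<le> ennreal (4 * B)"
proof -
  have "card (k_range l) = 4" by (simp add: k_range_def)
  then have "(\<Sum>k\<in>k_range l. ennreal B) = ennreal (4 * B)"
    using assms(2) by (simp add: ennreal_mult)
  then show ?thesis using sum_mono[of "k_range l" g "\<lambda>_. ennreal B"] assms(1) by simp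
qed

text \<open>With \<open>F\<close> the energy of \<open>f\<close> and \<open>R = 2\<^sup>j\<close>, the low frequencies contribute \<open>l\<^sup>-\<^sup>1 (l\<^bsup>1/2\<^esup> R) F\<close>, each middle one
\<open>l\<^bsup>-1/2\<^esup> R F\<close>, and the high frequency \<open>2\<^sup>k\<close> contributes \<open>4\<^sup>-\<^sup>k (2\<^sup>k R) F\<close>. The last terms form a geometric series that is
dominated by its first term, and all three parts are of size \<open>l\<^bsup>-1/2\<^esup> R F\<close>.\<close>

theorem Y_norm_compact_support:
  obtains C where "C > 0"
    "\<And>l j f. l > 0 \<Longrightarrow> f \<in> schwartz \<Longrightarrow> (\<And>x. f x \<noteq> 0 \<Longrightarrow> norm x \<le> 2 ^ j) \<Longrightarrow>
      Y_norm \<phi> l (distr_of f) \<le> ennreal (C * sqrt (l powr (- 1 / 2) * 2 ^ j * Lpow 2 f))"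
proof -
  obtain C1 where C1: "C1 > 0"
    "\<And>s R f. s > 0 \<Longrightarrow> R > 0 \<Longrightarrow> f \<in> schwartz \<Longrightarrow> (\<And>x. f x \<noteq> 0 \<Longrightarrow> norm x \<le> R) \<Longrightarrow>
      Lpow 2 (fmul (dil s \<phi>) f) \<le> C1 * min 1 (s * R) * Lpow 2 f"
    by (rule local_energy[OF phi]) blast
  obtain C2 where C2: "C2 > 0"
    "\<And>k j f. f \<in> schwartz \<Longrightarrow> (\<And>x. f x \<noteq> 0 \<Longrightarrow> norm x \<le> 2 ^ j) \<Longrightarrow>
      (B_norm (LP_piece \<phi> k f))\<^sup>2 \<le> ennreal (C2 * 2 ^ j * Lpow 2 f)"
    by (rule B_norm_fmul[OF LP_psi_schwartz]) blast
  obtain C3 where C3: "C3 > 0"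
    "\<And>s R f. s > 0 \<Longrightarrow> R > 0 \<Longrightarrow> f \<in> schwartz \<Longrightarrow> (\<And>x. f x \<noteq> 0 \<Longrightarrow> norm x \<le> R) \<Longrightarrow>
      Lpow 2 (fmul (dil s (LP_psi \<phi>)) f) \<le> C3 * min 1 (s * R) * Lpow 2 f"
    by (rule local_energy[OF LP_psi_schwartz]) blast
  define C where "C = sqrt (4 / 3 * C1 + 4 * C2 + 32 / 3 * C3)"
  have C: "C > 0" using C1 C2 C3 by (simp add: C_def add_pos_pos)
  show ?thesis
  proof (rule that[OF C])
    fix l :: real and j :: nat and f :: "'a \<Rightarrow> complex"
    assume l: "l > 0" and f: "f \<in> schwartz" and supp: "\<And>x. f x \<noteq> 0 \<Longrightarrow> norm x \<le> 2 ^ j"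
    define R where "R = (2::real) ^ j"
    have R: "R > 0" by (simp add: R_def)
    define F where "F = Lpow 2 f"
    have F: "F \<ge> 0" by (simp add: F_def)
    define Q where "Q = l powr (- 1 / 2) * R * F"
    have Q: "Q \<ge> 0" using R F by (simp add: Q_def)
    have energy: "C' * min 1 (s * R) * F \<le> C' * (s * R) * F" if "C' > 0" for C' s
      using that F by (intro mult_right_mono mult_left_mono) auto
    have low: "(weighted_norm l (LP_proj_below \<phi> l (distr_of f)))\<^sup>2 \<le> ennreal (4 / 3 * C1 * Q)"
    proof -
      define s where "s = (2::real) powi (k_of l - 3)"
      have s: "s > 0" "s \<le> sqrt l" using powi_k_of(1)[OF l] by (auto simp: s_def)
      have "Lpow 2 (fmul (dil s \<phi>) f) \<le> C1 * min 1 (s * R) * F"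
        unfolding F_def by (rule C1(2)[OF s(1) R f]) (use supp in \<open>auto simp: R_def\<close>)
      also have "\<dots> \<le> C1 * (s * R) * F" by (rule energy[OF C1(1)])
      also have "\<dots> \<le> C1 * (sqrt l * R) * F"
        using s C1(1) R F by (intro mult_right_mono mult_left_mono) auto
      finally have "4 / 3 / l * Lpow 2 (fmul (dil s \<phi>) f) \<le> 4 / 3 / l * (C1 * (sqrt l * R) * F)"
        using l by (intro mult_left_mono) auto
      also have "\<dots> = 4 / 3 * C1 * ((sqrt l / l) * R * F)" by simp
      also have "sqrt l / l = l powr (- 1 / 2)"
      proof -
        have "sqrt l / l = l powr (1 / 2) / l powr 1" using l by (simp add: powr_half_sqrt)
        also have "\<dots> = l powr (1 / 2 - 1)" by (simp only: powr_diff)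
        finally show ?thesis by simp
      qed
      finally show ?thesis
        using weighted_norm_low[OF l f] unfolding s_def[symmetric] Q_def
        by (meson ennreal_leI order_trans)
    qed
    have mid: "(\<Sum>k\<in>k_range l. ennreal (l powr (- 1 / 2)) * (distr_norm B_norm (LP_proj \<phi> k (distr_of f)))\<^sup>2)
       \<le> ennreal (4 * C2 * Q)"
    proof -
      have "ennreal (l powr (- 1 / 2)) * (distr_norm B_norm (LP_proj \<phi> k (distr_of f)))\<^sup>2 \<le> ennreal (C2 * Q)" for k
      proof -
        have "distr_norm B_norm (LP_proj \<phi> k (distr_of f)) \<le> B_norm (LP_piece \<phi> k f)"
          unfolding LP_proj_def by (intro distr_norm_le represents_fmul LP_psi_dilate_schwartz f)
        then have "(distr_norm B_norm (LP_proj \<phi> k (distr_of f)))\<^sup>2 \<le> (B_norm (LP_piece \<phi> k f))\<^sup>2"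
          by (intro power_mono) auto
        also have "\<dots> \<le> ennreal (C2 * R * F)" unfolding R_def F_def by (rule C2(2)[OF f]) (use supp in auto)
        finally have "ennreal (l powr (- 1 / 2)) * (distr_norm B_norm (LP_proj \<phi> k (distr_of f)))\<^sup>2
            \<le> ennreal (l powr (- 1 / 2)) * ennreal (C2 * R * F)"
          by (rule mult_left_mono) simp
        also have "\<dots> = ennreal (l powr (- 1 / 2) * (C2 * R * F))"
          using C2(1) R F by (intro ennreal_mult[symmetric]) auto
        also have "l powr (- 1 / 2) * (C2 * R * F) = C2 * Q" by (simp add: Q_def)
        finally show ?thesis .
      qed
      then have "(\<Sum>k\<in>k_range l. ennreal (l powr (- 1 / 2)) * (distr_norm B_norm (LP_proj \<phi> k (distr_of f)))\<^sup>2)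
         \<le> ennreal (4 * (C2 * Q))"
        using C2(1) Q by (intro sum_k_range_le) auto
      then show ?thesis by (simp add: mult.assoc)
    qed
    have high: "(\<Sum>\<^sub>\<infinity>k\<in>{k. k > k_of l + 1}. (weighted_norm l (LP_proj \<phi> k (distr_of f)))\<^sup>2) \<le> ennreal (32 / 3 * C3 * Q)"
    proof -
      have "(\<Sum>k\<in>A. 2 powr (- 2 * real_of_int k) * Lpow 2 (LP_piece \<phi> k f)) \<le> 2 * C3 * Q"
        if A: "finite A" "A \<subseteq> {k. k > k_of l + 1}" for A
      proof -
        have one: "2 powr (- 2 * real_of_int k) * Lpow 2 (LP_piece \<phi> k f)
            \<le> C3 * R * F * 2 powr (- 1 * real_of_int k)" for k
        proof -
          have s: "(2::real) powi k > 0" by simp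
          have "Lpow 2 (LP_piece \<phi> k f) \<le> C3 * min 1 (2 powi k * R) * F"
            unfolding F_def by (rule C3(2)[OF s R f]) (use supp in \<open>auto simp: R_def\<close>)
          also have "\<dots> \<le> C3 * (2 powi k * R) * F" by (rule energy[OF C3(1)])
          finally have "2 powr (- 2 * real_of_int k) * Lpow 2 (LP_piece \<phi> k f)
             \<le> 2 powr (- 2 * real_of_int k) * (C3 * (2 powi k * R) * F)" by (intro mult_left_mono) auto
          also have "\<dots> = C3 * R * F * (2 powr (- 2 * real_of_int k) * 2 powr real_of_int k)"
            by (simp add: powr_real_of_int')
          also have "2 powr (- 2 * real_of_int k) * 2 powr real_of_int k = 2 powr (- 1 * real_of_int k)"
            unfolding powr_add[symmetric] by simp
          finally show ?thesis .
        qed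
        have "(\<Sum>k\<in>A. 2 powr (- 2 * real_of_int k) * Lpow 2 (LP_piece \<phi> k f))
           \<le> C3 * R * F * (\<Sum>k\<in>A. 2 powr (- 1 * real_of_int k))"
          unfolding sum_distrib_left by (intro sum_mono one)
        also have "\<dots> \<le> C3 * R * F * (l powr (- 1 / 2) / (1 - 2 powr (- 1)))"
          using C3(1) R F by (intro mult_left_mono sum_geometric_high_le l A) auto
        also have "\<dots> = 2 * C3 * Q" by (simp add: Q_def powr_minus_divide)
        finally show ?thesis .
      qed
      then have "(\<Sum>\<^sub>\<infinity>k\<in>{k. k > k_of l + 1}. (weighted_norm l (LP_proj \<phi> k (distr_of f)))\<^sup>2) \<le> ennreal (16 / 3 * (2 * C3 * Q))"
        by (rule weighted_norm_high_sum[OF l f])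
      also have "16 / 3 * (2 * C3 * Q) = 32 / 3 * C3 * Q" by simp
      finally show ?thesis .
    qed
    have "Y_norm \<phi> l (distr_of f) \<le> ennreal (C * sqrt Q)"
      unfolding Y_norm_def C_def by (rule enn_powr_sum3_le[OF low mid high]) (use C1(1) C2(1) C3(1) Q in auto)
    then show "Y_norm \<phi> l (distr_of f) \<le> ennreal (C * sqrt (l powr (- 1 / 2) * 2 ^ j * Lpow 2 f))"
      by (simp add: Q_def R_def F_def)
  qed
qed

text \<open>All exponents come from scaling: Bernstein's inequality at frequency \<open>2\<^sup>k\<close> costs \<open>2\<^bsup>kd(1/t-1/2)\<^esup>\<close> in the weighted terms,
and \<open>2\<^bsup>kd(1/t-1/r)\<^esup>\<close> in the middle terms, where \<open>r\<close> is dual to \<open>q\<^sub>d\<close>; the weights turn both into \<open>l\<^bsup>-e\<^esup>\<close> at \<open>2\<^sup>k \<sim> l\<^bsup>1/2\<^esup>\<close>. For high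
frequencies the square of the weighted cost is \<open>2\<^bsup>-4ek\<^esup>\<close>, which is summable exactly if \<open>e > 0\<close>; for \<open>e = 0\<close>, that is
\<open>p = p\<^sub>d\<close>, which forces \<open>d \<ge> 3\<close>, the endpoint inequality applies.\<close>

theorem Z_norm_Lp:
  fixes p :: real
  assumes d2: "DIM('a) \<ge> 2" and p: "ereal p \<in> {ereal (q_exp DIM('a))..p_exp DIM('a)}"
  defines "t \<equiv> p / (p - 1)" and "e \<equiv> real DIM('a) / 2 * (1 / p - recip (p_exp DIM('a)))"
  obtains C where "C > 0"
    "\<And>l f. l > 0 \<Longrightarrow> f \<in> schwartz \<Longrightarrow>
      Z_norm \<phi> l (distr_of f) \<le> ennreal (C * (l powr (- e) * Lpow t f powr (1 / t)))"
proof -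
  define d where "d = real DIM('a)"
  have d: "d \<ge> 2" using d2 by (simp add: d_def)
  define q where "q = q_exp DIM('a)"
  have q: "q > 2" "1 / q = (d - 1) / (2 * (d + 1))"
    using d unfolding q_def q_exp_def d_def[symmetric] by (auto simp: field_simps)
  have pq: "p \<ge> q" using p by (simp add: q_def)
  then have p2: "p > 2" using q by simp
  define \<rho> where "\<rho> = recip (p_exp DIM('a))"
  have \<rho>: "\<rho> = 1 / 2 - 1 / d"
  proof (cases "DIM('a) = 2")
    case True
    then show ?thesis by (simp add: \<rho>_def p_exp_def recip_def d_def)
  next
    case False
    then have "d \<ge> 3" using d2 by (simp add: d_def)
    then have "1 / 2 - 1 / d > 0" by (simp add: field_simps)
    then show ?thesis using False unfolding \<rho>_def p_exp_def recip_def d_def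
      by (simp add: one_ereal_def)
  qed
  have p\<rho>: "1 / p \<ge> \<rho>"
  proof (cases "DIM('a) = 2")
    case True
    then show ?thesis using p2 unfolding \<rho> d_def by simp
  next
    case False
    then have d3: "d \<ge> 3" using d2 by (simp add: d_def)
    then have "1 / 2 - 1 / d > 0" by (simp add: field_simps)
    moreover have "p \<le> 1 / (1 / 2 - 1 / d)" using p False by (simp add: p_exp_def d_def)
    ultimately show ?thesis using p2 unfolding \<rho> by (simp add: field_simps)
  qed
  have e0: "e \<ge> 0" using p\<rho> d unfolding e_def \<rho>_def[symmetric] by simp
  have t: "1 / t = 1 - 1 / p" "t > 1" "t \<le> 2" using p2 by (auto simp: t_def field_simps)
  define \<beta> where "\<beta> = 1 / t - 1 / 2"
  have \<beta>: "\<beta> \<ge> 0" "\<beta> = 1 / 2 - 1 / p" using p2 by (auto simp: \<beta>_def t field_simps)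
  \<comment> \<open>The scaling identity behind the low and the high frequencies.\<close>
  have e\<beta>: "- 2 * e = d * \<beta> - 1"
    unfolding e_def \<beta>(2) \<rho>_def[symmetric] \<rho> d_def[symmetric] using d by (simp add: field_simps)
  define r where "r = dual_exp (q_exp DIM('a))"
  have r1: "1 / r = 1 - 1 / q"
    unfolding r_def dual_exp_def recip_def q_def[symmetric] using q(1) by (simp add: one_ereal_def)
  have rpd: "1 / dual_exp (p_exp DIM('a)) = 1 - \<rho>" by (simp add: dual_exp_def \<rho>_def)
  have r0: "r > 0" unfolding r_def dual_exp_def recip_def q_def[symmetric] using q(1) by (simp add: one_ereal_def)
  have "1 / p \<le> 1 / q" using pq q(1) by (intro divide_left_mono) auto
  then have itr: "1 / r \<le> 1 / t" unfolding r1 t(1) by (rule diff_left_mono)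
  then have tr: "t \<le> r" using t(2) r0 by (simp add: field_simps)
  have r_ge: "r \<ge> 1" using tr t by simp
  obtain C1 where C1: "C1 > 0"
    "\<And>s f t r. s > 0 \<Longrightarrow> f \<in> schwartz \<Longrightarrow> 1 \<le> t \<Longrightarrow> t \<le> r \<Longrightarrow>
      Lpow r (fmul (dil s \<phi>) f) powr (1 / r)
      \<le> C1 * s powr (real DIM('a) * (1 / t - 1 / r)) * Lpow t f powr (1 / t)"
    by (rule bernstein[OF phi]) blast
  obtain C2 where C2: "C2 > 0"
    "\<And>s f t r. s > 0 \<Longrightarrow> f \<in> schwartz \<Longrightarrow> 1 \<le> t \<Longrightarrow> t \<le> r \<Longrightarrow>
      Lpow r (fmul (dil s (LP_psi \<phi>)) f) powr (1 / r)
      \<le> C2 * s powr (real DIM('a) * (1 / t - 1 / r)) * Lpow t f powr (1 / t)"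
    by (rule bernstein[OF LP_psi_schwartz]) blast
  have sq: "Lpow 2 g \<le> C\<^sup>2 * s powr (2 * d * \<beta>) * N\<^sup>2"
    if "Lpow 2 g powr (1 / 2) \<le> C * s powr (real DIM('a) * (1 / t - 1 / 2)) * N" for g :: "'a \<Rightarrow> complex" and C s N
  proof -
    have "(Lpow 2 g powr (1 / 2))\<^sup>2 \<le> (C * s powr (d * \<beta>) * N)\<^sup>2"
      using that unfolding \<beta>_def d_def by (intro power_mono) auto
    also have "\<dots> = C\<^sup>2 * (s powr (d * \<beta>) * s powr (d * \<beta>)) * N\<^sup>2" by (simp add: power2_eq_square)
    also have "s powr (d * \<beta>) * s powr (d * \<beta>) = s powr (2 * d * \<beta>)"
      unfolding powr_add[symmetric] by (rule arg_cong) simp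
    finally show ?thesis by (simp add: powr_half_sqrt)
  qed
  have high: "\<exists>C3>0. \<forall>l f A. l > 0 \<longrightarrow> f \<in> schwartz \<longrightarrow> finite A \<longrightarrow> A \<subseteq> {k. k > k_of l + 1} \<longrightarrow>
      (\<Sum>k\<in>A. 2 powr (- 2 * real_of_int k) * Lpow 2 (LP_piece \<phi> k f))
      \<le> C3 * (l powr (- 2 * e) * (Lpow t f powr (1 / t))\<^sup>2)"
  proof (cases "e = 0")
    case True
    then have 1: "1 / p = \<rho>" using d unfolding e_def \<rho>_def[symmetric] d_def[symmetric] by simp
    have d3: "DIM('a) \<ge> 3"
    proof (rule ccontr)
      assume "\<not> DIM('a) \<ge> 3"
      then have "d = 2" using d2 by (simp add: d_def)
      then show False using 1 p2 unfolding \<rho> by simp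
    qed
    have "1 / t = 1 / (2 * d / (d + 2))" unfolding t(1) 1 \<rho> using d by (simp add: field_simps)
    then have "t = 2 * d / (d + 2)" using t(2) by (metis div_by_1 divide_divide_eq_right mult_1)
    then obtain C where "C > 0"
      "\<And>f A. f \<in> schwartz \<Longrightarrow> finite A \<Longrightarrow>
      (\<Sum>k\<in>A. 2 powr (- 2 * real_of_int k) * Lpow 2 (LP_piece \<phi> k f)) \<le> C * (Lpow t f powr (1 / t))\<^sup>2"
      using endpoint_sobolev[OF LP_psi_schwartz d3, of t] unfolding d_def by blast
    then show ?thesis using True by (intro exI[of _ C]) auto
  next
    case False
    then have e: "e > 0" using e0 by simp
    define c where "c = 1 / (1 - 2 powr (- (4 * e)))"
    have c: "c > 0" unfolding c_def using e powr_less_mono[of "- (4 * e)" 0 "2::real"] by simp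
    show ?thesis
    proof (intro exI[of _ "C2\<^sup>2 * c"] conjI allI impI)
      show "C2\<^sup>2 * c > 0" using C2(1) c by simp
      fix l :: real and f :: "'a \<Rightarrow> complex" and A :: "int set"
      assume l: "l > 0" and f: "f \<in> schwartz" and A: "finite A" "A \<subseteq> {k. k > k_of l + 1}"
      define N where "N = Lpow t f powr (1 / t)"
      have one: "2 powr (- 2 * real_of_int k) * Lpow 2 (LP_piece \<phi> k f)
          \<le> C2\<^sup>2 * N\<^sup>2 * 2 powr (- (4 * e) * real_of_int k)" for k
      proof -
        have s: "(2::real) powi k > 0" by simp
        have "Lpow 2 (LP_piece \<phi> k f) \<le> C2\<^sup>2 * (2 powi k) powr (2 * d * \<beta>) * N\<^sup>2"
          unfolding N_def using t by (intro sq C2(2) s f) auto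
        also have "(2 powi k) powr (2 * d * \<beta>) = 2 powr (2 * d * \<beta> * real_of_int k)"
          by (simp add: powr_powr mult.commute flip: powr_real_of_int')
        finally have "2 powr (- 2 * real_of_int k) * Lpow 2 (LP_piece \<phi> k f)
           \<le> 2 powr (- 2 * real_of_int k) * (C2\<^sup>2 * 2 powr (2 * d * \<beta> * real_of_int k) * N\<^sup>2)"
          by (intro mult_left_mono) auto
        also have "\<dots> = C2\<^sup>2 * N\<^sup>2 * (2 powr (- 2 * real_of_int k) * 2 powr (2 * d * \<beta> * real_of_int k))" by simp
        also have "2 powr (- 2 * real_of_int k) * 2 powr (2 * d * \<beta> * real_of_int k) = 2 powr ((2 * (d * \<beta> - 1)) * real_of_int k)"
          unfolding powr_add[symmetric] by (intro arg_cong[where f="\<lambda>x. 2 powr x"]) (simp add: algebra_simps)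
        also have "2 * (d * \<beta> - 1) = - (4 * e)" unfolding e\<beta>[symmetric] by simp
        finally show ?thesis .
      qed
      have "(\<Sum>k\<in>A. 2 powr (- 2 * real_of_int k) * Lpow 2 (LP_piece \<phi> k f))
         \<le> C2\<^sup>2 * N\<^sup>2 * (\<Sum>k\<in>A. 2 powr (- (4 * e) * real_of_int k))"
        unfolding sum_distrib_left by (intro sum_mono one)
      also have "\<dots> \<le> C2\<^sup>2 * N\<^sup>2 * (l powr (- (4 * e) / 2) / (1 - 2 powr (- (4 * e))))"
        using e by (intro mult_left_mono sum_geometric_high_le l A) auto
      also have "\<dots> = C2\<^sup>2 * c * (l powr (- 2 * e) * N\<^sup>2)" by (simp add: c_def)
      finally show "(\<Sum>k\<in>A. 2 powr (- 2 * real_of_int k) * Lpow 2 (LP_piece \<phi> k f))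
        \<le> C2\<^sup>2 * c * (l powr (- 2 * e) * (Lpow t f powr (1 / t))\<^sup>2)" unfolding N_def .
    qed
  qed
  then obtain C3 where C3: "C3 > 0" "\<And>l f A. l > 0 \<Longrightarrow> f \<in> schwartz \<Longrightarrow> finite A \<Longrightarrow> A \<subseteq> {k. k > k_of l + 1} \<Longrightarrow>
      (\<Sum>k\<in>A. 2 powr (- 2 * real_of_int k) * Lpow 2 (LP_piece \<phi> k f))
      \<le> C3 * (l powr (- 2 * e) * (Lpow t f powr (1 / t))\<^sup>2)" by blast
  define \<gamma> where "\<gamma> = 1 / t - 1 / r"
  have \<gamma>: "\<gamma> \<ge> 0" using itr by (simp add: \<gamma>_def)
  define C4 where "C4 = 4 * (C2\<^sup>2 * 4 powr (2 * d * \<gamma>))"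
  have C4: "C4 \<ge> 0" by (simp add: C4_def)
  define C where "C = sqrt (4 / 3 * C1\<^sup>2 + C4 + 16 / 3 * C3)"
  have C: "C > 0" unfolding C_def using C1(1) C3(1) C4 by (simp add: add_pos_nonneg add_nonneg_pos)
  show ?thesis
  proof (rule that[OF C])
    fix l :: real and f :: "'a \<Rightarrow> complex" assume l: "l > 0" and f: "f \<in> schwartz"
    define N where "N = Lpow t f powr (1 / t)"
    have N: "N \<ge> 0" by (simp add: N_def)
    define Q where "Q = l powr (- 2 * e) * N\<^sup>2"
    have Q: "Q \<ge> 0" by (simp add: Q_def)
    have sqrt_powr: "sqrt l powr x = l powr (x / 2)" for x
      using l by (simp add: powr_half_sqrt[symmetric] powr_powr)
    have low: "(weighted_norm l (LP_proj_below \<phi> l (distr_of f)))\<^sup>2 \<le> ennreal (4 / 3 * C1\<^sup>2 * Q)"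
    proof -
      define s where "s = (2::real) powi (k_of l - 3)"
      have s: "s > 0" "s \<le> sqrt l" using powi_k_of(1)[OF l] by (auto simp: s_def)
      have "Lpow 2 (fmul (dil s \<phi>) f) \<le> C1\<^sup>2 * s powr (2 * d * \<beta>) * N\<^sup>2"
        unfolding N_def using t by (intro sq C1(2) s f) auto
      also have "\<dots> \<le> C1\<^sup>2 * sqrt l powr (2 * d * \<beta>) * N\<^sup>2"
        using s \<beta> d by (intro mult_right_mono mult_left_mono powr_mono2) auto
      finally have "4 / 3 / l * Lpow 2 (fmul (dil s \<phi>) f) \<le> 4 / 3 / l * (C1\<^sup>2 * sqrt l powr (2 * d * \<beta>) * N\<^sup>2)"
        using l by (intro mult_left_mono) auto
      also have "\<dots> = 4 / 3 * C1\<^sup>2 * ((l powr (d * \<beta>) / l) * N\<^sup>2)" by (simp add: sqrt_powr)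
      also have "l powr (d * \<beta>) / l = l powr (- 2 * e)" unfolding e\<beta> using l by (simp add: powr_diff)
      finally show ?thesis
        using weighted_norm_low[OF l f] unfolding s_def[symmetric] Q_def
        by (meson ennreal_leI order_trans)
    qed
    have mid: "(\<Sum>k\<in>k_range l. ennreal (l powr (real DIM('a) * (1 / dual_exp (q_exp DIM('a)) - 1 / dual_exp (p_exp DIM('a)))))
           * (distr_norm (Lp_norm (dual_exp (q_exp DIM('a)))) (LP_proj \<phi> k (distr_of f)))\<^sup>2) \<le> ennreal (C4 * Q)"
    proof -
      have one: "ennreal (l powr (real DIM('a) * (1 / dual_exp (q_exp DIM('a)) - 1 / dual_exp (p_exp DIM('a)))))
           * (distr_norm (Lp_norm (dual_exp (q_exp DIM('a)))) (LP_proj \<phi> k (distr_of f)))\<^sup>2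
         \<le> ennreal (C2\<^sup>2 * 4 powr (2 * d * \<gamma>) * Q)" if k: "k \<in> k_range l" for k
      proof -
        let ?g = "LP_piece \<phi> k f"
        have s: "(2::real) powi k > 0" by simp
        have "distr_norm (Lp_norm r) (LP_proj \<phi> k (distr_of f)) \<le> Lp_norm r ?g"
          unfolding LP_proj_def by (intro distr_norm_le represents_fmul LP_psi_dilate_schwartz f)
        also have "\<dots> = ennreal (Lpow r ?g powr (1 / r))"
          by (intro Lp_norm_eq_Lpow fmul_schwartz LP_psi_dilate_schwartz f r_ge)
        also have "\<dots> \<le> ennreal (C2 * (4 * sqrt l) powr (d * \<gamma>) * N)"
        proof (rule ennreal_leI)
          have "Lpow r ?g powr (1 / r) \<le> C2 * (2 powi k) powr (d * \<gamma>) * N"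
            unfolding N_def d_def \<gamma>_def using t tr by (intro C2(2) s f) auto
          also have "\<dots> \<le> C2 * (4 * sqrt l) powr (d * \<gamma>) * N"
            using C2(1) N \<gamma> d k powi_k_of(3)[OF l k] by (intro mult_right_mono mult_left_mono powr_mono2) auto
          finally show "Lpow r ?g powr (1 / r) \<le> C2 * (4 * sqrt l) powr (d * \<gamma>) * N" .
        qed
        finally have "(distr_norm (Lp_norm r) (LP_proj \<phi> k (distr_of f)))\<^sup>2 \<le> (ennreal (C2 * (4 * sqrt l) powr (d * \<gamma>) * N))\<^sup>2"
          by (intro power_mono) auto
        also have "\<dots> = ennreal ((C2 * (4 * sqrt l) powr (d * \<gamma>) * N)\<^sup>2)"
          using C2(1) N by (intro ennreal_power) auto
        also have "(C2 * (4 * sqrt l) powr (d * \<gamma>) * N)\<^sup>2 = C2\<^sup>2 * ((4 * sqrt l) powr (d * \<gamma>) * (4 * sqrt l) powr (d * \<gamma>)) * N\<^sup>2"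
          by (simp add: power2_eq_square)
        also have "(4 * sqrt l) powr (d * \<gamma>) * (4 * sqrt l) powr (d * \<gamma>) = 4 powr (2 * d * \<gamma>) * l powr (d * \<gamma>)"
        proof -
          have "(4 * sqrt l) powr (d * \<gamma>) * (4 * sqrt l) powr (d * \<gamma>) = (4 * sqrt l) powr (2 * d * \<gamma>)"
            unfolding powr_add[symmetric] by (intro arg_cong[where f="\<lambda>x. (4 * sqrt l) powr x"]) simp
          also have "\<dots> = 4 powr (2 * d * \<gamma>) * sqrt l powr (2 * d * \<gamma>)" by (simp add: powr_mult)
          finally show ?thesis by (simp add: sqrt_powr)
        qed
        finally have le: "(distr_norm (Lp_norm r) (LP_proj \<phi> k (distr_of f)))\<^sup>2
           \<le> ennreal (C2\<^sup>2 * (4 powr (2 * d * \<gamma>) * l powr (d * \<gamma>)) * N\<^sup>2)" .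
        define x where "x = d * (1 / r - (1 - \<rho>))"
        have "ennreal (l powr x) * (distr_norm (Lp_norm r) (LP_proj \<phi> k (distr_of f)))\<^sup>2
           \<le> ennreal (l powr x) * ennreal (C2\<^sup>2 * (4 powr (2 * d * \<gamma>) * l powr (d * \<gamma>)) * N\<^sup>2)"
          by (intro mult_left_mono le) simp
        also have "\<dots> = ennreal (l powr x * (C2\<^sup>2 * (4 powr (2 * d * \<gamma>) * l powr (d * \<gamma>)) * N\<^sup>2))"
          by (intro ennreal_mult[symmetric]) auto
        also have "l powr x * (C2\<^sup>2 * (4 powr (2 * d * \<gamma>) * l powr (d * \<gamma>)) * N\<^sup>2)
           = C2\<^sup>2 * 4 powr (2 * d * \<gamma>) * ((l powr x * l powr (d * \<gamma>)) * N\<^sup>2)" by simp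
        also have "l powr x * l powr (d * \<gamma>) = l powr (x + d * \<gamma>)" by (simp add: powr_add)
        also have "x + d * \<gamma> = - 2 * e"
          unfolding x_def \<gamma>_def t(1) e_def \<rho>_def[symmetric] d_def[symmetric] by (simp add: algebra_simps)
        finally show ?thesis unfolding x_def d_def r_def[symmetric] rpd Q_def .
      qed
      have "(\<Sum>k\<in>k_range l. ennreal (l powr (real DIM('a) * (1 / dual_exp (q_exp DIM('a)) - 1 / dual_exp (p_exp DIM('a)))))
           * (distr_norm (Lp_norm (dual_exp (q_exp DIM('a)))) (LP_proj \<phi> k (distr_of f)))\<^sup>2)
         \<le> ennreal (4 * (C2\<^sup>2 * 4 powr (2 * d * \<gamma>) * Q))"
        by (rule sum_k_range_le[OF one]) (use Q in auto)
      also have "4 * (C2\<^sup>2 * 4 powr (2 * d * \<gamma>) * Q) = C4 * Q" by (simp add: C4_def)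
      finally show ?thesis .
    qed
    have high: "(\<Sum>\<^sub>\<infinity>k\<in>{k. k > k_of l + 1}. (weighted_norm l (LP_proj \<phi> k (distr_of f)))\<^sup>2) \<le> ennreal (16 / 3 * C3 * Q)"
      unfolding mult.assoc[of "16 / 3"]
      unfolding Q_def N_def by (intro weighted_norm_high_sum[OF l f] C3(2)[OF l f])
    have "Z_norm \<phi> l (distr_of f) \<le> ennreal (C * sqrt Q)"
      unfolding Z_norm_def C_def by (rule enn_powr_sum3_le[OF low mid high]) (use C1(1) C4 C3(1) Q in auto)
    also have "sqrt Q = l powr (- e) * N"
    proof (rule real_sqrt_unique)
      have "(l powr (- e))\<^sup>2 = l powr (- e + - e)" unfolding power2_eq_square powr_add ..
      then show "(l powr (- e) * N)\<^sup>2 = Q" by (simp add: Q_def power_mult_distrib)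
    qed (use N in simp)
    finally show "Z_norm \<phi> l (distr_of f) \<le> ennreal (C * (l powr (- e) * Lpow t f powr (1 / t)))"
      unfolding N_def .
  qed
qed

end

section \<open>Duality\<close>

lemma distr_of_zero: "distr_of (\<lambda>x. 0) = (\<lambda>f. 0)"
  by (rule ext) (simp add: distr_of_def)

lemma distr_of_scale:
  assumes "f \<in> schwartz"
  shows "distr_of (\<lambda>x. c * f x) = distr_scale c (distr_of f)"
proof (rule ext)
  fix g
  have "(LINT x|lborel. c * f x * g x) = (LINT x|lborel. c * (f x * g x))" by (simp only: mult.assoc)
  then show "distr_of (\<lambda>x. c * f x) g = distr_scale c (distr_of f) g"
    by (simp add: distr_of_def distr_scale_def)
qed

text \<open>The splitting \<open>f = f + 0\<close>. That the zero distribution has norm \<open>0\<close> in the other space follows from any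
homogeneous bound for that norm.\<close>

lemma X_norm_le_Y_norm:
  assumes f: "f \<in> schwartz" and Y: "Y_norm \<phi> l (distr_of f) < \<infinity>"
    and Z0: "Z_norm \<phi> l (distr_of (\<lambda>x. 0)) = 0"
  shows "distr_of f \<in> X_space \<phi> l" "X_norm \<phi> l (distr_of f) \<le> Y_norm \<phi> l (distr_of f)"
proof -
  have dec: "distr_of f = distr_add (distr_of f) (distr_of (\<lambda>x. 0))"
    by (simp add: distr_add_def distr_of_zero)
  have m: "distr_of f \<in> Y_space \<phi> l" "distr_of (\<lambda>x. 0) \<in> Z_space \<phi> l"
    using Y Z0 distr_of_tempered[OF f] distr_of_tempered[OF schwartz_zero]
    by (auto simp: Y_space_def Z_space_def)
  show "distr_of f \<in> X_space \<phi> l"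
    unfolding X_space_def using dec m by blast
  have "X_norm \<phi> l (distr_of f) \<le> (case (distr_of f, distr_of (\<lambda>x. 0)) of (f, g) \<Rightarrow> Y_norm \<phi> l f + Z_norm \<phi> l g)"
    unfolding X_norm_def by (rule INF_lower) (use dec m in auto)
  then show "X_norm \<phi> l (distr_of f) \<le> Y_norm \<phi> l (distr_of f)" by (simp add: Z0)
qed

lemma X_norm_le_Z_norm:
  assumes f: "f \<in> schwartz" and Z: "Z_norm \<phi> l (distr_of f) < \<infinity>"
    and Y0: "Y_norm \<phi> l (distr_of (\<lambda>x. 0)) = 0"
  shows "distr_of f \<in> X_space \<phi> l" "X_norm \<phi> l (distr_of f) \<le> Z_norm \<phi> l (distr_of f)"
proof -
  have dec: "distr_of f = distr_add (distr_of (\<lambda>x. 0)) (distr_of f)"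
    by (simp add: distr_add_def distr_of_zero)
  have m: "distr_of f \<in> Z_space \<phi> l" "distr_of (\<lambda>x. 0) \<in> Y_space \<phi> l"
    using Z Y0 distr_of_tempered[OF f] distr_of_tempered[OF schwartz_zero]
    by (auto simp: Y_space_def Z_space_def)
  show "distr_of f \<in> X_space \<phi> l"
    unfolding X_space_def using dec m by blast
  have "X_norm \<phi> l (distr_of f) \<le> (case (distr_of (\<lambda>x. 0), distr_of f) of (f, g) \<Rightarrow> Y_norm \<phi> l f + Z_norm \<phi> l g)"
    unfolding X_norm_def by (rule INF_lower) (use dec m in auto)
  then show "X_norm \<phi> l (distr_of f) \<le> Z_norm \<phi> l (distr_of f)" by (simp add: Y0)
qed

text \<open>The dual norm is tested on \<open>f\<close> divided by its norm; the bound for all multiples of \<open>f\<close> takes the place of the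
homogeneity of the norm of \<open>X\<close>.\<close>

lemma dual_pairing_le:
  assumes L: "L \<in> X_dual \<phi> l" and D: "dual_norm \<phi> l L = ennreal D" "D \<ge> 0"
    and f: "f \<in> schwartz" and N: "N \<ge> 0"
    and X: "\<And>c. c > 0 \<Longrightarrow> distr_of (\<lambda>x. of_real c * f x) \<in> X_space \<phi> l \<and>
      X_norm \<phi> l (distr_of (\<lambda>x. of_real c * f x)) \<le> ennreal (c * N)"
  shows "cmod (L (distr_of f)) \<le> D * N"
proof -
  \<comment> \<open>The addition of \<open>\<delta>\<close> covers the case \<open>N = 0\<close>.\<close>
  have step: "cmod (L (distr_of f)) \<le> D * (N + \<delta>)" if \<delta>: "\<delta> > 0" for \<delta>
  proof -
    define c where "c = 1 / (N + \<delta>)"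
    have c: "c > 0" "c * N \<le> 1" using N \<delta> by (auto simp: c_def)
    have X1: "distr_of f \<in> X_space \<phi> l" using X[of 1] by simp
    have Xc: "distr_of (\<lambda>x. of_real c * f x) \<in> X_space \<phi> l" using X[OF c(1)] by simp
    have "X_norm \<phi> l (distr_of (\<lambda>x. of_real c * f x)) \<le> ennreal (c * N)" using X[OF c(1)] by simp
    also have "\<dots> \<le> 1" using c(2) by simp
    finally have "ennreal (cmod (L (distr_of (\<lambda>x. of_real c * f x)))) \<le> dual_norm \<phi> l L"
      unfolding dual_norm_def using Xc by (intro SUP_upper) auto
    then have "cmod (L (distr_of (\<lambda>x. of_real c * f x))) \<le> D" using D by simp
    moreover have "L (distr_of (\<lambda>x. of_real c * f x)) = of_real c * L (distr_of f)"
      unfolding distr_of_scale[OF f] using L X1 unfolding X_dual_def by blast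
    ultimately have "c * cmod (L (distr_of f)) \<le> D" using c by (simp add: norm_mult)
    then show ?thesis using N \<delta> by (simp add: c_def divide_le_eq mult.commute)
  qed
  show ?thesis
  proof (rule field_le_epsilon)
    fix \<epsilon> :: real assume \<epsilon>: "\<epsilon> > 0"
    define \<delta> where "\<delta> = \<epsilon> / (D + 1)"
    have "\<delta> > 0" using \<epsilon> D by (simp add: \<delta>_def)
    then have "cmod (L (distr_of f)) \<le> D * (N + \<delta>)" by (rule step)
    also have "\<dots> = D * N + D * \<delta>" by (simp add: algebra_simps)
    also have "D * \<delta> \<le> \<epsilon>" using D \<epsilon> by (simp add: \<delta>_def field_simps)
    finally show "cmod (L (distr_of f)) \<le> D * N + \<epsilon>" by simp
  qed
qed

lemma Lpow_zero [simp]: "Lpow t (\<lambda>x. 0) = 0"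
  by (simp add: Lpow_def)

text \<open>On the \<open>j\<close>-th shell the test function is \<open>f = w cnj u\<close> with \<open>w = \<bar>\<phi> (x / 2\<^sup>j)\<bar>\<^sup>2\<close>, a cutoff that equals \<open>1\<close> for
\<open>\<bar>x\<bar> \<le> 2\<^sup>j\<close> and vanishes for \<open>\<bar>x\<bar> > 2\<^sup>j\<^sup>+\<^sup>1\<close>. With \<open>I = \<integral> u f = \<integral> w \<bar>u\<bar>\<^sup>2\<close> one has \<open>\<parallel>f\<parallel>\<^sub>2\<^sup>2 \<le> M\<^sup>2 I\<close>, so duality bounds \<open>I\<close> by a
multiple of its own square root.\<close>

lemma Bstar_norm_dual_le:
  fixes \<phi> u :: "'a::euclidean_space \<Rightarrow> complex"
  assumes phi: "\<phi> \<in> schwartz"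
    and phi_supp: "\<And>\<xi>. \<phi> \<xi> \<noteq> 0 \<Longrightarrow> norm \<xi> \<le> 2"
    and phi_1: "\<And>\<xi>. norm \<xi> \<le> 1 \<Longrightarrow> \<phi> \<xi> = 1"
    and M: "\<And>\<xi>. cmod (\<phi> \<xi>) \<le> M" "M > 0"
    and Y: "\<And>j f. f \<in> schwartz \<Longrightarrow> (\<And>x. f x \<noteq> 0 \<Longrightarrow> norm x \<le> 2 ^ j) \<Longrightarrow>
      Y_norm \<phi> l (distr_of f) \<le> ennreal (C * sqrt (l powr (- 1 / 2) * 2 ^ j * Lpow 2 f))"
    and Z0: "Z_norm \<phi> l (distr_of (\<lambda>x. 0)) = 0"
    and C: "C > 0" and l: "l > 0" and u: "u \<in> schwartz"
    and L: "L \<in> X_dual \<phi> l" "\<And>f. f \<in> schwartz \<Longrightarrow> L (distr_of f) = (LINT x|lborel. u x * f x)"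
    and D: "dual_norm \<phi> l L = ennreal D" "D \<ge> 0"
  shows "ennreal (l powr (1 / 4)) * Bstar_norm u \<le> ennreal (C * M * sqrt 2 * D)"
proof -
  have shell: "ennreal (l powr (1 / 4)) * (ennreal (2 powr (- real j / 2)) * Lp_norm_on 2 (dyadic_shell j) u)
     \<le> ennreal (C * M * sqrt 2 * D)" for j
  proof -
    define w where "w = (\<lambda>x::'a. (cmod (\<phi> (x /\<^sub>R 2 ^ j)))\<^sup>2)"
    have dil: "(dil (2 ^ j) \<phi>) \<in> schwartz" by (intro schwartz_dilate phi) auto
    have w0: "w x \<ge> 0" and wM: "w x \<le> M\<^sup>2" for x
      using M by (auto simp: w_def intro!: power_mono)
    have w_eq: "complex_of_real (w x) = \<phi> (x /\<^sub>R 2 ^ j) * cnj (\<phi> (x /\<^sub>R 2 ^ j))" for x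
      unfolding w_def by (rule complex_norm_square)
    define f where "f = (\<lambda>x. of_real (w x) * cnj (u x))"
    have f: "f \<in> schwartz" unfolding f_def w_eq by (intro schwartz_mult schwartz_cnj dil u)
    have supp: "norm x \<le> 2 ^ Suc j" if "f x \<noteq> 0" for x
    proof -
      have "\<phi> (x /\<^sub>R 2 ^ j) \<noteq> 0" using that by (auto simp: f_def w_def)
      then have "norm (x /\<^sub>R 2 ^ j) \<le> 2" by (rule phi_supp)
      then show ?thesis by (simp add: field_simps)
    qed
    define I where "I = (LINT x|lborel. w x * (cmod (u x))\<^sup>2)"
    have iI: "integrable lborel (\<lambda>x. w x * (cmod (u x))\<^sup>2)"
    proof (rule Bochner_Integration.integrable_bound)
      show "integrable lborel (\<lambda>x. M\<^sup>2 * (cmod (u x))\<^sup>2)"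
        by (intro integrable_mult_right schwartz_square_integrable u)
      show "(\<lambda>x. w x * (cmod (u x))\<^sup>2) \<in> borel_measurable lborel"
        unfolding w_def using schwartz_measurable[OF dil] schwartz_measurable[OF u] by measurable
      show "AE x in lborel. norm (w x * (cmod (u x))\<^sup>2) \<le> norm (M\<^sup>2 * (cmod (u x))\<^sup>2)"
        using w0 wM by (auto simp: abs_mult intro!: mult_right_mono)
    qed
    have I0: "I \<ge> 0" unfolding I_def using w0 by (intro Bochner_Integration.integral_nonneg) auto
    have pair: "(LINT x|lborel. u x * f x) = of_real I"
    proof -
      have "u x * f x = complex_of_real (w x * (cmod (u x))\<^sup>2)" for x
        unfolding f_def of_real_mult complex_norm_square by (simp only: mult_ac)
      then show ?thesis by (simp only: integral_complex_of_real I_def)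
    qed
    have f2: "Lpow 2 f \<le> M\<^sup>2 * I"
    proof -
      have "(LINT x|lborel. (cmod (f x))\<^sup>2) \<le> (LINT x|lborel. M\<^sup>2 * (w x * (cmod (u x))\<^sup>2))"
      proof (rule integral_mono)
        fix x
        have "(cmod (f x))\<^sup>2 = w x * (w x * (cmod (u x))\<^sup>2)"
          by (simp add: f_def norm_mult power_mult_distrib power2_eq_square)
        also have "\<dots> \<le> M\<^sup>2 * (w x * (cmod (u x))\<^sup>2)" using wM w0 by (intro mult_right_mono) auto
        finally show "(cmod (f x))\<^sup>2 \<le> M\<^sup>2 * (w x * (cmod (u x))\<^sup>2)" .
      qed (intro schwartz_square_integrable f integrable_mult_right iI)+
      then show ?thesis by (simp add: Lpow_2 I_def)
    qed
    define A where "A = l powr (- 1 / 2) * 2 ^ Suc j"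
    have A: "A \<ge> 0" by (simp add: A_def)
    define N where "N = C * sqrt (A * Lpow 2 f)"
    have N: "N \<ge> 0" using C A by (simp add: N_def)
    have "cmod (L (distr_of f)) \<le> D * N"
    proof (rule dual_pairing_le[OF L(1) D f N])
      fix c :: real assume c: "c > 0"
      have cf: "(\<lambda>x. of_real c * f x) \<in> schwartz" by (rule schwartz_scale[OF f])
      have "Y_norm \<phi> l (distr_of (\<lambda>x. of_real c * f x)) \<le> ennreal (C * sqrt (l powr (- 1 / 2) * 2 ^ Suc j * Lpow 2 (\<lambda>x. of_real c * f x)))"
        by (rule Y[OF cf]) (use supp in auto)
      also have "C * sqrt (l powr (- 1 / 2) * 2 ^ Suc j * Lpow 2 (\<lambda>x. of_real c * f x)) = c * N"
        unfolding N_def A_def[symmetric] using c by (simp add: Lpow_scale real_sqrt_mult)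
      finally have le: "Y_norm \<phi> l (distr_of (\<lambda>x. of_real c * f x)) \<le> ennreal (c * N)" .
      then have fin: "Y_norm \<phi> l (distr_of (\<lambda>x. of_real c * f x)) < \<infinity>"
        using ennreal_less_top[of "c * N"] by (simp add: le_less_trans)
      show "distr_of (\<lambda>x. of_real c * f x) \<in> X_space \<phi> l \<and> X_norm \<phi> l (distr_of (\<lambda>x. of_real c * f x)) \<le> ennreal (c * N)"
        using X_norm_le_Y_norm[OF cf fin Z0] le by (blast intro: order_trans)
    qed
    then have IDN: "I \<le> D * N" using I0 by (simp add: L(2)[OF f] pair)
    have sI: "sqrt I \<le> D * C * M * sqrt A"
    proof (cases "I = 0")
      case True
      then show ?thesis using C M D A by simp
    next
      case False
      then have I: "sqrt I > 0" using I0 by simp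
      have "sqrt I * sqrt I \<le> D * N" using IDN I0 by simp
      also have "\<dots> \<le> D * (C * sqrt (A * (M\<^sup>2 * I)))"
        unfolding N_def using D C A f2 by (intro mult_left_mono real_sqrt_le_mono) auto
      also have "\<dots> = (D * C * M * sqrt A) * sqrt I" using M by (simp add: real_sqrt_mult)
      finally show ?thesis using I by (rule mult_right_le_imp_le)
    qed
    have "Lp_norm_on 2 (dyadic_shell j) u \<le> ennreal (sqrt I)"
      unfolding I_def
    proof (rule Lp_norm_on_2_le[OF iI])
      fix x :: 'a assume "x \<in> dyadic_shell j"
      then have "norm x \<le> 2 ^ j" by (auto simp: dyadic_shell_def split: if_splits)
      then have "w x = 1" unfolding w_def using phi_1[of "x /\<^sub>R 2 ^ j"] by (simp add: field_simps)
      then show "(cmod (u x))\<^sup>2 \<le> w x * (cmod (u x))\<^sup>2" by simp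
    qed (use w0 in auto)
    also have "\<dots> \<le> ennreal (D * C * M * sqrt A)" using sI by (rule ennreal_leI)
    finally have "ennreal (l powr (1 / 4)) * (ennreal (2 powr (- real j / 2)) * Lp_norm_on 2 (dyadic_shell j) u)
      \<le> ennreal (l powr (1 / 4)) * (ennreal (2 powr (- real j / 2)) * ennreal (D * C * M * sqrt A))"
      by (intro mult_left_mono) auto
    also have "\<dots> = ennreal (l powr (1 / 4) * (2 powr (- real j / 2) * (D * C * M * sqrt A)))"
      using D C M A by (subst ennreal_mult[symmetric], simp, simp)+ simp
    also have "l powr (1 / 4) * (2 powr (- real j / 2) * (D * C * M * sqrt A)) = C * M * sqrt 2 * D"
    proof -
      have "sqrt A = sqrt (l powr (- 1 / 2)) * (sqrt 2 * 2 powr (real j / 2))"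
        by (simp add: A_def real_sqrt_mult sqrt_two_power)
      also have "sqrt (l powr (- 1 / 2)) = l powr (- 1 / 4)"
        by (simp add: powr_half_sqrt[symmetric] powr_powr)
      finally have "l powr (1 / 4) * (2 powr (- real j / 2) * (D * C * M * sqrt A))
         = C * M * sqrt 2 * D * (l powr (1 / 4) * l powr (- 1 / 4)) * (2 powr (- real j / 2) * 2 powr (real j / 2))"
        by (simp only: mult_ac)
      then show ?thesis using l unfolding powr_add[symmetric] by simp
    qed
    finally show ?thesis .
  qed
  then show ?thesis unfolding Bstar_norm_def SUP_mult_left_ennreal by (intro SUP_least)
qed

text \<open>Multiplication by polynomials in \<open>\<bar>u\<bar>\<^sup>2 = u cnj u\<close> preserves the Schwartz space, whereas \<open>\<bar>u\<bar>\<^bsup>p-2\<^esup>\<close> has only finitely many derivatives in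
general.\<close>

lemma schwartz_polynomial_modulus:
  fixes u :: "'a::euclidean_space \<Rightarrow> complex" and Q :: "real \<Rightarrow> real"
  assumes "real_polynomial_function Q" and u: "u \<in> schwartz" and "v \<in> schwartz"
  shows "(\<lambda>x. of_real (Q ((cmod (u x))\<^sup>2)) * v x) \<in> schwartz"
  using assms(1,3)
proof (induction Q arbitrary: v)
  case (linear f)
  have "of_real (f ((cmod (u x))\<^sup>2)) * v x = complex_of_real (f 1) * ((u x * cnj (u x)) * v x)" for x
  proof -
    have eq: "f ((cmod (u x))\<^sup>2) = (cmod (u x))\<^sup>2 * f 1"
      using linear_cmul[OF bounded_linear.linear[OF linear(1)], of "(cmod (u x))\<^sup>2" 1] by simp
    show ?thesis unfolding eq of_real_mult complex_norm_square by (simp only: mult_ac)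
  qed
  moreover have "(\<lambda>x. complex_of_real (f 1) * ((u x * cnj (u x)) * v x)) \<in> schwartz"
    by (intro schwartz_scale schwartz_mult schwartz_cnj u linear)
  ultimately show ?case by (simp only:)
next
  case (const c)
  then show ?case by (rule schwartz_scale)
next
  case (add f g)
  show ?case using schwartz_add[OF add.IH(1)[OF add.prems] add.IH(2)[OF add.prems]]
    by (simp add: distrib_right)
next
  case (mult f g)
  show ?case using mult.IH(1)[OF mult.IH(2)[OF mult.prems]] by (simp add: mult.assoc)
qed

text \<open>The extremal function \<open>\<bar>u\<bar>\<^bsup>p-2\<^esup> cnj u\<close> need not be smooth. By the Weierstrass theorem \<open>s\<^bsup>(p-2)/2\<^esup>\<close> is a uniform limit of
polynomials on the range of \<open>\<bar>u\<bar>\<^sup>2\<close>; inserting these gives Schwartz functions \<open>f\<^sub>n\<close> for which \<open>\<integral> u f\<^sub>n\<close> and the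
\<open>t\<close>-th power of \<open>\<parallel>f\<^sub>n\<parallel>\<^sub>t\<close> both converge to the \<open>p\<close>-th power of \<open>\<parallel>u\<parallel>\<^sub>p\<close>.\<close>

lemma Lp_norm_dual_le:
  fixes \<phi> u :: "'a::euclidean_space \<Rightarrow> complex" and p :: real
  assumes p: "p > 2" and t: "t = p / (p - 1)"
    and Z: "\<And>f. f \<in> schwartz \<Longrightarrow> Z_norm \<phi> l (distr_of f) \<le> ennreal (C * (l powr (- e) * Lpow t f powr (1 / t)))"
    and Y0: "Y_norm \<phi> l (distr_of (\<lambda>x. 0)) = 0"
    and C: "C > 0" and l: "l > 0" and u: "u \<in> schwartz"
    and L: "L \<in> X_dual \<phi> l" "\<And>f. f \<in> schwartz \<Longrightarrow> L (distr_of f) = (LINT x|lborel. u x * f x)"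
    and D: "dual_norm \<phi> l L = ennreal D" "D \<ge> 0"
  shows "ennreal (l powr e) * Lp_norm p u \<le> ennreal (C * D)"
proof -
  have t1: "t > 1" and pt: "(p - 1) * t = p" and it: "1 / t = 1 - 1 / p" using p by (auto simp: t field_simps)
  obtain B where B: "\<And>x. cmod (u x) \<le> B" "B > 0" using schwartz_bdd[OF u] by metis
  have [measurable]: "u \<in> borel_measurable borel" by (rule schwartz_measurable[OF u])
  define \<sigma> where "\<sigma> = (p - 2) / 2"
  have \<sigma>: "\<sigma> > 0" using p by (simp add: \<sigma>_def)
  have "\<exists>Q. real_polynomial_function Q \<and> (\<forall>s\<in>{0..B\<^sup>2}. \<bar>s powr \<sigma> - Q s\<bar> < 1 / real (Suc n))" for n
  proof -
    have "continuous_on {0..B\<^sup>2} (\<lambda>s. s powr \<sigma>)"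
      using \<sigma> by (intro continuous_on_powr' continuous_intros) auto
    then obtain g where "real_polynomial_function g" "\<And>x. x \<in> {0..B\<^sup>2} \<Longrightarrow> \<bar>x powr \<sigma> - g x\<bar> < 1 / real (Suc n)"
      using Stone_Weierstrass_real_polynomial_function[of "{0..B\<^sup>2}" "\<lambda>s. s powr \<sigma>" "1 / real (Suc n)"] by auto
    then show ?thesis by blast
  qed
  then obtain Q where Q: "\<And>n. real_polynomial_function (Q n)"
    "\<And>n s. s \<in> {0..B\<^sup>2} \<Longrightarrow> \<bar>s powr \<sigma> - Q n s\<bar> < 1 / real (Suc n)" by metis
  define q where "q = (\<lambda>n x. Q n ((cmod (u x))\<^sup>2))"
  have ran: "(cmod (u x))\<^sup>2 \<in> {0..B\<^sup>2}" for x using B by (auto intro!: power_mono)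
  have u\<sigma>: "((cmod (u x))\<^sup>2) powr \<sigma> = cmod (u x) powr (p - 2)" for x
  proof (cases "u x = 0")
    case False
    then have eq: "(cmod (u x))\<^sup>2 = cmod (u x) powr 2" by simp
    show ?thesis unfolding eq powr_powr \<sigma>_def by (rule arg_cong) simp
  qed simp
  have q_lim: "(\<lambda>n. q n x) \<longlonglongrightarrow> cmod (u x) powr (p - 2)" for x
  proof (rule LIM_zero_cancel, rule Lim_null_comparison[OF _ LIMSEQ_Suc[OF lim_1_over_n]])
    show "\<forall>\<^sub>F n in sequentially. norm (q n x - cmod (u x) powr (p - 2)) \<le> 1 / real (Suc n)"
      using Q(2)[OF ran] unfolding q_def u\<sigma>[symmetric]
      by (intro always_eventually) (auto simp: abs_minus_commute less_imp_le)
  qed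
  define B' where "B' = B powr (p - 2) + 1"
  have B': "B' > 0" by (simp add: B'_def add_nonneg_pos)
  have q_bd: "\<bar>q n x\<bar> \<le> B'" for n x
  proof -
    have "\<bar>q n x\<bar> \<le> \<bar>cmod (u x) powr (p - 2)\<bar> + \<bar>cmod (u x) powr (p - 2) - q n x\<bar>" by linarith
    also have "\<bar>cmod (u x) powr (p - 2) - q n x\<bar> \<le> 1 / real (Suc n)"
      using Q(2)[OF ran, of x n] unfolding q_def u\<sigma>[symmetric] by simp
    also have "\<dots> \<le> 1" by simp
    also have "\<bar>cmod (u x) powr (p - 2)\<bar> \<le> B powr (p - 2)" using B p by (simp add: powr_mono2)
    finally show ?thesis by (simp add: B'_def)
  qed
  define f where "f = (\<lambda>n x. complex_of_real (q n x) * cnj (u x))"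
  have f: "f n \<in> schwartz" for n
    unfolding f_def q_def by (intro schwartz_polynomial_modulus Q u schwartz_cnj)
  have qm [measurable]: "q n \<in> borel_measurable borel" for n
  proof -
    have "continuous_on UNIV (Q n)" using continuous_on_polymonial_function Q(1) real_polynomial_function_eq by blast
    then have [measurable]: "Q n \<in> borel_measurable borel" by (rule borel_measurable_continuous_onI)
    show ?thesis unfolding q_def by measurable
  qed
  define P where "P = Lpow p u"
  have P0: "P \<ge> 0" by (simp add: P_def)
  have lim1: "(\<lambda>n. LINT x|lborel. q n x * (cmod (u x))\<^sup>2) \<longlonglongrightarrow> P"
    unfolding P_def Lpow_def
  proof (rule integral_dominated_convergence[where w="\<lambda>x. B' * (cmod (u x))\<^sup>2"])
    show "(\<lambda>x. cmod (u x) powr p) \<in> borel_measurable lborel" by measurable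
    show "(\<lambda>x. q n x * (cmod (u x))\<^sup>2) \<in> borel_measurable lborel" for n by measurable
    show "integrable lborel (\<lambda>x. B' * (cmod (u x))\<^sup>2)" by (intro integrable_mult_right schwartz_square_integrable u)
    have "(\<lambda>n. q n x * (cmod (u x))\<^sup>2) \<longlonglongrightarrow> cmod (u x) powr (p - 2) * (cmod (u x))\<^sup>2" for x
      by (intro tendsto_mult q_lim tendsto_const)
    moreover have "cmod (u x) powr (p - 2) * (cmod (u x))\<^sup>2 = cmod (u x) powr p" for x
      by (cases "u x = 0") (simp_all add: powr_diff)
    ultimately show "AE x in lborel. (\<lambda>n. q n x * (cmod (u x))\<^sup>2) \<longlonglongrightarrow> cmod (u x) powr p" by simp
    show "AE x in lborel. norm (q n x * (cmod (u x))\<^sup>2) \<le> B' * (cmod (u x))\<^sup>2" for n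
      using q_bd by (intro AE_I2) (auto simp: abs_mult intro!: mult_right_mono)
  qed
  have lim2: "(\<lambda>n. Lpow t (f n)) \<longlonglongrightarrow> P"
    unfolding P_def Lpow_def
  proof (rule integral_dominated_convergence[where w="\<lambda>x. B' powr t * cmod (u x) powr t"])
    show "(\<lambda>x. cmod (u x) powr p) \<in> borel_measurable lborel" by measurable
    show "(\<lambda>x. cmod (f n x) powr t) \<in> borel_measurable lborel" for n using schwartz_measurable[OF f[of n]] by measurable
    show "integrable lborel (\<lambda>x. B' powr t * cmod (u x) powr t)"
      using t1 by (intro integrable_mult_right schwartz_powr_integrable u) auto
    have "(\<lambda>n. cmod (f n x) powr t) \<longlonglongrightarrow> cmod (u x) powr p" for x
    proof -
      have "(\<lambda>n. \<bar>q n x\<bar> * cmod (u x)) \<longlonglongrightarrow> \<bar>cmod (u x) powr (p - 2)\<bar> * cmod (u x)"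
        by (intro tendsto_mult tendsto_rabs q_lim tendsto_const)
      moreover have "\<bar>cmod (u x) powr (p - 2)\<bar> * cmod (u x) = cmod (u x) powr (p - 1)"
        by (cases "u x = 0") (simp_all add: powr_diff power2_eq_square)
      ultimately have "(\<lambda>n. cmod (f n x)) \<longlonglongrightarrow> cmod (u x) powr (p - 1)" by (simp add: f_def norm_mult)
      then have "(\<lambda>n. cmod (f n x) powr t) \<longlonglongrightarrow> (cmod (u x) powr (p - 1)) powr t"
        using t1 by (intro tendsto_powr' tendsto_const) auto
      then show ?thesis by (simp add: powr_powr pt)
    qed
    then show "AE x in lborel. (\<lambda>n. cmod (f n x) powr t) \<longlonglongrightarrow> cmod (u x) powr p" by simp
    have "cmod (f n x) powr t \<le> B' powr t * cmod (u x) powr t" for n x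
    proof -
      have "cmod (f n x) powr t \<le> (B' * cmod (u x)) powr t"
        using q_bd t1 by (intro powr_mono2) (auto simp: f_def norm_mult intro!: mult_right_mono)
      then show ?thesis using B' by (simp add: powr_mult)
    qed
    then show "AE x in lborel. norm (cmod (f n x) powr t) \<le> B' powr t * cmod (u x) powr t" for n by simp
  qed
  have bound: "(LINT x|lborel. q n x * (cmod (u x))\<^sup>2) \<le> D * (C * (l powr (- e) * Lpow t (f n) powr (1 / t)))" for n
  proof -
    define N where "N = C * (l powr (- e) * Lpow t (f n) powr (1 / t))"
    have N: "N \<ge> 0" using C by (simp add: N_def)
    have "cmod (L (distr_of (f n))) \<le> D * N"
    proof (rule dual_pairing_le[OF L(1) D f N])
      fix c :: real assume c: "c > 0"
      have cf: "(\<lambda>x. of_real c * f n x) \<in> schwartz" by (rule schwartz_scale[OF f])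
      have "Z_norm \<phi> l (distr_of (\<lambda>x. of_real c * f n x)) \<le> ennreal (C * (l powr (- e) * Lpow t (\<lambda>x. of_real c * f n x) powr (1 / t)))"
        by (rule Z[OF cf])
      also have "C * (l powr (- e) * Lpow t (\<lambda>x. of_real c * f n x) powr (1 / t)) = c * N"
        unfolding N_def using c t1 by (simp add: Lpow_scale powr_mult powr_powr)
      finally have le: "Z_norm \<phi> l (distr_of (\<lambda>x. of_real c * f n x)) \<le> ennreal (c * N)" .
      then have fin: "Z_norm \<phi> l (distr_of (\<lambda>x. of_real c * f n x)) < \<infinity>"
        using ennreal_less_top[of "c * N"] by (simp add: le_less_trans)
      show "distr_of (\<lambda>x. of_real c * f n x) \<in> X_space \<phi> l \<and> X_norm \<phi> l (distr_of (\<lambda>x. of_real c * f n x)) \<le> ennreal (c * N)"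
        using X_norm_le_Z_norm[OF cf fin Y0] le by (blast intro: order_trans)
    qed
    moreover have "L (distr_of (f n)) = of_real (LINT x|lborel. q n x * (cmod (u x))\<^sup>2)"
    proof -
      have "u x * f n x = complex_of_real (q n x * (cmod (u x))\<^sup>2)" for x
        unfolding f_def of_real_mult complex_norm_square by (simp only: mult_ac)
      then show ?thesis by (simp only: L(2)[OF f] integral_complex_of_real)
    qed
    ultimately have "\<bar>LINT x|lborel. q n x * (cmod (u x))\<^sup>2\<bar> \<le> D * N" by (simp only: norm_of_real)
    then show ?thesis unfolding N_def by linarith
  qed
  have main: "P powr (1 / p) \<le> D * (C * l powr (- e))"
  proof (cases "P = 0")
    case True
    then show ?thesis using D C by simp
  next
    case False
    then have P: "P > 0" using P0 by simp
    have "(\<lambda>n. D * (C * (l powr (- e) * Lpow t (f n) powr (1 / t)))) \<longlonglongrightarrow> D * (C * (l powr (- e) * P powr (1 / t)))"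
      using P by (intro tendsto_mult tendsto_const tendsto_powr' lim2) auto
    then have "P \<le> D * (C * (l powr (- e) * P powr (1 / t)))"
      using bound by (intro LIMSEQ_le[OF lim1]) auto
    moreover have "P = P powr (1 / p) * P powr (1 / t)"
      unfolding it powr_add[symmetric] using P by simp
    ultimately have "P powr (1 / p) * P powr (1 / t) \<le> (D * (C * l powr (- e))) * P powr (1 / t)"
      by (simp add: mult.assoc)
    then show ?thesis by (rule mult_right_le_imp_le) (use P in simp)
  qed
  have "ennreal (l powr e) * Lp_norm p u = ennreal (l powr e * P powr (1 / p))"
    unfolding P_def using p by (subst Lp_norm_eq_Lpow[OF u]) (simp_all add: ennreal_mult)
  also have "\<dots> \<le> ennreal (l powr e * (D * (C * l powr (- e))))"
    by (intro ennreal_leI mult_left_mono main) auto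
  also have "l powr e * (D * (C * l powr (- e))) = C * D * (l powr e * l powr (- e))" by simp
  also have "l powr e * l powr (- e) = 1" using l by (simp flip: powr_add)
  finally show ?thesis by simp
qed

theorem theorem2p9:
  fixes \<phi> :: "'a::euclidean_space \<Rightarrow> complex" and p :: real
  assumes "DIM('a) \<ge> 2"
    and "\<phi> \<in> schwartz"
    and "closure {\<xi>. \<phi> \<xi> \<noteq> 0} \<subseteq> {\<xi>. norm \<xi> \<le> 2}"
    and "\<forall>\<xi>. norm \<xi> \<le> 1 \<longrightarrow> \<phi> \<xi> = 1"
    and "ereal p \<in> {ereal (q_exp DIM('a))..p_exp DIM('a)}"
  shows "\<exists>C>0. \<forall>l>0. \<forall>u::'a \<Rightarrow> complex. u \<in> schwartz \<longrightarrow>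
    ennreal (l powr (1 / 4)) * Bstar_norm u
    + ennreal (l powr (real DIM('a) / 2 * (1 / p - recip (p_exp DIM('a))))) * Lp_norm p u
    \<le> ennreal C * Xstar_norm \<phi> l (distr_of u)"
proof -
  define e where "e = real DIM('a) / 2 * (1 / p - recip (p_exp DIM('a)))"
  define t where "t = p / (p - 1)"
  have p2: "p > 2"
  proof -
    have "q_exp DIM('a) > 2" using assms(1) by (auto simp: q_exp_def field_simps)
    then show ?thesis using assms(5) by simp
  qed
  have supp: "norm \<xi> \<le> 2" if "\<phi> \<xi> \<noteq> 0" for \<xi>
    by (rule CollectD, rule subsetD[OF order_trans[OF closure_subset assms(3)]]) (use that in simp)
  obtain M where M: "\<And>\<xi>. cmod (\<phi> \<xi>) \<le> M" "M > 0" using schwartz_bdd[OF assms(2)] by metis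
  obtain CY where CY: "CY > 0"
    "\<And>l j f. l > 0 \<Longrightarrow> f \<in> schwartz \<Longrightarrow> (\<And>x. f x \<noteq> 0 \<Longrightarrow> norm x \<le> 2 ^ j) \<Longrightarrow>
      Y_norm \<phi> l (distr_of f) \<le> ennreal (CY * sqrt (l powr (- 1 / 2) * 2 ^ j * Lpow 2 f))"
    by (rule Y_norm_compact_support[OF assms(2-4)]) blast
  obtain CZ where CZ: "CZ > 0"
    "\<And>l f. l > 0 \<Longrightarrow> f \<in> schwartz \<Longrightarrow>
      Z_norm \<phi> l (distr_of f) \<le> ennreal (CZ * (l powr (- e) * Lpow t f powr (1 / t)))"
    unfolding e_def t_def by (rule Z_norm_Lp[OF assms(2-4) assms(1) assms(5)]) blast
  define C where "C = CY * M * sqrt 2 + CZ"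
  have C: "C > 0" using CY(1) CZ(1) M by (simp add: C_def add_pos_pos)
  show ?thesis unfolding e_def[symmetric]
  proof (intro exI[of _ C] conjI allI impI C)
    fix l :: real and u :: "'a \<Rightarrow> complex" assume l: "l > 0" and u: "u \<in> schwartz"
    have Y0: "Y_norm \<phi> l (distr_of (\<lambda>x. 0)) = 0"
      using CY(2)[OF l schwartz_zero, of 0] by simp
    have Z0: "Z_norm \<phi> l (distr_of (\<lambda>x. 0)) = 0"
      using CZ(2)[OF l schwartz_zero] by simp
    define A where "A = ennreal (l powr (1 / 4)) * Bstar_norm u + ennreal (l powr e) * Lp_norm p u"
    have "A / ennreal C \<le> dual_norm \<phi> l L"
      if L: "L \<in> X_dual \<phi> l" "\<forall>f\<in>schwartz. L (distr_of f) = distr_of u f" for L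
    proof -
      have L2: "L (distr_of f) = (LINT x|lborel. u x * f x)" if "f \<in> schwartz" for f
        using L(2) that by (simp add: distr_of_def)
      have "dual_norm \<phi> l L < \<infinity>" using L(1) by (simp add: X_dual_def)
      then obtain D where D: "dual_norm \<phi> l L = ennreal D" "D \<ge> 0"
        by (cases "dual_norm \<phi> l L") auto
      have "ennreal (l powr (1 / 4)) * Bstar_norm u \<le> ennreal (CY * M * sqrt 2 * D)"
        by (rule Bstar_norm_dual_le[OF assms(2) supp _ M CY(2)[OF l] Z0 CY(1) l u L(1) L2 D])
           (use assms(4) in auto)
      moreover have "ennreal (l powr e) * Lp_norm p u \<le> ennreal (CZ * D)"
        by (rule Lp_norm_dual_le[OF p2 t_def CZ(2)[OF l] Y0 CZ(1) l u L(1) L2 D])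
      ultimately have "A \<le> ennreal (CY * M * sqrt 2 * D) + ennreal (CZ * D)"
        unfolding A_def by (rule add_mono)
      also have "\<dots> = ennreal (CY * M * sqrt 2 * D + CZ * D)"
        using CY(1) CZ(1) M D by (intro ennreal_plus[symmetric]) auto
      also have "CY * M * sqrt 2 * D + CZ * D = C * D" by (simp add: C_def algebra_simps)
      also have "ennreal (C * D) = ennreal C * dual_norm \<phi> l L"
        using C D by (simp add: ennreal_mult)
      finally show ?thesis using C by (intro divide_le_posI_ennreal) auto
    qed
    then have "A / ennreal C \<le> Xstar_norm \<phi> l (distr_of u)"
      unfolding Xstar_norm_def by (intro INF_greatest) auto
    then have "ennreal C * (A / ennreal C) \<le> ennreal C * Xstar_norm \<phi> l (distr_of u)"
      by (rule mult_left_mono) simp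
    moreover have "ennreal C * (A / ennreal C) = A"
      using C by (simp add: ennreal_times_divide mult.commute ennreal_mult_divide_eq)
    ultimately show "ennreal (l powr (1 / 4)) * Bstar_norm u + ennreal (l powr e) * Lp_norm p u
       \<le> ennreal C * Xstar_norm \<phi> l (distr_of u)" by (simp add: A_def)
  qed
qed

end
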